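(* Let $Q\subseteq\mathbb{N}$, let $\{A_q\}$ and $\{B_q\}$ be sequences of integers with $\gcd(A_q,B_q)=1$ and $B_q>0$ for all $q$, let $\psi\colon Q\to[0,\tfrac12)$ and $\theta\colon Q\to\mathbb{R}$ be functions, and suppose \[ \sum_{q\in Q}\psi(q)\prod_{\substack{\ell\mid q,\ \ell\nmid B_q\\ \ell \text{ prime}}}\bigl(1-\ell^{-1}\bigr)<\infty . \] Let $W_Q^{\ast}(\psi,\theta)$ be the set of $x\in[0,1]$ such that \[ \left|x-\frac{p+\theta(q)}{q}\right|<\frac{\psi(q)}{q} \] holds for infinitely many pairs $(p,q)\in\mathbb{Z}\times Q$ with $\gcd(B_qp+A_q,q)=1$. Then \[ \dim_{\mathrm F}W_Q^{\ast}(\psi,\theta)=\min\{2s(Q,\psi),1\},\qquad\text{where } s(Q,\psi)=\inf\Bigl\{s\ge 0:\sum_{q\in Q}\Bigl(\frac{\psi(q)}{q}\Bigr)^{s}<\infty\Bigr\}. \]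
   Context: For $E\subseteq\mathbb{R}$, the Fourier dimension is $\dim_{\mathrm F}E=\sup\{s\in[0,1]: \exists\,\nu\in\mathcal P(E)\text{ with }|\hat\nu(\xi)|\le C_s(1+|\xi|)^{-s/2}\ \forall\xi\in\mathbb{R}\}$, where $\mathcal P(E)$ is the set of Borel probability measures on $\mathbb{R}$ giving full measure to $E$, and $\hat\nu(\xi)=\int e^{-2\pi i\xi x}\,d\nu(x)$. In the product, $\ell$ ranges over primes. *)

theory Defs
  imports "HOL-Probability.Probability" "HOL-Computational_Algebra.Primes"
begin

(* The library's char uses the kernel exp (i t x); the normalisation here is exp (-2 pi i xi x). *)
definition fourier_meas :: "real measure \<Rightarrow> real \<Rightarrow> complex" where
  "fourier_meas \<nu> \<xi> = (\<integral>x. exp (- 2 * of_real pi * \<i> * of_real \<xi> * of_real x) \<partial>\<nu>)"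

(* For a set E that is not Borel, the AE condition says that E contains a Borel set of
   measure 1; for Borel E it is just measure nu E = 1. *)
definition prob_measures_on :: "real set \<Rightarrow> real measure set" where
  "prob_measures_on E = {\<nu>. real_distribution \<nu> \<and> (AE x in \<nu>. x \<in> E)}"

(* The supremum is taken in [0,1]. Inserting 0 matters only for E = {}, where the set is
   empty and the dimension is 0 (Sup {} is not specified in type real); for E nonempty a point
   mass shows that s = 0 already belongs to the set. *)
definition fourier_dim :: "real set \<Rightarrow> real" where
  "fourier_dim E = Sup (insert 0 {s \<in> {0..1}. \<exists>\<nu> \<in> prob_measures_on E. \<exists>C. \<forall>\<xi>.
     cmod (fourier_meas \<nu> \<xi>) \<le> C * (1 + \<bar>\<xi>\<bar>) powr (- s / 2)})"

definition W_star ::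
  "(nat \<Rightarrow> int) \<Rightarrow> (nat \<Rightarrow> int) \<Rightarrow> nat set \<Rightarrow> (nat \<Rightarrow> real) \<Rightarrow> (nat \<Rightarrow> real) \<Rightarrow> real set" where
  "W_star A B Q \<psi> \<theta> = {x \<in> {0..1}. infinite {(p :: int, q :: nat). q \<in> Q \<and>
     gcd (B q * p + A q) (int q) = 1 \<and>
     \<bar>x - (of_int p + \<theta> q) / real q\<bar> < \<psi> q / real q}}"

(* Since 0 powr 0 = 0 in Isabelle, membership of s = 0 could depend on the convention for 0^0;
   the infimum does not. *)
definition conv_exponent :: "nat set \<Rightarrow> (nat \<Rightarrow> real) \<Rightarrow> real" where
  "conv_exponent Q \<psi> = Inf {s. s \<ge> 0 \<and> (\<lambda>q. (\<psi> q / real q) powr s) summable_on Q}"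

end

(* Upper bound. Let nu be a probability measure on W-star with Fourier decay |xi|^(-t/2). Testing nu
   against Fejer kernels of order about q/psi(q) centred at the admissible points (p+theta)/q
   bounds the nu-measure of the q-th layer of W-star by a constant times
   psi(q) prod(1-1/l) + d(q) (psi(q)/q)^(t/2). The frequency-zero term gives the product, and the
   other frequencies are controlled by inclusion-exclusion over the primes l | q, l not dividing
   B_q. As d(q) = O(q^eps), these bounds are summable if t > 2 s(Q,psi), and the Borel-Cantelli
   lemma gives nu(W-star) = 0, a contradiction.

   Lower bound. If sigma < s(Q,psi), then infinitely many dyadic blocks {q : psi(q)/q ~ 2^(-m)}
   have at least 2^(m tau) elements, for some tau > sigma. Average, over such a block, periodic
   tent functions of width 2^(-m) centred at the admissible points. The result has mean 1, is
   supported close to the admissible points, and its Fourier coefficients at l /= 0 are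
   o(|l|^(-sigma)) as m grows. Multiplying a fixed density on [0,1] successively by such functions
   changes its Fourier transform by an arbitrarily small multiple of (1+|xi|)^(-sigma) at each
   step, and a weak limit of the normalised products lives on W-star with this decay. *)

theory Submission
  imports Defs
begin

section \<open>Additive characters and the divisor bound\<close>

text \<open>Both bounds rest on one estimate: the exponential sum over the admissible residues
  modulo q at frequency l is at most the sum of the common divisors of q and l. For a single pair
  this can be useless (if q | l there is no cancellation at all), so it is used on average: over l
  for fixed q in the upper bound, over the q of a block for fixed l in the lower bound. The averages
  cost divisor functions and, in the second case, a logarithm; a small gap between exponents pays
  for them.

  The exponent is \<sigma> = t / 2, so t <= 1 becomes \<sigma> <= 1/2. In this range the decay (1 +
  |xi|)^(-2) of a density can give up a power \<sigma> in a convolution and keep the summable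
  exponent -3/2. Two rates are carried along: rate 2 holds for each density with a constant that may
  explode along the sequence, while rate \<sigma> holds uniformly and is all that survives in the
  limit. Each block is chosen after the density that it multiplies, so a smaller coefficient bound
  absorbs the exploding constant.\<close>

definition ee :: "real \<Rightarrow> complex" where "ee x = cis (2 * pi * x)"

lemma ee_0 [simp]: "ee 0 = 1" by (simp add: ee_def)
lemma ee_add: "ee (x + y) = ee x * ee y" by (simp add: ee_def cis_mult ring_distribs)
lemma norm_ee [simp]: "cmod (ee x) = 1" by (simp add: ee_def)
lemma ee_of_int [simp]: "ee (of_int n) = 1"
  using cos_int_2pin[of n] sin_int_2pin[of n] by (simp only: ee_def complex_eq_iff) simp
lemma ee_power: "ee x ^ n = ee (real n * x)"
  unfolding ee_def Complex.DeMoivre by (simp only: mult_ac)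
lemma ee_diff: "ee (x - y) = ee x * ee (- y)" using ee_add[of x "-y"] by simp
lemma cnj_ee: "cnj (ee x) = ee (- x)" by (simp add: ee_def cis_cnj)
lemma continuous_on_ee [continuous_intros]: "continuous_on S f \<Longrightarrow> continuous_on S (\<lambda>x. ee (f x))"
  unfolding ee_def cis_conv_exp by (intro continuous_intros)
lemma Re_ee: "Re (ee x) = cos (2 * pi * x)" by (simp add: ee_def)

lemma norm_one_minus_ee: "cmod (1 - ee x) = 2 * \<bar>sin (pi * x)\<bar>"
proof -
  have "(cmod (1 - ee x))\<^sup>2 = (1 - cos (2*pi*x))\<^sup>2 + (sin (2*pi*x))\<^sup>2"
    by (simp add: cmod_power2 ee_def)
  also have "\<dots> = 2 - 2 * cos (2 * (pi * x))"
    using sin_cos_squared_add[of "2*pi*x"] by (simp add: power2_eq_square algebra_simps)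
  also have "\<dots> = (2 * \<bar>sin (pi * x)\<bar>)\<^sup>2"
    using cos_double_sin[of "pi * x"] by (simp add: power_mult_distrib)
  finally show ?thesis by (rule power2_eq_imp_eq) auto
qed

lemma ee_eq_1_iff: "ee x = 1 \<longleftrightarrow> x \<in> \<int>"
proof -
  have "ee x = 1 \<longleftrightarrow> sin (pi * x) = 0"
    using norm_one_minus_ee[of x] by auto
  also have "\<dots> \<longleftrightarrow> x \<in> \<int>"
    by (auto simp: sin_zero_iff_int2 Ints_def mult.commute)
  finally show ?thesis .
qed

lemma sum_ee_root_of_unity:
  fixes l :: int assumes "n > 0"
  shows "(\<Sum>i<n. ee (real_of_int l * real i / real n)) = (if int n dvd l then of_nat n else 0)"
proof -
  define z where "z = ee (real_of_int l / real n)"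
  have eq: "ee (real_of_int l * real i / real n) = z ^ i" for i
    by (simp add: z_def ee_power mult.commute)
  have z1: "z = 1 \<longleftrightarrow> int n dvd l"
  proof -
    have "real_of_int l / real n \<in> \<int> \<longleftrightarrow> int n dvd l"
    proof
      assume "real_of_int l / real n \<in> \<int>"
      then obtain k :: int where "real_of_int l / real n = of_int k" by (auto elim: Ints_cases)
      hence "real_of_int l = of_int (k * int n)" using assms by (simp add: field_simps)
      hence "l = k * int n" using of_int_eq_iff by blast
      thus "int n dvd l" by simp
    qed (use assms in \<open>auto elim!: dvdE\<close>)
    thus ?thesis by (simp add: z_def ee_eq_1_iff)
  qed
  have zn: "z ^ n = 1"
    using assms by (simp add: z_def ee_power)
  show ?thesis
  proof (cases "z = 1")
    case True thus ?thesis using z1 by (simp add: eq)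
  next
    case False
    thus ?thesis using z1 zn by (simp add: eq sum_gp_strict)
  qed
qed

section \<open>The bound d(n) = O(n^\<epsilon>) for the number of divisors\<close>

lemma divisor_card_primepow_mult:
  fixes p m :: nat assumes "prime p" "m > 0"
  shows "card {d. d dvd p ^ a * m} \<le> (a + 1) * card {d. d dvd m}"
proof -
  have "{d. d dvd p ^ a * m} \<subseteq> (\<lambda>(i, d). p ^ i * d) ` ({..a} \<times> {d. d dvd m})"
  proof
    fix d assume "d \<in> {d. d dvd p ^ a * m}"
    then obtain b c where "d = b * c" "b dvd p ^ a" "c dvd m"
      using division_decomp[of d "p ^ a" m] by blast
    moreover obtain i where "i \<le> a" "b = p ^ i"
      using divides_primepow_nat[OF assms(1)] \<open>b dvd p ^ a\<close> by blast
    ultimately show "d \<in> (\<lambda>(i, d). p ^ i * d) ` ({..a} \<times> {d. d dvd m})" by force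
  qed
  moreover have fin: "finite ({..a} \<times> {d. d dvd m})" using assms by auto
  ultimately have "card {d. d dvd p ^ a * m} \<le> card ({..a} \<times> {d. d dvd m})"
    using surj_card_le by blast
  thus ?thesis by (simp add: card_cartesian_product)
qed

text \<open>The quotient d(n) / n^\<epsilon> is a product of (a + 1) / p^(a \<epsilon>) over the
  prime powers p^a exactly dividing n. For p >= 2^(1/\<epsilon>) such a factor is at most 1, as a +
  1 <= 2^a; for each of the at most M smaller primes it is at most K. Hence C = K^M.\<close>

lemma divisor_bound:
  fixes \<epsilon> :: real assumes "\<epsilon> > 0"
  obtains C where "C > 0" "\<And>n. n > 0 \<Longrightarrow> real (card {d. d dvd n}) \<le> C * real n powr \<epsilon>"
proof -
  define M where "M = nat \<lceil>2 powr (1 / \<epsilon>)\<rceil>"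
  have M: "real p powr \<epsilon> \<ge> 2" if "p \<ge> M" for p
  proof -
    have "2 powr (1 / \<epsilon>) \<le> real p" using that unfolding M_def by linarith
    hence "(2 powr (1 / \<epsilon>)) powr \<epsilon> \<le> real p powr \<epsilon>" using assms by (intro powr_mono2) auto
    thus ?thesis using assms by (simp add: powr_powr)
  qed
  \<comment> \<open>The inequality 1 + y <= exp y at y = a * \<epsilon> * ln 2 gives a + 1 <= K *
    2^(a \<epsilon>), whatever the prime.\<close>
  define K where "K = 1 + 1 / (\<epsilon> * ln 2)"
  have K1: "K \<ge> 1" using assms by (simp add: K_def)
  have K: "real a + 1 \<le> K * (real p powr \<epsilon>) ^ a" if "p \<ge> 2" for a p :: nat
  proof -
    have pe: "2 powr \<epsilon> \<le> real p powr \<epsilon>" using that assms by (intro powr_mono2) auto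
    have "1 + real a * (\<epsilon> * ln 2) \<le> exp (real a * (\<epsilon> * ln 2))" by (rule exp_ge_add_one_self)
    also have "\<dots> = (2 powr \<epsilon>) ^ a" by (simp add: powr_def exp_of_nat_mult)
    also have "\<dots> \<le> (real p powr \<epsilon>) ^ a" using pe by (intro power_mono) auto
    finally have 1: "1 + real a * (\<epsilon> * ln 2) \<le> (real p powr \<epsilon>) ^ a" .
    have "real a + 1 \<le> K * (1 + real a * (\<epsilon> * ln 2))"
      using assms by (simp add: K_def field_simps)
    also have "\<dots> \<le> K * (real p powr \<epsilon>) ^ a" using 1 K1 by (intro mult_left_mono) auto
    finally show ?thesis .
  qed
  \<comment> \<open>The induction removes one prime with its full power. The exponent of K counts
    only primes below M, so it drops exactly when the removed prime is small.\<close>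
  have main: "real (card {d. d dvd n}) \<le> K ^ card {p. prime p \<and> p dvd n \<and> p < M} * real n powr \<epsilon>" 
    if "n > 0" for n
    using that
  proof (induction n rule: less_induct)
    case (less n)
    show ?case
    proof (cases "n = 1")
      case True thus ?thesis using K1 by simp
    next
      case False
      then obtain p where p: "prime p" "p dvd n" using prime_factor_nat by blast
      obtain m where m: "n = p ^ multiplicity p n * m" "\<not> p dvd m"
        using multiplicity_decompose'[of n p] less.prems p not_prime_unit[of p] by blast
      define a where "a = multiplicity p n"
      have a: "a \<noteq> 0" using p less.prems unfolding a_def
        by (simp add: prime_multiplicity_gt_zero_iff prime_imp_prime_elem)
      have m0: "m > 0" using m less.prems by (metis gr0I mult_0_right)
      have p2: "p \<ge> 2" using p prime_ge_2_nat by blast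
      have nm: "n = p ^ a * m" using m by (simp add: a_def)
      have "p ^ a > 1" using a p2 by (metis one_less_power prime_gt_1_nat p(1) gr0I)
      hence "m < n" using m0 nm by simp
      note IH = less.IH[OF this m0]
      let ?S = "\<lambda>n. {p. prime p \<and> p dvd n \<and> p < M}"
      have powr: "real n powr \<epsilon> = (real p powr \<epsilon>) ^ a * real m powr \<epsilon>"
      proof -
        have "real (p ^ a) powr \<epsilon> = (real p powr \<epsilon>) ^ a"
          using p2 by (simp add: powr_power powr_powr mult.commute flip: powr_realpow)
        thus ?thesis by (simp add: nm powr_mult)
      qed
      have pm: "x dvd n \<longleftrightarrow> x dvd m \<or> x = p" if "prime x" for x
        using that p a by (auto simp: nm prime_dvd_mult_iff prime_dvd_power_iff primes_dvd_imp_eq)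
      have "real (card {d. d dvd n}) \<le> (real a + 1) * real (card {d. d dvd m})"
        using divisor_card_primepow_mult[OF p(1) m0, of a, folded nm]
        by (simp flip: of_nat_le_iff [where 'a = real] add: algebra_simps)
      also have "\<dots> \<le> (real a + 1) * (K ^ card (?S m) * real m powr \<epsilon>)"
        using IH by (intro mult_left_mono) auto
      also have "\<dots> \<le> K ^ card (?S n) * real n powr \<epsilon>"
      proof (cases "p < M")
        case True
        have "?S n = insert p (?S m)" using p True pm by auto
        moreover have "p \<notin> ?S m" using m by auto
        ultimately have c: "card (?S n) = Suc (card (?S m))" by simp
        have "(real a + 1) * (K ^ card (?S m) * real m powr \<epsilon>) 
          \<le> (K * (real p powr \<epsilon>) ^ a) * (K ^ card (?S m) * real m powr \<epsilon>)"
          using K[OF p2] K1 by (intro mult_right_mono) auto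
        thus ?thesis by (simp add: c powr mult_ac)
      next
        case False
        have "?S n = ?S m" using False pm by auto
        moreover have "real a + 1 \<le> (real p powr \<epsilon>) ^ a"
        proof -
          have "real a + 1 \<le> 2 ^ a" 
            using Suc_leI[OF less_exp[of a]] by (metis add.commute of_nat_Suc of_nat_le_numeral_power_cancel_iff)
          also have "\<dots> \<le> (real p powr \<epsilon>) ^ a" using M[of p] False by (intro power_mono) auto
          finally show ?thesis .
        qed
        hence "(real a + 1) * (K ^ card (?S m) * real m powr \<epsilon>) 
          \<le> ((real p powr \<epsilon>) ^ a) * (K ^ card (?S m) * real m powr \<epsilon>)"
          using K1 by (intro mult_right_mono) auto
        ultimately show ?thesis by (simp add: powr mult_ac)
      qed
      finally show ?thesis .
    qed
  qed
  show ?thesis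
  proof (rule that[of "K ^ M"])
    show "K ^ M > 0" using K1 by simp
    fix n :: nat assume n: "n > 0"
    have "card {p. prime p \<and> p dvd n \<and> p < M} \<le> card {..<M}" by (intro card_mono) auto
    hence "K ^ card {p. prime p \<and> p dvd n \<and> p < M} \<le> K ^ M"
      using K1 by (intro power_increasing) auto
    thus "real (card {d. d dvd n}) \<le> K ^ M * real n powr \<epsilon>"
      using main[OF n] by (meson mult_right_mono order_trans powr_ge_zero)
  qed
qed

section \<open>Exponential sums over admissible residues\<close>

lemma prod_primes_dvd_iff:
  fixes T :: "nat set" and x :: int
  assumes "finite T" "\<And>p. p \<in> T \<Longrightarrow> prime p"
  shows "prod int T dvd x \<longleftrightarrow> (\<forall>p\<in>T. int p dvd x)"
  using assms
proof (induction T rule: finite_induct)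
  case (insert p T)
  have "coprime (int p) (prod int T)"
    using insert by (intro prod_coprime_right) (metis insertCI primes_coprime coprime_int_iff)
  moreover have "int p dvd x \<and> prod int T dvd x \<Longrightarrow> int p * prod int T dvd x"
    using calculation divides_mult by blast
  ultimately have "int p * prod int T dvd x \<longleftrightarrow> int p dvd x \<and> prod int T dvd x"
    by (meson dvd_mult_left dvd_mult_right)
  thus ?case using insert by simp
qed auto

lemma inj_on_prod_primes:
  assumes "finite L" "\<And>p::nat. p \<in> L \<Longrightarrow> prime p"
  shows "inj_on (\<lambda>T. \<Prod>T) (Pow L)"
proof (rule inj_on_inverseI)
  fix T assume T: "T \<in> Pow L"
  hence fT: "finite T" using assms finite_subset by blast
  have "prime p \<and> p dvd \<Prod>T \<longleftrightarrow> p \<in> T" for p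
  proof
    assume p: "prime p \<and> p dvd \<Prod>T"
    then obtain x where "x \<in> T" "p dvd x" using fT by (auto simp: prime_dvd_prod_iff)
    thus "p \<in> T" using p T assms primes_dvd_imp_eq by blast
  qed (use T assms fT in \<open>auto intro: dvd_prodI\<close>)
  thus "{p. prime p \<and> p dvd \<Prod>T} = T" by auto
qed

definition admissible_residues :: "int \<Rightarrow> int \<Rightarrow> nat \<Rightarrow> int set" where
  "admissible_residues a b q = {p \<in> {0..<int q}. gcd (b * p + a) (int q) = 1}"

text \<open>For a = 0 and b = 1 this is Ramanujan's sum c_q(l).\<close>

definition residue_exp_sum :: "int \<Rightarrow> int \<Rightarrow> nat \<Rightarrow> int \<Rightarrow> complex" where
  "residue_exp_sum a b q l = (\<Sum>p\<in>admissible_residues a b q. ee (- (real_of_int l * real_of_int p / real q)))"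

lemma finite_admissible_residues [simp]: "finite (admissible_residues a b q)"
  unfolding admissible_residues_def by (rule finite_subset[of _ "{0..<int q}"]) auto

lemma residue_exp_sum_0_card: "residue_exp_sum a b q 0 = of_nat (card (admissible_residues a b q))"
  by (simp add: residue_exp_sum_def)

text \<open>Bezout gives an inverse u of b modulo d, so the solutions form the single class of -a *
  u modulo d, and this class meets the interval of length d * e in e points.\<close>

lemma progression_eq:
  fixes a b :: int and d e :: nat
  assumes "coprime b (int d)" "d > 0"
  obtains p0 where "{p \<in> {0..<int (d * e)}. int d dvd b * p + a} = (\<lambda>i. p0 + int d * int i) ` {..<e}"
proof -
  obtain u v where uv: "u * b + v * int d = 1"
    using bezout_int[of b "int d"] assms by auto
  define p0 where "p0 = (- a * u) mod int d"
  have p0: "0 \<le> p0" "p0 < int d" using assms by (auto simp: p0_def)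
  have iff: "int d dvd b * p + a \<longleftrightarrow> int d dvd p - p0" for p
  proof -
    have "int d dvd (- a * u) - p0" unfolding p0_def by (simp add: minus_mod_eq_mult_div)
    then obtain k where "- a * u - p0 = int d * k" by (rule dvdE)
    hence k: "p0 = - a * u - int d * k" by simp
    have "b * p + a = b * (p - p0) + int d * (a * v - b * k)"
    proof -
      have "a = a * (u * b + v * int d)" using uv by simp
      thus ?thesis unfolding k by (simp add: algebra_simps)
    qed
    hence "int d dvd b * p + a \<longleftrightarrow> int d dvd b * (p - p0)" by (simp add: dvd_add_left_iff)
    also have "\<dots> \<longleftrightarrow> int d dvd p - p0"
      using assms by (intro coprime_dvd_mult_right_iff) (simp add: coprime_commute)
    finally show ?thesis .
  qed
  have "{p \<in> {0..<int (d * e)}. int d dvd b * p + a} = (\<lambda>i. p0 + int d * int i) ` {..<e}"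
  proof (intro equalityI subsetI)
    fix p assume "p \<in> {p \<in> {0..<int (d * e)}. int d dvd b * p + a}"
    hence p: "0 \<le> p" "p < int d * int e" "int d dvd p - p0" by (auto simp: iff)
    then obtain k where k: "p = p0 + int d * k" by (metis diff_eq_eq dvdE add.commute)
    have "k \<ge> 0"
    proof (rule ccontr)
      assume "\<not> k \<ge> 0"
      hence "int d * k \<le> int d * (-1)" by (intro mult_left_mono) auto
      thus False using p p0 k by simp
    qed
    have "k < int e"
    proof (rule ccontr)
      assume "\<not> k < int e"
      hence "int d * int e \<le> int d * k" by (intro mult_left_mono) auto
      thus False using p p0 k by linarith
    qed
    thus "p \<in> (\<lambda>i. p0 + int d * int i) ` {..<e}" using k \<open>k \<ge> 0\<close>
      by (intro image_eqI[of _ _ "nat k"]) auto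
  next
    fix p assume "p \<in> (\<lambda>i. p0 + int d * int i) ` {..<e}"
    then obtain i where i: "i < e" "p = p0 + int d * int i" by auto
    have "int d * int i + int d \<le> int d * int e"
    proof -
      have "int d * (int i + 1) \<le> int d * int e" using i by (intro mult_left_mono) auto
      thus ?thesis by (simp add: algebra_simps)
    qed
    thus "p \<in> {p \<in> {0..<int (d * e)}. int d dvd b * p + a}"
      using p0 i by (auto simp: iff)
  qed
  thus ?thesis using that by blast
qed

text \<open>Apart from the phase of the first term, the sum is a sum over i < e of roots of unity,
  because l * d * i / (d * e) = l * i / e. The starting point is unknown, so only the modulus is
  available in general; at l = 0 the phase is 1 and the value itself is known.\<close>

lemma progression_exp_sum:
  fixes a b :: int and d e :: nat and l :: int
  assumes "coprime b (int d)" "d > 0" "e > 0"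
  defines "S \<equiv> \<lambda>l. \<Sum>p | p \<in> {0..<int (d * e)} \<and> int d dvd b * p + a. 
      ee (- (real_of_int l * real_of_int p / real (d * e)))"
  shows "cmod (S l) = (if int e dvd l then real e else 0)" and "S 0 = of_nat e"
proof -
  obtain p0 where p0: "{p \<in> {0..<int (d * e)}. int d dvd b * p + a} = (\<lambda>i. p0 + int d * int i) ` {..<e}"
    using progression_eq[OF assms(1,2)] by blast
  have inj: "inj_on (\<lambda>i. p0 + int d * int i) {..<e}" using assms by (auto simp: inj_on_def)
  have S: "S l = ee (- (real_of_int l * real_of_int p0 / real (d * e))) *
      (\<Sum>i<e. ee (real_of_int (- l) * real i / real e))" for l
  proof -
    have "S l = (\<Sum>i<e. ee (- (real_of_int l * real_of_int (p0 + int d * int i) / real (d * e))))"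
      unfolding S_def p0 using inj by (simp add: sum.reindex)
    also have "\<dots> = (\<Sum>i<e. ee (- (real_of_int l * real_of_int p0 / real (d * e))) * 
         ee (real_of_int (- l) * real i / real e))"
    proof (intro sum.cong refl)
      fix i
      have "- (real_of_int l * real_of_int (p0 + int d * int i) / real (d * e)) = 
        - (real_of_int l * real_of_int p0 / real (d * e)) + real_of_int (- l) * real i / real e"
        using assms(2,3) by (simp add: field_simps)
      thus "ee (- (real_of_int l * real_of_int (p0 + int d * int i) / real (d * e))) = 
         ee (- (real_of_int l * real_of_int p0 / real (d * e))) * ee (real_of_int (- l) * real i / real e)"
        by (simp only: ee_add)
    qed
    finally show ?thesis by (simp add: sum_distrib_left)
  qed
  show "cmod (S l) = (if int e dvd l then real e else 0)"
    unfolding S sum_ee_root_of_unity[OF assms(3)] by (simp add: norm_mult)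
  show "S 0 = of_nat e" unfolding S sum_ee_root_of_unity[OF assms(3)] by simp
qed

section \<open>Inclusion-exclusion over the primes that restrict an admissible residue\<close>

context
  fixes a b :: int and q :: nat
  assumes q0: "q > 0" and ab: "gcd a b = 1"
begin

private definition L where "L = {l. prime l \<and> l dvd q \<and> \<not> int l dvd b}"

private lemma L_finite: "finite L"
  unfolding L_def using q0 by (intro finite_subset[OF _ finite_divisors_nat[OF q0]]) auto

private lemma L_prime: "p \<in> L \<Longrightarrow> prime p"
  by (simp add: L_def)

text \<open>A prime factor of q that divides b never divides b * p + a, since it would then divide a
  as well, against gcd a b = 1. Only the primes in \<open>L\<close> impose a condition on p.\<close>

private lemma gcd_iff: "gcd (b * p + a) (int q) = 1 \<longleftrightarrow> (\<forall>l\<in>L. \<not> int l dvd b * p + a)"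
proof
  assume g: "gcd (b * p + a) (int q) = 1"
  show "\<forall>l\<in>L. \<not> int l dvd b * p + a"
  proof (intro ballI notI)
    fix l assume "l \<in> L" "int l dvd b * p + a"
    hence "int l dvd gcd (b * p + a) (int q)" by (auto simp: L_def)
    thus False using g \<open>l \<in> L\<close> L_prime[of l] by (simp add: prime_nat_iff)
  qed
next
  assume R: "\<forall>l\<in>L. \<not> int l dvd b * p + a"
  show "gcd (b * p + a) (int q) = 1"
  proof (rule ccontr)
    assume "gcd (b * p + a) (int q) \<noteq> 1"
    hence "nat (gcd (b * p + a) (int q)) \<noteq> 1" by (metis gcd_ge_0_int int_nat_eq of_nat_1)
    then obtain l where l: "prime l" "l dvd nat (gcd (b * p + a) (int q))"
      using prime_factor_nat by blast
    hence "int l dvd gcd (b * p + a) (int q)" by (metis gcd_ge_0_int int_dvd_int_iff nat_0_le)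
    hence l2: "int l dvd b * p + a" "int l dvd int q" by auto
    have "\<not> int l dvd b"
    proof
      assume "int l dvd b"
      hence "int l dvd a" using l2(1) by (simp add: dvd_add_right_iff)
      hence "int l dvd gcd a b" using \<open>int l dvd b\<close> by simp
      thus False using ab l(1) by (simp add: prime_nat_iff)
    qed
    hence "l \<in> L" using l l2 by (simp add: L_def)
    thus False using R l2 by blast
  qed
qed

private lemma prod_T:
  assumes "T \<subseteq> L"
  shows "\<Prod>T dvd q" "coprime b (int (\<Prod>T))" "\<Prod>T > 0"
proof -
  have fT: "finite T" using assms L_finite finite_subset by blast
  have "prod int T dvd int q"
    using assms prod_primes_dvd_iff[OF fT, of "int q"] by (auto simp: L_def)
  hence "int (\<Prod>T) dvd int q" by simp
  thus "\<Prod>T dvd q" by (simp only: int_dvd_int_iff)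
  have "coprime b (\<Prod>x\<in>T. int x)"
    
  proof (rule prod_coprime_right)
    fix l assume "l \<in> T"
    hence "coprime (int l) b" using assms by (intro prime_imp_coprime) (auto simp: L_def)
    thus "coprime b (int l)" by (simp add: coprime_commute)
  qed
  thus "coprime b (int (\<Prod>T))" by simp
  show "\<Prod>T > 0" using assms by (intro prod_pos) (auto simp: L_def prime_gt_0_nat)
qed

text \<open>The indicator of admissibility is the product over l in \<open>L\<close> of 1 -
  [l | b * p + a]. Expanding it gives one term for each subset T, and the conditions for the primes
  in T merge into divisibility by their product.\<close>

private lemma residue_exp_sum_expand: 
  "residue_exp_sum a b q l = (\<Sum>T\<in>Pow L. (-1) ^ card T * 
     (\<Sum>p | p \<in> {0..<int q} \<and> prod int T dvd b * p + a. ee (- (real_of_int l * real_of_int p / real q))))"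
proof -
  let ?E = "\<lambda>p. ee (- (real_of_int l * real_of_int p / real q))"
  have ind: "(of_bool (gcd (b * p + a) (int q) = 1) :: complex) = 
      (\<Sum>T\<in>Pow L. (-1) ^ card T * of_bool (prod int T dvd b * p + a))" for p
  proof -
    have "(of_bool (gcd (b * p + a) (int q) = 1) :: complex) = 
       (\<Prod>l\<in>L. - of_bool (int l dvd b * p + a) + 1)"
      using L_finite by (auto simp: gcd_iff prod_zero_iff)
    also have "\<dots> = (\<Sum>T\<in>Pow L. (\<Prod>l\<in>T. - of_bool (int l dvd b * p + a)))"
      using prod_add[OF L_finite, of "\<lambda>l. - of_bool (int l dvd b * p + a) :: complex" "\<lambda>_. 1"] by simp
    also have "\<dots> = (\<Sum>T\<in>Pow L. (-1) ^ card T * of_bool (prod int T dvd b * p + a))"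
    proof (intro sum.cong refl)
      fix T assume "T \<in> Pow L"
      hence T: "finite T" "\<And>p. p \<in> T \<Longrightarrow> prime p" using L_finite L_prime finite_subset by blast+
      have "(\<Prod>l\<in>T. - of_bool (int l dvd b * p + a) :: complex) = 
         (-1) ^ card T * (\<Prod>l\<in>T. of_bool (int l dvd b * p + a))"
        using prod.distrib[of "\<lambda>_. -1 :: complex" "\<lambda>l. of_bool (int l dvd b * p + a)" T] by simp
      also have "(\<Prod>l\<in>T. of_bool (int l dvd b * p + a) :: complex) = of_bool (prod int T dvd b * p + a)"
        using T by (subst prod_primes_dvd_iff) (auto simp: prod_zero_iff)
      finally show "(\<Prod>l\<in>T. - of_bool (int l dvd b * p + a) :: complex) = 
         (-1) ^ card T * of_bool (prod int T dvd b * p + a)" .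
    qed
    finally show ?thesis .
  qed
  have "residue_exp_sum a b q l = (\<Sum>p\<in>{0..<int q}. of_bool (gcd (b * p + a) (int q) = 1) * ?E p)"
    unfolding residue_exp_sum_def admissible_residues_def by (intro sum.mono_neutral_cong_left) auto
  also have "\<dots> = (\<Sum>p\<in>{0..<int q}. \<Sum>T\<in>Pow L. (-1) ^ card T * (of_bool (prod int T dvd b * p + a) * ?E p))"
    by (subst ind) (simp add: sum_distrib_right mult.assoc)
  also have "\<dots> = (\<Sum>T\<in>Pow L. \<Sum>p\<in>{0..<int q}. (-1) ^ card T * (of_bool (prod int T dvd b * p + a) * ?E p))"
    by (rule sum.swap)
  also have "\<dots> = (\<Sum>T\<in>Pow L. (-1) ^ card T * (\<Sum>p\<in>{0..<int q}. of_bool (prod int T dvd b * p + a) * ?E p))"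
    by (simp only: sum_distrib_left)
  also have "(\<lambda>T. \<Sum>p\<in>{0..<int q}. of_bool (prod int T dvd b * p + a) * ?E p) = 
     (\<lambda>T. \<Sum>p | p \<in> {0..<int q} \<and> prod int T dvd b * p + a. ?E p)"
    by (intro ext sum.mono_neutral_cong_right) auto
  finally show ?thesis .
qed

private lemma div_dvd: "T \<subseteq> L \<Longrightarrow> q div \<Prod>T dvd q"
  using prod_T(1)[of T] by (metis dvd_div_mult_self dvd_triv_left)

text \<open>A subset T contributes e = q / prod T in modulus if e | l, and 0 otherwise. Distinct T
  give distinct divisors e of q, so dropping the signs leaves at most the sum of the common divisors
  of q and l.\<close>

lemma norm_residue_exp_sum_le: "cmod (residue_exp_sum a b q l) \<le> (\<Sum>e | e dvd q \<and> int e dvd l. real e)"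
proof -
  have "cmod (residue_exp_sum a b q l) \<le> (\<Sum>T\<in>Pow L. (if int (q div \<Prod>T) dvd l then real (q div \<Prod>T) else 0))"
    unfolding residue_exp_sum_expand
  proof (intro sum_norm_le)
    fix T assume "T \<in> Pow L"
    note T = prod_T[of T] 
    have e: "q = \<Prod>T * (q div \<Prod>T)" "q div \<Prod>T > 0" 
      using T \<open>T \<in> Pow L\<close> q0 by (auto simp: div_greater_zero_iff dvd_imp_le)
    show "cmod ((-1) ^ card T * 
     (\<Sum>p | p \<in> {0..<int q} \<and> prod int T dvd b * p + a. ee (- (real_of_int l * real_of_int p / real q))))
      \<le> (if int (q div \<Prod>T) dvd l then real (q div \<Prod>T) else 0)"
      using progression_exp_sum(1)[of b "\<Prod>T" "q div \<Prod>T" l a] T \<open>T \<in> Pow L\<close> e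
      by (simp add: norm_mult norm_power)
  qed
  also have "\<dots> = (\<Sum>e\<in>(\<lambda>T. q div \<Prod>T) ` Pow L. (if int e dvd l then real e else 0))"
  proof (subst sum.reindex)
    show "inj_on (\<lambda>T. q div \<Prod>T) (Pow L)"
    proof (rule inj_onI)
      fix S T assume ST: "S \<in> Pow L" "T \<in> Pow L" "q div \<Prod>S = q div \<Prod>T"
      hence "\<Prod>S dvd q" "\<Prod>T dvd q" "\<Prod>S > 0" using prod_T by auto
      hence "q = \<Prod>S * (q div \<Prod>S)" "q = \<Prod>T * (q div \<Prod>S)" using ST(3) by auto
      hence "\<Prod>S = \<Prod>T" using q0 by (metis mult_0_right mult_cancel2 nat_less_le)
      thus "S = T" using inj_onD[OF inj_on_prod_primes[OF L_finite L_prime]] ST by blast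
    qed
  qed (simp add: o_def)
  also have "\<dots> \<le> (\<Sum>e | e dvd q. (if int e dvd l then real e else 0))"
    using q0 prod_T by (intro sum_mono2) (auto intro!: div_dvd)
  also have "\<dots> = (\<Sum>e | e dvd q \<and> int e dvd l. real e)"
    using q0 by (simp add: sum.inter_filter[symmetric])
  finally show ?thesis .
qed

text \<open>Here the signs must be kept: at frequency 0 the signed sum over T factors again, into
  the Euler product of the convergence hypothesis.\<close>

lemma residue_exp_sum_0: "residue_exp_sum a b q 0 = of_real (real q * (\<Prod>l | prime l \<and> l dvd q \<and> \<not> int l dvd b. 1 - 1 / real l))"
proof -
  have "residue_exp_sum a b q 0 = (\<Sum>T\<in>Pow L. (-1) ^ card T * of_nat (q div \<Prod>T))"
    unfolding residue_exp_sum_expand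
  proof (intro sum.cong refl, goal_cases)
    case (1 T)
    note T = prod_T[of T] 
    have e: "q = \<Prod>T * (q div \<Prod>T)" "q div \<Prod>T > 0" 
      using T 1 q0 by (auto simp: div_greater_zero_iff dvd_imp_le)
    show ?case using progression_exp_sum(2)[of b "\<Prod>T" "q div \<Prod>T" a] T 1 e by simp
  qed
  also have "\<dots> = of_real (\<Sum>T\<in>Pow L. real q * (\<Prod>l\<in>T. - 1 / real l))"
    unfolding of_real_sum
  proof (intro sum.cong refl)
    fix T assume "T \<in> Pow L"
    note T = prod_T[of T] 
    have "real (q div \<Prod>T) = real q / real (\<Prod>T)"
      using T \<open>T \<in> Pow L\<close> by (intro real_of_nat_div) auto
    moreover have "(\<Prod>l\<in>T. - 1 / real l) = (-1) ^ card T / real (\<Prod>T)"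
      using prod_dividef[of "\<lambda>_. - 1 :: real" real T] by simp
    ultimately have "real q * (\<Prod>l\<in>T. - 1 / real l) = (-1) ^ card T * real (q div \<Prod>T)"
      by simp
    thus "(-1) ^ card T * of_nat (q div \<Prod>T) = complex_of_real (real q * (\<Prod>l\<in>T. - 1 / real l))"
      by (simp only: of_real_mult of_real_power of_real_minus of_real_1 of_real_of_nat_eq)
  qed
  also have "(\<Sum>T\<in>Pow L. real q * (\<Prod>l\<in>T. - 1 / real l)) = real q * (\<Prod>l\<in>L. - 1 / real l + 1)"
    using prod_add[OF L_finite, of "\<lambda>l. - 1 / real l" "\<lambda>_. 1"] by (simp add: sum_distrib_left)
  finally show ?thesis by (simp add: L_def)
qed

text \<open>Each factor \<open>1 - 1 / l\<close> is at least \<open>1 / 2\<close>, and the squarefree divisors already give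
  \<open>2 ^ card L\<close> divisors.\<close>

lemma card_admissible_residues_ge: "real q \<le> real (card (admissible_residues a b q)) * real (card {d. d dvd q})"
proof -
  have c: "real (card (admissible_residues a b q)) = real q * (\<Prod>l\<in>L. 1 - 1 / real l)"
  proof -
    have "complex_of_real (real (card (admissible_residues a b q))) = of_real (real q * (\<Prod>l\<in>L. 1 - 1 / real l))"
      using residue_exp_sum_0 residue_exp_sum_0_card by (simp add: L_def)
    thus ?thesis by (simp only: of_real_eq_iff)
  qed
  have "(\<Prod>l\<in>L. 1 / 2) \<le> (\<Prod>l\<in>L. 1 - 1 / real l)"
  proof (intro prod_mono conjI)
    fix l assume "l \<in> L"
    hence "real l \<ge> 2" using L_prime prime_ge_2_nat by fastforce
    thus "1 / 2 \<le> 1 - 1 / real l" by (simp add: field_simps)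
  qed auto
  hence 1: "1 / 2 ^ card L \<le> (\<Prod>l\<in>L. 1 - 1 / real l)" by (simp add: power_divide)
  have "card ((\<lambda>T. \<Prod>T) ` Pow L) \<le> card {d. d dvd q}"
    using q0 prod_T by (intro card_mono) auto
  moreover have "card ((\<lambda>T. \<Prod>T) ` Pow L) = 2 ^ card L"
    using card_image[OF inj_on_prod_primes[OF L_finite L_prime]] L_finite by (simp add: card_Pow)
  ultimately have 2: "2 ^ card L \<le> real (card {d. d dvd q})"
    by (metis of_nat_le_iff of_nat_numeral of_nat_power)
  have "1 \<le> (\<Prod>l\<in>L. 1 - 1 / real l) * 2 ^ card L" using 1 by (simp add: field_simps)
  also have "\<dots> \<le> (\<Prod>l\<in>L. 1 - 1 / real l) * real (card {d. d dvd q})"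
    using 2 1 by (intro mult_left_mono) (auto intro: order_trans[OF _ 1])
  finally have "real q * 1 \<le> real q * ((\<Prod>l\<in>L. 1 - 1 / real l) * real (card {d. d dvd q}))"
    by (intro mult_left_mono) auto
  thus ?thesis by (simp add: c mult.assoc)
qed

end

lemma sum_multiples:
  fixes f :: "nat \<Rightarrow> 'a::comm_monoid_add"
  assumes "e > 0"
  shows "(\<Sum>i | i \<in> {1..N} \<and> e dvd i. f i) = (\<Sum>j\<in>{1..N div e}. f (e * j))"
  by (rule sum.reindex_bij_witness[of _ "\<lambda>j. e * j" "\<lambda>i. i div e"])
    (use assms in \<open>auto simp: less_eq_div_iff_mult_less_eq div_greater_zero_iff dvd_imp_le mult.commute div_le_mono Suc_le_eq\<close>)

section \<open>The Fejer kernel and periodic tents\<close>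

text \<open>The Fourier coefficient at k of the indicator of a window of length r around 0, divided
  by r. Its square is the coefficient of the convolution of two such windows, the tent supported in
  [-r, r]; the value 1 at k = 0 is the common mass.\<close>

definition sinc_coeff :: "real \<Rightarrow> int \<Rightarrow> real" where
  "sinc_coeff r k = (if k = 0 then 1 else sin (pi * of_int k * r) / (pi * of_int k * r))"

lemma has_integral_cos_window:
  fixes k :: int assumes "r > 0"
  shows "((\<lambda>y. cos (2 * pi * of_int k * y)) has_integral 
     r * (sinc_coeff r k * cos (2 * pi * of_int k * x))) {x - r / 2..x + r / 2}"
proof (cases "k = 0")
  case True
  have "((\<lambda>y::real. 1::real) has_integral r) {x - r / 2..x + r / 2}"
    using has_integral_const_real[of "1::real" "x - r/2" "x + r/2"] assms by simp
  thus ?thesis using True by (simp add: sinc_coeff_def)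
next
  case False
  define w where "w = 2 * pi * of_int k"
  have w: "w \<noteq> 0" using False by (simp add: w_def)
  have "((\<lambda>y. cos (w * y)) has_integral (sin (w * (x + r/2)) / w - sin (w * (x - r/2)) / w)) {x - r / 2..x + r / 2}"
    using assms w by (intro fundamental_theorem_of_calculus)
      (auto intro!: derivative_eq_intros simp: has_real_derivative_iff_has_vector_derivative[symmetric])
  moreover have "sin (w * (x + r/2)) / w - sin (w * (x - r/2)) / w = r * (sinc_coeff r k * cos (w * x))"
  proof -
    have "sin (w * (x + r/2)) - sin (w * (x - r/2)) = 2 * cos (w * x) * sin (w * r / 2)"
      by (simp add: ring_distribs sin_add sin_diff)
    moreover have "w * r / 2 = pi * of_int k * r" by (simp add: w_def)
    ultimately have "(sin (w * (x + r/2)) - sin (w * (x - r/2))) / w = 2 * cos (w * x) * sin (pi * of_int k * r) / w" by simp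
    thus ?thesis using False assms by (simp add: sinc_coeff_def w_def diff_divide_distrib[symmetric])
  qed
  ultimately show ?thesis by (simp add: w_def)
qed

text \<open>Averaging a cosine polynomial over a window of length \<open>r\<close> multiplies its coefficients by
  \<open>sinc_coeff r\<close>, so doing it twice to the Fejer kernel yields the Fejer means of the tent,
  and bounds of the kernel pass to these means.\<close>

lemma cos_poly_window_average:
  fixes k :: "'i \<Rightarrow> int" and \<beta> :: "'i \<Rightarrow> real"
  assumes "finite I" "r > 0"
    and T: "\<And>y. \<bar>y - x\<bar> \<le> r / 2 \<Longrightarrow> (\<Sum>i\<in>I. \<beta> i * cos (2 * pi * of_int (k i) * y)) \<in> {0..c}"
  shows "(\<Sum>i\<in>I. \<beta> i * sinc_coeff r (k i) * cos (2 * pi * of_int (k i) * x)) \<in> {0..c}"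
proof -
  let ?S = "{x - r / 2..x + r / 2}"
  let ?V = "\<Sum>i\<in>I. \<beta> i * sinc_coeff r (k i) * cos (2 * pi * of_int (k i) * x)"
  have "((\<lambda>y. \<Sum>i\<in>I. \<beta> i * cos (2 * pi * of_int (k i) * y)) has_integral 
     (\<Sum>i\<in>I. \<beta> i * (r * (sinc_coeff r (k i) * cos (2 * pi * of_int (k i) * x))))) ?S"
    using assms by (intro has_integral_sum has_integral_mult_right has_integral_cos_window)
  also have "(\<Sum>i\<in>I. \<beta> i * (r * (sinc_coeff r (k i) * cos (2 * pi * of_int (k i) * x)))) = r * ?V"
    by (simp add: sum_distrib_left mult_ac)
  finally have I: "((\<lambda>y. \<Sum>i\<in>I. \<beta> i * cos (2 * pi * of_int (k i) * y)) has_integral r * ?V) ?S" .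
  have T': "(\<Sum>i\<in>I. \<beta> i * cos (2 * pi * of_int (k i) * y)) \<in> {0..c}" if "y \<in> ?S" for y
    using that by (intro T) (simp only: atLeastAtMost_iff, linarith)
  have "r * ?V \<ge> 0" using has_integral_nonneg[OF I] T' by auto
  moreover have "r * ?V \<le> r * c"
  proof -
    have "((\<lambda>y. c) has_integral r * c) ?S"
      using has_integral_const_real[of c "x - r/2" "x + r/2"] assms by simp
    from has_integral_le[OF I this] T' show ?thesis by auto
  qed
  ultimately show ?thesis using assms by (auto simp: zero_le_mult_iff)
qed

text \<open>This is the identity behind writing the Fejer kernel as a mean of Dirichlet kernels.
  Passing from N to N + 1 adds an L-shaped border to the square, and along it m - n takes each value
  from -N to N exactly once.\<close>

lemma sum_diff_square:
  fixes f :: "int \<Rightarrow> 'a::comm_monoid_add"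
  shows "(\<Sum>(m, n)\<in>{..<N} \<times> {..<N}. f (int m - int n)) = (\<Sum>j<N. \<Sum>k\<in>{- int j..int j}. f k)"
proof (induction N)
  case (Suc N)
  have "{..<Suc N} \<times> {..<Suc N} = {..<N} \<times> {..<N} \<union> ((\<lambda>k. if k \<ge> 0 then (N, N - nat k) else (N - nat (- k), N)) ` {- int N..int N})"
    (is "_ = _ \<union> ?g ` _")
  proof (intro equalityI subsetI)
    fix z assume "z \<in> {..<Suc N} \<times> {..<Suc N}"
    then obtain m n where z: "z = (m, n)" "m \<le> N" "n \<le> N" by auto
    show "z \<in> {..<N} \<times> {..<N} \<union> ?g ` {- int N..int N}"
    proof (cases "m < N \<and> n < N")
      case False
      hence "z = ?g (int m - int n)" using z by auto
      moreover have "int m - int n \<in> {- int N..int N}" using z by auto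
      ultimately show ?thesis by blast
    qed (use z in auto)
  qed auto
  moreover have "({..<N} \<times> {..<N}) \<inter> ?g ` {- int N..int N} = {}" by auto
  ultimately have "(\<Sum>(m, n)\<in>{..<Suc N} \<times> {..<Suc N}. f (int m - int n)) = 
     (\<Sum>(m, n)\<in>{..<N} \<times> {..<N}. f (int m - int n)) + (\<Sum>(m, n)\<in>?g ` {- int N..int N}. f (int m - int n))"
    by (subst sum.union_disjoint[symmetric]) auto
  also have "(\<Sum>(m, n)\<in>?g ` {- int N..int N}. f (int m - int n)) = (\<Sum>k\<in>{- int N..int N}. f k)"
    by (subst sum.reindex) (auto simp: inj_on_def of_nat_diff split: if_splits intro!: sum.cong)
  finally show ?case using Suc by simp
qed auto

definition fejer :: "nat \<Rightarrow> real \<Rightarrow> real" where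
  "fejer N x = (cmod (\<Sum>n<N. ee (real n * x)))\<^sup>2 / N"

lemma fejer_eq_ee:
  "of_real (fejer N x) = (\<Sum>(m, n)\<in>{..<N} \<times> {..<N}. ee (of_int (int m - int n) * x)) / of_nat N"
proof -
  have "complex_of_real ((cmod (\<Sum>n<N. ee (real n * x)))\<^sup>2) = 
      (\<Sum>n<N. ee (real n * x)) * (\<Sum>n<N. ee (- (real n * x)))"
    by (simp only: complex_norm_square cnj_sum cnj_ee)
  also have "\<dots> = (\<Sum>(m, n)\<in>{..<N} \<times> {..<N}. ee (of_int (int m - int n) * x))"
    by (simp add: sum_product sum.cartesian_product[symmetric] ee_diff left_diff_distrib)
  finally show ?thesis by (simp add: fejer_def)
qed

lemma fejer_eq_cos:
  "fejer N x = (\<Sum>(m, n)\<in>{..<N} \<times> {..<N}. cos (2 * pi * of_int (int m - int n) * x)) / N"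
proof -
  have "fejer N x = Re (of_real (fejer N x))" by simp
  also have "\<dots> = (\<Sum>(m, n)\<in>{..<N} \<times> {..<N}. cos (2 * pi * of_int (int m - int n) * x)) / N"
    unfolding fejer_eq_ee by (simp add: Re_divide_of_nat case_prod_unfold Re_ee mult.assoc)
  finally show ?thesis .
qed

lemma fejer_nonneg: "fejer N x \<ge> 0" by (simp add: fejer_def)

lemma fejer_le: 
  assumes "\<bar>sin (pi * x)\<bar> \<ge> c" "c > 0" "N > 0"
  shows "fejer N x \<le> 1 / (c\<^sup>2 * N)"
proof -
  have "(1 - ee x) * (\<Sum>n<N. ee (real n * x)) = 1 - ee (real N * x)"
    using one_diff_power_eq[of "ee x" N] by (simp add: ee_power)
  hence "cmod (1 - ee x) * cmod (\<Sum>n<N. ee (real n * x)) \<le> 2"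
    by (metis norm_mult norm_triangle_ineq4 norm_one norm_ee one_add_one)
  hence "c * cmod (\<Sum>n<N. ee (real n * x)) \<le> 1"
    unfolding norm_one_minus_ee using assms(1) mult_right_mono[OF assms(1), of "cmod (\<Sum>n<N. ee (real n * x))"] by simp
  hence "cmod (\<Sum>n<N. ee (real n * x)) \<le> 1 / c" using assms by (simp add: field_simps)
  hence "(cmod (\<Sum>n<N. ee (real n * x)))\<^sup>2 \<le> (1 / c)\<^sup>2" by (intro power_mono) auto
  thus ?thesis using assms unfolding fejer_def by (simp add: field_simps)
qed

text \<open>For |x| <= 1 / (6 N) all angles 2 pi n x with n < N stay within pi / 3 of 0, so each
  term has real part at least 1/2.\<close>

lemma fejer_ge: 
  assumes "\<bar>x\<bar> * (6 * real N) \<le> 1"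
  shows "fejer N x \<ge> N / 4"
proof (cases "N = 0")
  case False
  have "real N / 2 = (\<Sum>n<N. 1 / 2)" by simp
  also have "\<dots> \<le> (\<Sum>n<N. Re (ee (real n * x)))"
  proof (intro sum_mono)
    fix n assume "n \<in> {..<N}"
    hence "\<bar>real n * x\<bar> \<le> \<bar>x\<bar> * real N" by (auto simp: abs_mult mult.commute intro!: mult_left_mono)
    hence "6 * \<bar>real n * x\<bar> \<le> 1" using assms by simp
    hence "2 * pi * \<bar>real n * x\<bar> \<le> pi / 3" using mult_left_mono[of "6 * \<bar>real n * x\<bar>" 1 pi] by simp
    moreover have "0 \<le> 2 * pi * \<bar>real n * x\<bar>" by simp
    ultimately have "cos (pi / 3) \<le> cos (2 * pi * \<bar>real n * x\<bar>)"
      using pi_gt_zero by (subst cos_mono_le_eq) auto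
    also have "cos (2 * pi * \<bar>real n * x\<bar>) = cos (2 * pi * (real n * x))"
      using cos_abs_real[of "2 * pi * (real n * x)"] by (simp add: abs_mult)
    finally show "1 / 2 \<le> Re (ee (real n * x))" by (simp add: cos_60 Re_ee)
  qed
  also have "\<dots> = Re (\<Sum>n<N. ee (real n * x))" by simp
  also have "\<dots> \<le> cmod (\<Sum>n<N. ee (real n * x))" by (rule complex_Re_le_cmod)
  finally have "(real N / 2)\<^sup>2 \<le> (cmod (\<Sum>n<N. ee (real n * x)))\<^sup>2" by (intro power_mono) auto
  thus ?thesis using False unfolding fejer_def by (simp add: field_simps power2_eq_square)
qed (simp add: fejer_def)

lemma cesaro_tendsto:
  fixes D :: "nat \<Rightarrow> real"
  assumes "D \<longlonglongrightarrow> g"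
  shows "(\<lambda>N. (\<Sum>j<N. D j) / real N) \<longlonglongrightarrow> g"
proof (rule LIMSEQ_I)
  fix e :: real assume e: "e > 0"
  obtain M where M: "\<And>n. n \<ge> M \<Longrightarrow> \<bar>D n - g\<bar> < e / 2"
    using LIMSEQ_D[OF assms, of "e / 2"] e by auto
  define S where "S = (\<Sum>j<M. \<bar>D j - g\<bar>)"
  have S0: "S \<ge> 0" by (auto simp: S_def intro: sum_nonneg)
  obtain K where K: "real K > 2 * S / e" using reals_Archimedean2 by blast
  show "\<exists>no. \<forall>n\<ge>no. norm ((\<Sum>j<n. D j) / real n - g) < e"
  proof (intro exI allI impI)
    fix n assume n: "n \<ge> max (max K M) 1"
    have n0: "real n > 0" using n by auto
    have "(\<Sum>j<n. D j) - real n * g = (\<Sum>j<n. D j - g)" by (simp add: sum_subtractf)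
    hence "\<bar>(\<Sum>j<n. D j) - real n * g\<bar> \<le> (\<Sum>j<n. \<bar>D j - g\<bar>)" by (metis sum_abs)
    also have "(\<Sum>j<n. \<bar>D j - g\<bar>) = S + (\<Sum>j\<in>{M..<n}. \<bar>D j - g\<bar>)"
      unfolding S_def using n by (subst sum.union_disjoint[symmetric]) (auto intro!: sum.cong)
    also have "(\<Sum>j\<in>{M..<n}. \<bar>D j - g\<bar>) \<le> (\<Sum>j\<in>{M..<n}. e / 2)"
      using M by (intro sum_mono) (auto intro: less_imp_le)
    also have "\<dots> \<le> real n * (e / 2)" using e by (auto intro!: mult_right_mono)
    also have "S < real n * (e / 2)"
    proof -
      have "2 * S / e < real n" using K n by linarith
      thus ?thesis using e by (simp add: field_simps)
    qed
    finally have "\<bar>(\<Sum>j<n. D j) - real n * g\<bar> < real n * e" by (simp add: mult.commute)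
    moreover have "(\<Sum>j<n. D j) / real n - g = ((\<Sum>j<n. D j) - real n * g) / real n" using n0 by (simp add: field_simps)
    ultimately show "norm ((\<Sum>j<n. D j) / real n - g) < e" using n0 by (simp add: field_simps)
  qed
qed

lemma sinc_coeff_sq_le:
  assumes "r > 0" "k \<noteq> 0"
  shows "(sinc_coeff r k)\<^sup>2 \<le> 1" "(sinc_coeff r k)\<^sup>2 \<le> 1 / (\<bar>of_int k\<bar> * r)\<^sup>2"
proof -
  have "\<bar>sin (pi * of_int k * r)\<bar> \<le> \<bar>pi * of_int k * r\<bar>" by (rule abs_sin_x_le_abs_x)
  hence "\<bar>sinc_coeff r k\<bar> \<le> 1" using assms by (simp add: sinc_coeff_def field_simps abs_mult)
  thus "(sinc_coeff r k)\<^sup>2 \<le> 1" by (simp add: abs_square_le_1)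
  have "\<bar>sinc_coeff r k\<bar> \<le> 1 / (\<bar>of_int k\<bar> * r)"
  proof -
    have "\<bar>sinc_coeff r k\<bar> = \<bar>sin (pi * of_int k * r)\<bar> / (pi * (\<bar>of_int k\<bar> * r))"
      using assms by (simp add: sinc_coeff_def abs_mult)
    also have "\<dots> \<le> 1 / (1 * (\<bar>of_int k\<bar> * r))"
      using assms pi_gt3 by (intro frac_le mult_right_mono mult_pos_pos) auto
    finally show ?thesis by simp
  qed
  hence "\<bar>sinc_coeff r k\<bar>\<^sup>2 \<le> (1 / (\<bar>of_int k\<bar> * r))\<^sup>2" by (intro power_mono) auto
  thus "(sinc_coeff r k)\<^sup>2 \<le> 1 / (\<bar>of_int k\<bar> * r)\<^sup>2" by (simp add: power_divide)
qed

lemma sum_symmetric_int: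
  fixes f :: "int \<Rightarrow> 'a::comm_monoid_add"
  shows "(\<Sum>k\<in>{- int j..int j}. f k) = f 0 + (\<Sum>i<j. f (int (Suc i)) + f (- int (Suc i)))"
proof (induction j)
  case (Suc j)
  have "{- int (Suc j)..int (Suc j)} = insert (int (Suc j)) (insert (- int (Suc j)) {- int j..int j})" by auto
  thus ?case using Suc by (simp add: add_ac)
qed auto

text \<open>Only the sign and the support of the periodic tent matter, and both pass to the limit from its
  Fejer means; no inversion theorem for Fourier series is needed.\<close>

lemma periodic_bump:
  assumes r: "r > 0"
  obtains g :: "real \<Rightarrow> real" where
    "\<And>x. (\<lambda>j. \<Sum>k\<in>{- int j..int j}. of_real ((sinc_coeff r k)\<^sup>2) * ee (of_int k * x)) \<longlonglongrightarrow> of_real (g x)"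
    "\<And>x. g x \<ge> 0" "\<And>x. (\<And>n::int. \<bar>x - of_int n\<bar> > r) \<Longrightarrow> g x = 0"
proof -
  let ?a = "\<lambda>k. (sinc_coeff r k)\<^sup>2"
  define D where "D x j = (\<Sum>k\<in>{- int j..int j}. ?a k * cos (2 * pi * of_int k * x))" for x j
  have even: "sinc_coeff r (- k) = sinc_coeff r k" for k by (simp add: sinc_coeff_def)
  have D: "(\<Sum>k\<in>{- int j..int j}. of_real (?a k) * ee (of_int k * x)) = complex_of_real (D x j)" for x j
  proof -
    have "of_real (?a k) * ee (of_int k * x) + of_real (?a (- k)) * ee (of_int (- k) * x) = 
        complex_of_real (?a k * cos (2 * pi * of_int k * x) + ?a (- k) * cos (2 * pi * of_int (- k) * x))" for k
      by (simp add: even complex_eq_iff ee_def mult.assoc)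
    thus ?thesis unfolding D_def sum_symmetric_int by (simp only: of_real_add of_real_sum) simp
  qed
  have "convergent (D x)" for x
  proof -
    have "summable (\<lambda>i. ?a (int (Suc i)) * cos (2 * pi * of_int (int (Suc i)) * x) 
        + ?a (- int (Suc i)) * cos (2 * pi * of_int (- int (Suc i)) * x))"
    proof (rule summable_comparison_test)
      show "summable (\<lambda>i. 2 / r\<^sup>2 * (1 / real (Suc i) ^ 2))"
        using inverse_power_summable[of 2, where 'a = real] summable_Suc_iff[of "\<lambda>i. 1 / real i ^ 2"]
        by (intro summable_mult) (simp add: inverse_eq_divide del: of_nat_Suc)
      show "\<exists>N. \<forall>n\<ge>N. norm (?a (int (Suc n)) * cos (2 * pi * of_int (int (Suc n)) * x) 
        + ?a (- int (Suc n)) * cos (2 * pi * of_int (- int (Suc n)) * x)) \<le> 2 / r\<^sup>2 * (1 / real (Suc n) ^ 2)"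
      proof (intro exI allI impI)
        fix n :: nat
        have *: "\<bar>?a k * c\<bar> \<le> 1 / r\<^sup>2 * (1 / real (Suc n) ^ 2)" if "\<bar>c\<bar> \<le> 1" "\<bar>k\<bar> = int (Suc n)" for c k
        proof -
          have k: "k \<noteq> 0" "real_of_int \<bar>k\<bar> = real (Suc n)" using that(2) by auto
          have "\<bar>?a k * c\<bar> = ?a k * \<bar>c\<bar>" by (simp add: abs_mult)
          also have "\<dots> \<le> ?a k * 1" using that by (intro mult_left_mono) auto
          also have "\<dots> \<le> 1 / (\<bar>of_int k\<bar> * r)\<^sup>2" using sinc_coeff_sq_le(2)[OF r k(1)] by simp
          also have "\<dots> = 1 / r\<^sup>2 * (1 / real (Suc n) ^ 2)" using k(2) by (simp add: power_mult_distrib del: of_nat_Suc)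
          finally show ?thesis .
        qed
        show "norm (?a (int (Suc n)) * cos (2 * pi * of_int (int (Suc n)) * x) 
          + ?a (- int (Suc n)) * cos (2 * pi * of_int (- int (Suc n)) * x)) \<le> 2 / r\<^sup>2 * (1 / real (Suc n) ^ 2)"
          using *[OF abs_cos_le_one, of "int (Suc n)" "2 * pi * of_int (int (Suc n)) * x"]
            *[OF abs_cos_le_one, of "- int (Suc n)" "2 * pi * of_int (- int (Suc n)) * x"] 
          unfolding real_norm_def by (intro order_trans[OF abs_triangle_ineq]) simp
      qed
    qed
    hence "convergent (\<lambda>j. ?a 0 * cos (2 * pi * of_int 0 * x) + 
       (\<Sum>i<j. ?a (int (Suc i)) * cos (2 * pi * of_int (int (Suc i)) * x) 
        + ?a (- int (Suc i)) * cos (2 * pi * of_int (- int (Suc i)) * x)))"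
      unfolding summable_iff_convergent by (rule convergent_add[OF convergent_const])
    thus ?thesis unfolding D_def[abs_def] sum_symmetric_int .
  qed
  then obtain g where g: "\<And>x. D x \<longlonglongrightarrow> g x" unfolding convergent_def by metis
  \<comment> \<open>The partial sums converge absolutely, so their Cesaro means have the same limit.
    These means are Fejer means of the tent, to which bounds of the kernel pass, whereas the partial
    sums themselves carry no sign information.\<close>
  have S: "(\<lambda>N. (\<Sum>(m, n)\<in>{..<N} \<times> {..<N}. ?a (int m - int n) * cos (2 * pi * of_int (int m - int n) * x)) / N) \<longlonglongrightarrow> g x" for x
    using cesaro_tendsto[OF g[of x]] unfolding D_def
    by (subst sum_diff_square[of "\<lambda>k. ?a k * cos (2 * pi * of_int k * x)"])
  \<comment> \<open>Each window average looks r / 2 to either side, so after two of them only the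
    kernel within distance r of x matters.\<close>
  have bnd: "(\<Sum>(m, n)\<in>{..<N} \<times> {..<N}. ?a (int m - int n) * cos (2 * pi * of_int (int m - int n) * x)) / N \<in> {0..c}"
    if "\<And>y. \<bar>y - x\<bar> \<le> r \<Longrightarrow> fejer N y \<le> c" for N x c
  proof -
    let ?I = "{..<N} \<times> {..<N}"
    let ?k = "\<lambda>z. int (fst z) - int (snd z)"
    have 0: "(\<Sum>i\<in>?I. (1 / N) * cos (2 * pi * of_int (?k i) * y)) \<in> {0..c}" if "\<bar>y - x\<bar> \<le> r" for y
      using \<open>\<And>y. \<bar>y - x\<bar> \<le> r \<Longrightarrow> fejer N y \<le> c\<close>[OF that] fejer_nonneg[of N y] 
      unfolding fejer_eq_cos by (simp add: case_prod_unfold sum_divide_distrib)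
    have 1: "(\<Sum>i\<in>?I. (1 / N) * sinc_coeff r (?k i) * cos (2 * pi * of_int (?k i) * y)) \<in> {0..c}" if "\<bar>y - x\<bar> \<le> r / 2" for y
      by (intro cos_poly_window_average 0 r) (simp, insert that, linarith)
    have "(\<Sum>i\<in>?I. (1 / N) * sinc_coeff r (?k i) * sinc_coeff r (?k i) * cos (2 * pi * of_int (?k i) * x)) \<in> {0..c}"
      by (intro cos_poly_window_average 1 r) auto
    thus ?thesis by (simp add: case_prod_unfold sum_divide_distrib power2_eq_square mult_ac)
  qed
  show ?thesis
  proof (rule that[of g])
    fix x
    show "(\<lambda>j. \<Sum>k\<in>{- int j..int j}. of_real (?a k) * ee (of_int k * x)) \<longlonglongrightarrow> of_real (g x)"
      unfolding D by (intro tendsto_of_real g)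
    show "g x \<ge> 0"
    proof (rule LIMSEQ_le_const[OF S[of x]], intro exI allI impI)
      fix N :: nat
      have "fejer N y \<le> N" for y
      proof -
        have "cmod (\<Sum>n<N. ee (real n * y)) \<le> (\<Sum>n<N. 1)" by (intro sum_norm_le) auto
        hence "(cmod (\<Sum>n<N. ee (real n * y)))\<^sup>2 \<le> (real N)\<^sup>2" by (intro power_mono) auto
        thus ?thesis by (cases "N = 0") (auto simp: fejer_def field_simps power2_eq_square)
      qed
      from bnd[OF this] show "0 \<le> (\<Sum>(m, n)\<in>{..<N} \<times> {..<N}. ?a (int m - int n) * cos (2 * pi * of_int (int m - int n) * x)) / N"
        by simp
    qed
    assume x: "\<And>n::int. \<bar>x - of_int n\<bar> > r"
    \<comment> \<open>The closed window around x contains no integer, so by compactness |sin (pi y)|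
      is at least some c > 0 on it; there the kernel is O(1/N), and the limit is 0.\<close>
    have "\<exists>z\<in>{x-r..x+r}. \<forall>y\<in>{x-r..x+r}. \<bar>sin (pi * z)\<bar> \<le> \<bar>sin (pi * y)\<bar>"
      using r by (intro continuous_attains_inf continuous_intros) auto
    then obtain z where z: "z \<in> {x-r..x+r}" "\<And>y. y \<in> {x-r..x+r} \<Longrightarrow> \<bar>sin (pi * z)\<bar> \<le> \<bar>sin (pi * y)\<bar>" by blast
    define c where "c = \<bar>sin (pi * z)\<bar>"
    have "c \<noteq> 0"
    proof
      assume "c = 0"
      hence "ee z = 1" using norm_one_minus_ee[of z] by (simp add: c_def)
      then obtain n where "z = of_int n" unfolding ee_eq_1_iff by (auto elim: Ints_cases)
      thus False using x[of n] z(1) by (auto simp: abs_le_iff)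
    qed
    hence c: "c > 0" by (simp add: c_def)
    have "g x \<le> 0"
    proof (rule LIMSEQ_le[OF S[of x]])
      have "(\<lambda>N. (1 / c\<^sup>2) * (1 / real N)) \<longlonglongrightarrow> (1 / c\<^sup>2) * 0"
        by (intro tendsto_mult tendsto_const lim_1_over_n)
      thus "(\<lambda>N. 1 / (c\<^sup>2 * real N)) \<longlonglongrightarrow> 0" by simp
      show "\<exists>N. \<forall>n\<ge>N. (\<Sum>(m, na)\<in>{..<n} \<times> {..<n}. ?a (int m - int na) * cos (2 * pi * of_int (int m - int na) * x)) / real n
            \<le> 1 / (c\<^sup>2 * real n)"
      proof (intro exI allI impI)
        fix n :: nat assume n: "n \<ge> 1"
        have "fejer n y \<le> 1 / (c\<^sup>2 * real n)" if "\<bar>y - x\<bar> \<le> r" for y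
          using that n c z(2)[of y] by (intro fejer_le) (auto simp: c_def abs_le_iff)
        from bnd[OF this] show "(\<Sum>(m, na)\<in>{..<n} \<times> {..<n}. ?a (int m - int na) * cos (2 * pi * of_int (int m - int na) * x)) / real n
            \<le> 1 / (c\<^sup>2 * real n)" by simp
      qed
    qed
    thus "g x = 0" using \<open>g x \<ge> 0\<close> by simp
  qed
qed

section \<open>The upper bound\<close>

lemma fourier_meas_ee: "fourier_meas \<nu> \<xi> = (\<integral>x. ee (- \<xi> * x) \<partial>\<nu>)"
proof -
  have "exp (- 2 * of_real pi * \<i> * of_real \<xi> * of_real x) = ee (- \<xi> * x)" for x
    by (simp add: ee_def cis_conv_exp mult_ac)
  thus ?thesis by (simp add: fourier_meas_def)
qed

lemma fejer_shift_int: "fejer N (x + of_int m) = fejer N x"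
proof -
  have "ee (real n * (x + of_int m)) = ee (real n * x)" for n
    using ee_of_int[of "int n * m"] by (simp add: ring_distribs ee_add)
  thus ?thesis by (simp add: fejer_def)
qed

section \<open>The measure of one layer under Fourier decay\<close>

definition approx_set :: "int \<Rightarrow> int \<Rightarrow> nat \<Rightarrow> real \<Rightarrow> real \<Rightarrow> real set" where
  "approx_set a b q \<psi> \<theta> = {x. \<exists>p::int. gcd (b * p + a) (int q) = 1 \<and> \<bar>x - (of_int p + \<theta>) / real q\<bar> < \<psi> / real q}"

lemma open_approx_set: "open (approx_set a b q \<psi> \<theta>)"
proof -
  have "approx_set a b q \<psi> \<theta> = (\<Union>p\<in>{p::int. gcd (b * p + a) (int q) = 1}. 
     {x. \<bar>x - (of_int p + \<theta>) / real q\<bar> < \<psi> / real q})"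
    by (rule set_eqI) (simp only: approx_set_def mem_Collect_eq UN_iff Bex_def)
  also have "open \<dots>" by (intro open_UN ballI open_Collect_less continuous_intros)
  finally show ?thesis .
qed

lemma admissible_residues_mod:
  assumes "q > 0" "gcd (b * p + a) (int q) = 1"
  shows "p mod int q \<in> admissible_residues a b q"
proof -
  have "b * p + a = (b * (p mod int q) + a) + int q * (b * (p div int q))"
    using mult_div_mod_eq[of "int q" p] by (metis (no_types, opaque_lifting) add.assoc add.commute distrib_left mult.left_commute)
  hence "gcd (b * p + a) (int q) = gcd (b * (p mod int q) + a) (int q)"
    by (metis gcd.commute gcd_add_mult mult.commute add.commute)
  thus ?thesis using assms by (simp add: admissible_residues_def)
qed

lemma sum_inverse_sqrt_le: "(\<Sum>j\<in>{1..M}. 1 / sqrt (real j)) \<le> 2 * sqrt (real M)"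
proof (induction M)
  case (Suc M)
  define a b where "a = sqrt (real M)" and "b = sqrt (real (Suc M))"
  have ab: "0 \<le> a" "a \<le> b" "b > 0" "b\<^sup>2 - a\<^sup>2 = 1" by (auto simp: a_def b_def)
  have "1 \<le> 2 * b * (b - a)"
  proof -
    have "1 = (b + a) * (b - a)" using ab by (simp add: power2_eq_square algebra_simps)
    also have "\<dots> \<le> (2 * b) * (b - a)" using ab by (intro mult_right_mono) auto
    finally show ?thesis .
  qed
  hence "1 / b \<le> 2 * b - 2 * a" using ab by (simp add: field_simps)
  thus ?case using Suc by (simp add: a_def b_def)
qed auto

text \<open>Reduction to exponent 1/2: j^(-\<sigma>) = j^(1/2 - \<sigma>) * j^(-1/2), and the first
  factor is largest at j = M. The constant 2 is then the same for all \<sigma> up to 1/2.\<close>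

lemma sum_powr_le:
  assumes "0 \<le> \<sigma>" "\<sigma> \<le> 1 / 2"
  shows "(\<Sum>j\<in>{1..M}. real j powr (- \<sigma>)) \<le> 2 * real M powr (1 - \<sigma>)"
proof -
  have "(\<Sum>j\<in>{1..M}. real j powr (- \<sigma>)) \<le> (\<Sum>j\<in>{1..M}. real M powr (1 / 2 - \<sigma>) * (1 / sqrt (real j)))"
  proof (intro sum_mono)
    fix j assume j: "j \<in> {1..M}"
    have "real j powr (- \<sigma>) = real j powr (1 / 2 - \<sigma>) * real j powr (- (1 / 2))"
      using j by (simp flip: powr_add)
    also have "\<dots> \<le> real M powr (1 / 2 - \<sigma>) * real j powr (- (1 / 2))"
      using j assms by (intro mult_right_mono powr_mono2) auto
    finally show "real j powr (- \<sigma>) \<le> real M powr (1 / 2 - \<sigma>) * (1 / sqrt (real j))"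
      using j by (simp add: powr_minus powr_half_sqrt inverse_eq_divide)
  qed
  also have "\<dots> = real M powr (1 / 2 - \<sigma>) * (\<Sum>j\<in>{1..M}. 1 / sqrt (real j))" by (simp add: sum_distrib_left)
  also have "\<dots> \<le> real M powr (1 / 2 - \<sigma>) * (2 * sqrt (real M))"
    by (intro mult_left_mono sum_inverse_sqrt_le) auto
  also have "\<dots> = 2 * (real M powr (1 / 2 - \<sigma>) * real M powr (1 / 2))"
    by (simp add: powr_half_sqrt)
  also have "\<dots> = 2 * real M powr (1 - \<sigma>)" by (simp only: powr_add[symmetric]) simp
  finally show ?thesis .
qed

text \<open>This is the average over frequencies with q fixed. After exchanging the sums, a divisor
  e of q meets only the multiples i = e * j, and the weight e compensates exactly for their
  sparsity: each divisor contributes at most 2 N^(1 - \<sigma>).\<close>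

lemma sum_gcd_powr_le:
  assumes "0 \<le> \<sigma>" "\<sigma> \<le> 1 / 2" "q > 0"
  shows "(\<Sum>i\<in>{1..N}. real i powr (- \<sigma>) * (\<Sum>e | e dvd q \<and> int e dvd int i. real e))
     \<le> 2 * real (card {d. d dvd q}) * real N powr (1 - \<sigma>)"
proof -
  have fin: "finite {d. d dvd q}" using assms by simp
  have "(\<Sum>i\<in>{1..N}. real i powr (- \<sigma>) * (\<Sum>e | e dvd q \<and> int e dvd int i. real e)) = 
     (\<Sum>i\<in>{1..N}. \<Sum>e | e \<in> {d. d dvd q} \<and> e dvd i. real i powr (- \<sigma>) * real e)"
    by (simp add: sum_distrib_left)
  also have "\<dots> = (\<Sum>e\<in>{d. d dvd q}. \<Sum>i | i \<in> {1..N} \<and> e dvd i. real i powr (- \<sigma>) * real e)"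
    by (rule sum.swap_restrict) (use fin in auto)
  also have "\<dots> \<le> (\<Sum>e\<in>{d. d dvd q}. 2 * real N powr (1 - \<sigma>))"
  proof (intro sum_mono)
    fix e assume "e \<in> {d. d dvd q}"
    hence e: "e > 0" using assms by (auto intro: dvd_pos_nat)
    have "(\<Sum>i | i \<in> {1..N} \<and> e dvd i. real i powr (- \<sigma>) * real e) = 
       (\<Sum>j\<in>{1..N div e}. real e powr (1 - \<sigma>) * real j powr (- \<sigma>))"
      unfolding sum_multiples[OF e]
      using e by (intro sum.cong refl) (simp add: powr_mult powr_diff powr_minus field_simps)
    also have "\<dots> = real e powr (1 - \<sigma>) * (\<Sum>j\<in>{1..N div e}. real j powr (- \<sigma>))" by (simp add: sum_distrib_left)
    also have "\<dots> \<le> real e powr (1 - \<sigma>) * (2 * real (N div e) powr (1 - \<sigma>))"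
      using assms by (intro mult_left_mono sum_powr_le) auto
    also have "\<dots> = 2 * (real (e * (N div e))) powr (1 - \<sigma>)" by (simp add: powr_mult)
    also have "\<dots> \<le> 2 * real N powr (1 - \<sigma>)"
    proof -
      have "e * (N div e) \<le> N" by simp
      hence "real (e * (N div e)) \<le> real N" by (simp only: of_nat_le_iff)
      thus ?thesis using assms by (intro mult_left_mono powr_mono2) auto
    qed
    finally show "(\<Sum>i | i \<in> {1..N} \<and> e dvd i. real i powr (- \<sigma>) * real e) \<le> 2 * real N powr (1 - \<sigma>)" .
  qed
  finally show ?thesis by simp
qed

text \<open>The indicator of the layer is dominated by 4 / N times a sum of Fejer kernels of order
  N, comparable to q / \<psi>, whose integral is computed on the Fourier side. The main case
  produces the constants 48 and 192 C; 300 covers them generously.\<close>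

lemma measure_approx_set_le:
  assumes \<nu>: "real_distribution \<nu>"
    and decay: "\<And>\<xi>. cmod (fourier_meas \<nu> \<xi>) \<le> C * (1 + \<bar>\<xi>\<bar>) powr (- \<sigma>)"
    and \<sigma>: "0 \<le> \<sigma>" "\<sigma> \<le> 1 / 2" and q: "q > 0" and ab: "gcd a b = 1" and \<psi>: "0 \<le> \<psi>" "\<psi> < 1/2"
  shows "measure \<nu> (approx_set a b q \<psi> \<theta>) \<le> (300 * C + 300) * 
     (\<psi> * (\<Prod>l | prime l \<and> l dvd q \<and> \<not> int l dvd b. 1 - 1 / real l) 
       + real (card {d. d dvd q}) * (\<psi> / real q) powr \<sigma>)"
proof -
  interpret real_distribution \<nu> by fact
  \<comment> \<open>The transform of a probability measure is 1 at frequency 0.\<close>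
  have C1: "C \<ge> 1" using decay[of 0] by (simp add: fourier_meas_def prob_space del: space_eq_univ)
  define \<Phi> where "\<Phi> = (\<Prod>l | prime l \<and> l dvd q \<and> \<not> int l dvd b. 1 - 1 / real l)"
  have \<Phi>0: "\<Phi> \<ge> 0" unfolding \<Phi>_def by (intro prod_nonneg) (auto simp: prime_gt_0_nat Suc_leI)
  let ?d = "real (card {d. d dvd q})"
  have d1: "?d \<ge> 1"
  proof -
    have "card {1::nat} \<le> card {d. d dvd q}" using q by (intro card_mono) auto
    thus ?thesis by simp
  qed
  let ?R = "\<psi> * \<Phi> + ?d * (\<psi> / real q) powr \<sigma>"
  have mE: "approx_set a b q \<psi> \<theta> \<in> sets borel" using open_approx_set by auto
  \<comment> \<open>For \<psi> = 0 the layer is empty. For q < 6 \<psi> the order N chosen below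
    would be 0, but then (\<psi> / q)^\<sigma> >= 1/6 and the claimed bound exceeds 1.\<close>
  consider "\<psi> = 0" | "\<psi> > 0" "real q < 6 * \<psi>" | "\<psi> > 0" "real q \<ge> 6 * \<psi>" using \<psi> by linarith
  hence "measure \<nu> (approx_set a b q \<psi> \<theta>) \<le> (300 * C + 300) * ?R"
  proof cases
    case 1
    thus ?thesis by (simp add: approx_set_def)
  next
    case 2
    have "(1 / 6) powr 1 \<le> (1 / 6 :: real) powr \<sigma>" using \<sigma> by (intro powr_mono') auto
    also have "\<dots> \<le> (\<psi> / real q) powr \<sigma>" using 2 q \<sigma> by (intro powr_mono2) (auto simp: field_simps)
    also have "\<dots> \<le> ?d * (\<psi> / real q) powr \<sigma>" using d1 mult_right_mono[OF d1, of "(\<psi> / real q) powr \<sigma>"] by simp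
    also have "\<dots> \<le> ?R" using \<psi> \<Phi>0 by simp
    finally have "1 / 6 \<le> ?R" by simp
    hence "6 * (1 / 6) \<le> (300 * C + 300) * ?R" using C1 by (intro mult_mono) auto
    thus ?thesis using prob_le_1[of "approx_set a b q \<psi> \<theta>"] by linarith
  next
    case 3
    \<comment> \<open>The largest order for which every point within \<psi> / q of a centre
      satisfies the hypothesis of \<open>fejer_ge\<close>.\<close>
    define N where "N = nat \<lfloor>real q / (6 * \<psi>)\<rfloor>"
    have "real q / (6 * \<psi>) \<ge> 1" using 3 by simp
    hence N1: "N \<ge> 1" "real N \<le> real q / (6 * \<psi>)" "real q / (6 * \<psi>) < real N + 1"
      unfolding N_def by (auto simp: le_nat_iff)
    \<comment> \<open>Rounding down a number that is at least 1 loses at most a factor 2.\<close>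
    hence N2: "real q / (12 * \<psi>) \<le> real N"
    proof -
      have "real q / (12 * \<psi>) = (real q / (6 * \<psi>)) / 2" by simp
      thus ?thesis using N1 by linarith
    qed
    define H where "H x = (\<Sum>p\<in>admissible_residues a b q. fejer N (x - (of_int p + \<theta>) / real q))" for x
    have H0: "H x \<ge> 0" for x unfolding H_def by (intro sum_nonneg fejer_nonneg)
    have ind: "indicator (approx_set a b q \<psi> \<theta>) x \<le> 4 / real N * H x" for x
    proof (cases "x \<in> approx_set a b q \<psi> \<theta>")
      case True
      then obtain p where p: "gcd (b * p + a) (int q) = 1" "\<bar>x - (of_int p + \<theta>) / real q\<bar> < \<psi> / real q"
        unfolding approx_set_def mem_Collect_eq by (elim exE conjE)
      \<comment> \<open>The kernel has period 1, so p may be replaced by its residue even if x is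
        far from the shifted centre.\<close>
      let ?p = "p mod int q"
      have pm: "of_int p = of_int ?p + real q * of_int (p div int q)"
        by (metis mod_mult_div_eq of_int_add of_int_mult of_int_of_nat_eq)
      have "x - (of_int ?p + \<theta>) / real q = x - (of_int p + \<theta>) / real q + of_int (p div int q)"
        using q by (simp add: pm field_simps)
      hence "fejer N (x - (of_int ?p + \<theta>) / real q) = fejer N (x - (of_int p + \<theta>) / real q)"
        by (simp only: fejer_shift_int)
      also have "\<dots> \<ge> real N / 4"
      proof (rule fejer_ge)
        have "\<bar>x - (of_int p + \<theta>) / real q\<bar> * (6 * real N) \<le> (\<psi> / real q) * (6 * (real q / (6 * \<psi>)))"
          using p N1 3 by (intro mult_mono) auto
        also have "\<dots> = 1" using 3 q by simp
        finally show "\<bar>x - (of_int p + \<theta>) / real q\<bar> * (6 * real N) \<le> 1" .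
      qed
      finally have "real N / 4 \<le> H x"
        unfolding H_def using admissible_residues_mod[OF q p(1)] fejer_nonneg
        by (intro order_trans[OF _ member_le_sum]) auto
      thus ?thesis using True N1 by (simp add: field_simps)
    qed (use H0 in auto)
    define h where "h k = cmod (residue_exp_sum a b q k) * cmod (fourier_meas \<nu> (- of_int k))" for k
    have int_ee: "integrable \<nu> (\<lambda>x. ee (c * x))" for c
    proof (rule integrable_const_bound[of _ 1])
      have "continuous_on UNIV (\<lambda>x. ee (c * x))" by (intro continuous_intros)
      from borel_measurable_continuous_onI[OF this] show "(\<lambda>x. ee (c * x)) \<in> borel_measurable \<nu>" by simp
    qed simp
    have HE: "complex_of_real (H x) = (\<Sum>(m, n)\<in>{..<N} \<times> {..<N}. \<Sum>p\<in>admissible_residues a b q. 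
        ee (- (of_int (int m - int n) * ((of_int p + \<theta>) / real q))) * ee (of_int (int m - int n) * x)) / of_nat N" for x
    proof -
      have "complex_of_real (H x) = (\<Sum>p\<in>admissible_residues a b q. \<Sum>(m, n)\<in>{..<N} \<times> {..<N}. 
        ee (- (of_int (int m - int n) * ((of_int p + \<theta>) / real q))) * ee (of_int (int m - int n) * x)) / of_nat N"
        unfolding H_def of_real_sum fejer_eq_ee sum_divide_distrib[symmetric]
        by (simp only: right_diff_distrib[of _ x] ee_diff[of "_ * x"] mult.commute[of "ee (_ * x)"])
      also have "\<dots> = (\<Sum>z\<in>{..<N} \<times> {..<N}. \<Sum>p\<in>admissible_residues a b q. (case z of (m, n) \<Rightarrow> 
        ee (- (of_int (int m - int n) * ((of_int p + \<theta>) / real q))) * ee (of_int (int m - int n) * x))) / of_nat N"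
        by (subst sum.swap) (rule refl)
      finally show ?thesis by (simp add: case_prod_unfold)
    qed
    have intH: "complex_of_real (\<integral>x. H x \<partial>\<nu>) = (\<Sum>(m, n)\<in>{..<N} \<times> {..<N}. \<Sum>p\<in>admissible_residues a b q. 
        ee (- (of_int (int m - int n) * ((of_int p + \<theta>) / real q))) * fourier_meas \<nu> (- of_int (int m - int n))) / of_nat N"
      unfolding integral_complex_of_real[symmetric] HE fourier_meas_ee case_prod_unfold
      using int_ee by simp
    have sumE: "(\<Sum>p\<in>admissible_residues a b q. ee (- (of_int k * ((of_int p + \<theta>) / real q))) * z) = 
       ee (- (of_int k * \<theta> / real q)) * residue_exp_sum a b q k * z" for k z
    proof -
      have "ee (- (of_int k * ((of_int p + \<theta>) / real q))) = ee (- (of_int k * \<theta> / real q)) * ee (- (of_int k * of_int p / real q))" for p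
      proof -
        have "- (of_int k * ((of_int p + \<theta>) / real q)) = - (of_int k * \<theta> / real q) + - (of_int k * of_int p / real q)"
          by (simp add: add_divide_distrib ring_distribs)
        thus ?thesis by (simp only: ee_add)
      qed
      thus ?thesis by (simp add: residue_exp_sum_def sum_distrib_left sum_distrib_right)
    qed
    have "(\<integral>x. H x \<partial>\<nu>) = cmod (complex_of_real (\<integral>x. H x \<partial>\<nu>))"
      using H0 by (simp add: integral_nonneg_AE)
    also have "\<dots> = cmod (\<Sum>(m, n)\<in>{..<N} \<times> {..<N}. ee (- (of_int (int m - int n) * \<theta> / real q)) * residue_exp_sum a b q (int m - int n) * 
         fourier_meas \<nu> (- of_int (int m - int n))) / real N"
      unfolding intH sumE by (simp add: norm_divide)
    also have "\<dots> \<le> (\<Sum>(m, n)\<in>{..<N} \<times> {..<N}. h (int m - int n)) / real N"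
      unfolding case_prod_unfold h_def by (intro divide_right_mono sum_norm_le) (simp_all add: norm_mult)
    also have "(\<Sum>(m, n)\<in>{..<N} \<times> {..<N}. h (int m - int n)) = (\<Sum>j<N. \<Sum>k\<in>{- int j..int j}. h k)"
      by (rule sum_diff_square)
    \<comment> \<open>As h >= 0, all N symmetric partial sums can be enlarged to the same one; this
      cancels the division by N.\<close>
    also have "\<dots> \<le> (\<Sum>j<N. \<Sum>k\<in>{- int N..int N}. h k)"
      by (intro sum_mono sum_mono2) (auto simp: h_def)
    also have "\<dots> / real N = (\<Sum>k\<in>{- int N..int N}. h k)" using N1 by simp
    finally have Hh: "(\<integral>x. H x \<partial>\<nu>) \<le> (\<Sum>k\<in>{- int N..int N}. h k)" using N1 by (simp add: divide_right_mono)
    let ?D = "\<lambda>i::nat. \<Sum>e | e dvd q \<and> int e dvd int i. real e"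
    have hk: "h k \<le> C * (real i powr (- \<sigma>) * ?D i)" if "\<bar>k\<bar> = int i" "i > 0" for k i
    proof -
      have 1: "cmod (residue_exp_sum a b q k) \<le> ?D i"
      proof -
        have "int e dvd k \<longleftrightarrow> int e dvd int i" for e using that(1) by (metis dvd_abs_iff)
        thus ?thesis using norm_residue_exp_sum_le[OF q ab, of k] by simp
      qed
      have "cmod (fourier_meas \<nu> (- of_int k)) \<le> C * (1 + \<bar>- of_int k\<bar>) powr (- \<sigma>)" by (rule decay)
      also have "\<dots> \<le> C * real i powr (- \<sigma>)"
      proof -
        have "\<bar>- real_of_int k\<bar> = real i" using that(1) by simp
        thus ?thesis using C1 that \<sigma> by (intro mult_left_mono powr_mono2') auto
      qed
      finally have "h k \<le> ?D i * (C * real i powr (- \<sigma>))"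
        unfolding h_def using 1 C1 by (intro mult_mono) (auto intro: sum_nonneg)
      thus ?thesis by (simp add: mult_ac)
    qed
    have h0: "h 0 = real q * \<Phi>"
      unfolding h_def residue_exp_sum_0[OF q ab] \<Phi>_def[symmetric] using \<Phi>0 by (simp add: fourier_meas_def prob_space norm_mult del: space_eq_univ)
    have "(\<Sum>k\<in>{- int N..int N}. h k) \<le> real q * \<Phi> + (\<Sum>i<N. 2 * C * (real (Suc i) powr (- \<sigma>) * ?D (Suc i)))"
      unfolding sum_symmetric_int h0
    proof (intro add_left_mono sum_mono)
      fix i
      show "h (int (Suc i)) + h (- int (Suc i)) \<le> 2 * C * (real (Suc i) powr (- \<sigma>) * ?D (Suc i))"
        using hk[of "int (Suc i)" "Suc i"] hk[of "- int (Suc i)" "Suc i"] by simp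
    qed
    also have "(\<Sum>i<N. 2 * C * (real (Suc i) powr (- \<sigma>) * ?D (Suc i))) = 
         2 * C * (\<Sum>i\<in>{1..N}. real i powr (- \<sigma>) * ?D i)"
      by (simp only: sum_distrib_left[symmetric] One_nat_def sum.atLeast1_atMost_eq)
    also have "\<dots> \<le> 2 * C * (2 * ?d * real N powr (1 - \<sigma>))"
      using C1 by (intro mult_left_mono sum_gcd_powr_le \<sigma> q) auto
    finally have Hb: "(\<integral>x. H x \<partial>\<nu>) \<le> real q * \<Phi> + 4 * C * ?d * real N powr (1 - \<sigma>)" using Hh by simp
    have contH: "continuous_on UNIV H"
      unfolding H_def fejer_def by (intro continuous_intros) (use N1 in auto)
    have intgH: "integrable \<nu> H"
    proof (rule integrable_const_bound)
      show "AE x in \<nu>. norm (H x) \<le> (\<Sum>p\<in>admissible_residues a b q. (real N)\<^sup>2 / real N)"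
      proof (rule AE_I2)
        fix x
        have "fejer N y \<le> (real N)\<^sup>2 / real N" for y
        proof -
          have "cmod (\<Sum>n<N. ee (real n * y)) \<le> (\<Sum>n<N. 1)" by (intro sum_norm_le) auto
          thus ?thesis unfolding fejer_def by (intro divide_right_mono power_mono) auto
        qed
        hence "H x \<le> (\<Sum>p\<in>admissible_residues a b q. (real N)\<^sup>2 / real N)"
          unfolding H_def by (intro sum_mono)
        thus "norm (H x) \<le> (\<Sum>p\<in>admissible_residues a b q. (real N)\<^sup>2 / real N)"
          using H0[of x] by (simp only: real_norm_def abs_of_nonneg)
      qed
      show "H \<in> borel_measurable \<nu>" using borel_measurable_continuous_onI[OF contH] by simp
    qed
    have "measure \<nu> (approx_set a b q \<psi> \<theta>) = (\<integral>x. indicator (approx_set a b q \<psi> \<theta>) x \<partial>\<nu>)"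
      using mE by simp
    also have "\<dots> \<le> (\<integral>x. 4 / real N * H x \<partial>\<nu>)"
      using ind mE intgH
      by (intro integral_mono integrable_real_indicator) (auto simp: emeasure_eq_measure)
    also have "\<dots> = 4 / real N * (\<integral>x. H x \<partial>\<nu>)" by simp
    also have "\<dots> \<le> 4 / real N * (real q * \<Phi> + 4 * C * ?d * real N powr (1 - \<sigma>))"
      using Hb by (intro mult_left_mono) auto
    also have "\<dots> = 4 * (real q / real N) * \<Phi> + 16 * C * ?d * real N powr (- \<sigma>)"
      using N1 by (simp add: powr_diff powr_minus field_simps)
    also have "\<dots> \<le> 4 * (12 * \<psi>) * \<Phi> + 16 * C * ?d * (12 * (\<psi> / real q) powr \<sigma>)"
    proof (intro add_mono mult_left_mono mult_right_mono)
      show "real q / real N \<le> 12 * \<psi>" using N2 N1 3 by (simp add: field_simps)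
      have "real N powr (- \<sigma>) \<le> (real q / (12 * \<psi>)) powr (- \<sigma>)"
        using N2 \<sigma> q 3 by (intro powr_mono2') auto
      also have "\<dots> = (12 * (\<psi> / real q)) powr \<sigma>"
        using q 3 by (simp add: powr_minus powr_divide powr_mult inverse_eq_divide)
      also have "\<dots> = 12 powr \<sigma> * (\<psi> / real q) powr \<sigma>"
        by (rule powr_mult)
      also have "12 powr \<sigma> \<le> 12 powr (1::real)" using \<sigma> by (intro powr_mono) auto
      finally show "real N powr (- \<sigma>) \<le> 12 * (\<psi> / real q) powr \<sigma>" by (simp add: mult_right_mono)
    qed (use C1 \<Phi>0 in auto)
    also have "\<dots> = 48 * (\<psi> * \<Phi>) + 192 * C * (?d * (\<psi> / real q) powr \<sigma>)" by simp
    also have "\<dots> \<le> (300 * C + 300) * (\<psi> * \<Phi>) + (300 * C + 300) * (?d * (\<psi> / real q) powr \<sigma>)"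
      using C1 \<Phi>0 \<psi> by (intro add_mono mult_right_mono) auto
    also have "\<dots> = (300 * C + 300) * ?R" by (simp only: ring_distribs)
    finally show ?thesis .
  qed
  thus ?thesis unfolding \<Phi>_def .
qed

section \<open>Summing over the layers: the Borel-Cantelli argument\<close>

lemma finite_near_int: 
  assumes "q > 0"
  shows "finite {p::int. \<bar>x - (of_int p + \<theta>) / real q\<bar> < c}"
proof (rule finite_subset)
  show "{p::int. \<bar>x - (of_int p + \<theta>) / real q\<bar> < c} \<subseteq> {\<lfloor>real q * (x - c) - \<theta>\<rfloor>..\<lceil>real q * (x + c) - \<theta>\<rceil>}"
  proof
    fix p assume "p \<in> {p::int. \<bar>x - (of_int p + \<theta>) / real q\<bar> < c}"
    hence "x - c < (of_int p + \<theta>) / real q" "(of_int p + \<theta>) / real q < x + c" by auto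
    hence "real q * (x - c) - \<theta> < of_int p" "of_int p < real q * (x + c) - \<theta>"
      using assms by (auto simp: field_simps)
    thus "p \<in> {\<lfloor>real q * (x - c) - \<theta>\<rfloor>..\<lceil>real q * (x + c) - \<theta>\<rceil>}"
      by (auto simp: floor_le_iff le_ceiling_iff)
  qed
qed simp

lemma summable_on_restrict:
  fixes f :: "nat \<Rightarrow> real"
  assumes "f summable_on Q"
  shows "summable (\<lambda>n. if n \<in> Q then f n else 0)"
proof -
  have "(\<lambda>n. if n \<in> Q then f n else 0) summable_on UNIV \<longleftrightarrow> f summable_on Q"
    by (rule summable_on_cong_neutral) auto
  thus ?thesis using assms summable_on_imp_summable by blast
qed

text \<open>It provides a member of the set whose infimum is \<open>conv_exponent\<close>; the
  infimum of an empty set of reals would be unspecified.\<close>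

lemma summable_on_powr_2:
  fixes Q :: "nat set" and \<psi> :: "nat \<Rightarrow> real"
  assumes Q0: "\<And>q. q \<in> Q \<Longrightarrow> q > 0" and \<psi>: "\<And>q. q \<in> Q \<Longrightarrow> \<psi> q \<in> {0..<1/2}"
  shows "(\<lambda>q. (\<psi> q / real q) powr 2) summable_on Q"
proof -
  have "(\<lambda>q. 1 / real q ^ 2) summable_on UNIV"
    using inverse_power_summable[of 2, where 'a = real]
    by (intro summable_nonneg_imp_summable_on) (auto simp: inverse_eq_divide)
  hence "(\<lambda>q. 1 / real q ^ 2) summable_on Q" by (rule summable_on_subset_banach) auto
  thus ?thesis
  proof (rule summable_on_comparison_test)
    fix q assume q: "q \<in> Q"
    have "(\<psi> q / real q) powr 2 \<le> (1 / real q) powr 2"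
      using \<psi>[OF q] Q0[OF q] by (intro powr_mono2 divide_right_mono) auto
    thus "(\<psi> q / real q) powr 2 \<le> 1 / real q ^ 2"
      using Q0[OF q] by (simp add: powr_divide)
  qed auto
qed

lemma fourier_decay_exponent_le:
  fixes Q :: "nat set" and A B :: "nat \<Rightarrow> int" and \<psi> \<theta> :: "nat \<Rightarrow> real"
  assumes Q0: "\<And>q. q \<in> Q \<Longrightarrow> q > 0"
    and AB: "\<And>q. q \<in> Q \<Longrightarrow> gcd (A q) (B q) = 1"
    and \<psi>: "\<And>q. q \<in> Q \<Longrightarrow> \<psi> q \<in> {0..<1/2}"
    and sm: "(\<lambda>q. \<psi> q * (\<Prod>l | prime l \<and> l dvd q \<and> \<not> int l dvd B q. 1 - 1 / real l)) summable_on Q"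
    and t: "0 \<le> t" "t \<le> 1" and \<nu>: "\<nu> \<in> prob_measures_on (W_star A B Q \<psi> \<theta>)"
    and decay: "\<And>\<xi>. cmod (fourier_meas \<nu> \<xi>) \<le> C * (1 + \<bar>\<xi>\<bar>) powr (- t / 2)"
  shows "t \<le> 2 * conv_exponent Q \<psi>"
proof (rule ccontr)
  assume "\<not> t \<le> 2 * conv_exponent Q \<psi>"
  define S where "S = {s. s \<ge> 0 \<and> (\<lambda>q. (\<psi> q / real q) powr s) summable_on Q}"
  have "2 \<in> S" using summable_on_powr_2[of Q \<psi>, OF Q0 \<psi>] by (simp add: S_def)
  moreover have "Inf S < t / 2" using \<open>\<not> t \<le> _\<close> by (simp add: conv_exponent_def S_def)
  ultimately obtain s where s: "s \<in> S" "s < t / 2" using cInf_lessD[of S "t / 2"] by blast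
  \<comment> \<open>The gap between t / 2 and s pays for the divisor function: d(q) (\<psi>/q)^(t/2)
    <= K q^\<epsilon> (\<psi>/q)^\<epsilon> (\<psi>/q)^s = K \<psi>^\<epsilon> (\<psi>/q)^s, where
    q^\<epsilon> has cancelled and \<psi>^\<epsilon> <= 1.\<close>
  define \<epsilon> where "\<epsilon> = t / 2 - s"
  have \<epsilon>: "\<epsilon> > 0" using s by (simp add: \<epsilon>_def)
  obtain K where K: "K > 0" "\<And>n. n > 0 \<Longrightarrow> real (card {d. d dvd n}) \<le> K * real n powr \<epsilon>"
    using divisor_bound[OF \<epsilon>] by blast
  interpret real_distribution \<nu> using \<nu> by (simp add: prob_measures_on_def)
  have rd: "real_distribution \<nu>" by unfold_locales
  have C1: "C \<ge> 1" using decay[of 0] by (simp add: fourier_meas_def prob_space del: space_eq_univ)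
  define E where "E n = (if n \<in> Q then approx_set (A n) (B n) n (\<psi> n) (\<theta> n) else {})" for n
  have mE: "E n \<in> sets \<nu>" for n using open_approx_set by (auto simp: E_def)
  let ?P = "\<lambda>q. \<psi> q * (\<Prod>l | prime l \<and> l dvd q \<and> \<not> int l dvd B q. 1 - 1 / real l)"
  have bound: "measure \<nu> (E q) \<le> (300 * C + 300) * (?P q + K * (\<psi> q / real q) powr s)" if q: "q \<in> Q" for q
  proof -
    have q0: "q > 0" using Q0 q by simp
    have "measure \<nu> (E q) \<le> (300 * C + 300) * (?P q + real (card {d. d dvd q}) * (\<psi> q / real q) powr (t / 2))"
      unfolding E_def using q \<psi>[OF q] t decay AB[OF q] q0
      by (simp only: if_True, intro measure_approx_set_le rd) auto
    also have "real (card {d. d dvd q}) * (\<psi> q / real q) powr (t / 2) \<le> K * (\<psi> q / real q) powr s"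
    proof -
      have "(\<psi> q / real q) powr (t / 2) = (\<psi> q / real q) powr \<epsilon> * (\<psi> q / real q) powr s"
        by (simp add: \<epsilon>_def flip: powr_add)
      hence "real (card {d. d dvd q}) * (\<psi> q / real q) powr (t / 2) \<le> 
          (K * real q powr \<epsilon>) * ((\<psi> q / real q) powr \<epsilon> * (\<psi> q / real q) powr s)"
        using K(2)[OF q0] by (simp add: mult_right_mono)
      also have "\<dots> = K * (\<psi> q powr \<epsilon>) * (\<psi> q / real q) powr s"
        using q0 \<psi>[OF q] by (simp add: powr_divide)
      also have "\<dots> \<le> K * 1 * (\<psi> q / real q) powr s"
        using K(1) \<psi>[OF q] \<epsilon> by (intro mult_right_mono mult_left_mono powr_le1) auto
      finally show ?thesis by simp
    qed
    finally show ?thesis using C1 by (simp add: mult_left_mono)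
  qed
  have P0: "?P q \<ge> 0" if "q \<in> Q" for q
    using \<psi>[OF that] by (intro mult_nonneg_nonneg prod_nonneg) (auto simp: prime_gt_0_nat Suc_leI)
  have "summable (\<lambda>n. measure \<nu> (E n))"
  proof (rule summable_comparison_test')
    show "summable (\<lambda>n. (300 * C + 300) * ((if n \<in> Q then ?P n else 0) + K * (if n \<in> Q then (\<psi> n / real n) powr s else 0)))"
      using s(1) sm by (intro summable_mult summable_add summable_on_restrict) (auto simp: S_def)
    show "norm (measure \<nu> (E n)) \<le> (300 * C + 300) * ((if n \<in> Q then ?P n else 0) + K * (if n \<in> Q then (\<psi> n / real n) powr s else 0))" for n
      using bound[of n] by (auto simp: E_def)
  qed
  hence "AE x in \<nu>. eventually (\<lambda>n. x \<in> space \<nu> - E n) sequentially"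
    using mE by (intro borel_cantelli_AE1) (auto simp: emeasure_eq_measure)
  moreover have "AE x in \<nu>. x \<in> W_star A B Q \<psi> \<theta>" using \<nu> by (simp add: prob_measures_on_def)
  ultimately have "AE x in \<nu>. False"
  proof eventually_elim
    case (elim x)
    obtain N where N: "\<And>n. n \<ge> N \<Longrightarrow> x \<notin> E n" using elim(1) by (auto simp: eventually_sequentially)
    \<comment> \<open>\<open>W_star\<close> counts pairs while Borel-Cantelli counts layers. For
      each q only finitely many p fit, so lying in finitely many layers leaves finitely many
      pairs.\<close>
    have "{(p :: int, q :: nat). q \<in> Q \<and> gcd (B q * p + A q) (int q) = 1 \<and>
         \<bar>x - (of_int p + \<theta> q) / real q\<bar> < \<psi> q / real q} \<subseteq> 
       (\<Union>q\<in>{..<N} \<inter> Q. {p::int. \<bar>x - (of_int p + \<theta> q) / real q\<bar> < \<psi> q / real q} \<times> {q})"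
    proof (rule subsetI)
      fix z assume z: "z \<in> {(p :: int, q :: nat). q \<in> Q \<and> gcd (B q * p + A q) (int q) = 1 \<and>
         \<bar>x - (of_int p + \<theta> q) / real q\<bar> < \<psi> q / real q}"
      define p q where "p = fst z" and "q = snd z"
      from z have pq: "q \<in> Q" "gcd (B q * p + A q) (int q) = 1" "\<bar>x - (of_int p + \<theta> q) / real q\<bar> < \<psi> q / real q"
        by (simp_all only: mem_Collect_eq case_prod_unfold p_def q_def)
      hence "x \<in> E q" by (simp only: E_def approx_set_def if_True mem_Collect_eq) (intro exI[of _ p] conjI)
      hence "q < N" using N[of q] by force
      thus "z \<in> (\<Union>q\<in>{..<N} \<inter> Q. {p::int. \<bar>x - (of_int p + \<theta> q) / real q\<bar> < \<psi> q / real q} \<times> {q})"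
        using pq by (cases z) (auto simp: p_def q_def)
    qed
    moreover have "finite (\<Union>q\<in>{..<N} \<inter> Q. {p::int. \<bar>x - (of_int p + \<theta> q) / real q\<bar> < \<psi> q / real q} \<times> {q})"
      using Q0 by (intro finite_UN_I finite_cartesian_product finite_near_int) auto
    ultimately have "finite {(p :: int, q :: nat). q \<in> Q \<and> gcd (B q * p + A q) (int q) = 1 \<and>
         \<bar>x - (of_int p + \<theta> q) / real q\<bar> < \<psi> q / real q}" by (rule finite_subset)
    thus False using elim(2) by (simp add: W_star_def)
  qed
  thus False using ae_filter_bot by (simp only: eventually_False)
qed

section \<open>Averages of tents over a dyadic block\<close>

lemma norm_residue_exp_sum_le_card: "cmod (residue_exp_sum a b q l) \<le> real (card (admissible_residues a b q))"
  unfolding residue_exp_sum_def by (rule order_trans[OF sum_norm_le[where g = "\<lambda>_. 1"]]) auto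

text \<open>The Fourier coefficients of the following average of tents of half-width r: first over
  the centres (p + \<theta> q) / q with p an admissible residue modulo q, then over q in S. Each q
  has the same weight, however many residues it has.\<close>

definition block_coeff :: 
  "(nat \<Rightarrow> int) \<Rightarrow> (nat \<Rightarrow> int) \<Rightarrow> (nat \<Rightarrow> real) \<Rightarrow> nat set \<Rightarrow> real \<Rightarrow> int \<Rightarrow> complex" where
  "block_coeff A B \<theta> S r l = of_real ((sinc_coeff r l)\<^sup>2 / real (card S)) *
     (\<Sum>q\<in>S. ee (- (of_int l * \<theta> q / real q)) * residue_exp_sum (A q) (B q) q l / of_nat (card (admissible_residues (A q) (B q) q)))"

context
  fixes A B :: "nat \<Rightarrow> int" and \<theta> :: "nat \<Rightarrow> real" and S :: "nat set" and r :: real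
  assumes S: "finite S" "S \<noteq> {}" and S0: "\<And>q. q \<in> S \<Longrightarrow> q > 0" 
    and AB: "\<And>q. q \<in> S \<Longrightarrow> gcd (A q) (B q) = 1" and r: "r > 0"
begin

lemma card_units_pos: "q \<in> S \<Longrightarrow> card (admissible_residues (A q) (B q) q) > 0"
  using card_admissible_residues_ge[of q "A q" "B q"] S0[of q] AB[of q] by (metis gr0I mult_zero_left of_nat_0 of_nat_0_less_iff not_le)

lemma block_function:
  obtains G :: "real \<Rightarrow> real" where 
    "\<And>x. (\<lambda>j. \<Sum>l\<in>{- int j..int j}. block_coeff A B \<theta> S r l * ee (of_int l * x)) \<longlonglongrightarrow> of_real (G x)"
    "\<And>x. G x \<ge> 0" 
    "\<And>x. G x \<noteq> 0 \<Longrightarrow> \<exists>q\<in>S. \<exists>p. gcd (B q * p + A q) (int q) = 1 \<and> \<bar>x - (of_int p + \<theta> q) / real q\<bar> \<le> r"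
proof -
  obtain g where g: 
    "\<And>x. (\<lambda>j. \<Sum>k\<in>{- int j..int j}. of_real ((sinc_coeff r k)\<^sup>2) * ee (of_int k * x)) \<longlonglongrightarrow> of_real (g x)"
    "\<And>x. g x \<ge> 0" "\<And>x. (\<And>n::int. \<bar>x - of_int n\<bar> > r) \<Longrightarrow> g x = 0"
    using periodic_bump[OF r] by blast
  let ?U = "\<lambda>q. admissible_residues (A q) (B q) q"
  define G where "G x = (\<Sum>q\<in>S. (\<Sum>p\<in>?U q. g (x - (of_int p + \<theta> q) / real q)) / real (card (?U q))) / real (card S)" for x
  have eq: "block_coeff A B \<theta> S r l * ee (of_int l * x) = (\<Sum>q\<in>S. (\<Sum>p\<in>?U q. 
       of_real ((sinc_coeff r l)\<^sup>2) * ee (of_int l * (x - (of_int p + \<theta> q) / real q))) / of_nat (card (?U q))) / of_nat (card S)" for l x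
  proof -
    have "ee (of_int l * (x - (of_int p + \<theta> q) / real q)) = 
       ee (- (of_int l * \<theta> q / real q)) * ee (- (of_int l * of_int p / real q)) * ee (of_int l * x)" for p q
    proof -
      have "of_int l * (x - (of_int p + \<theta> q) / real q) = 
         - (of_int l * \<theta> q / real q) + - (of_int l * of_int p / real q) + of_int l * x"
        by (simp add: add_divide_distrib ring_distribs)
      thus ?thesis by (simp only: ee_add)
    qed
    thus ?thesis
      by (simp add: block_coeff_def residue_exp_sum_def sum_distrib_left sum_distrib_right sum_divide_distrib mult_ac)
  qed
  show ?thesis
  proof (rule that[of G])
    fix x
    have "(\<lambda>j. (\<Sum>q\<in>S. (\<Sum>p\<in>?U q. \<Sum>l\<in>{- int j..int j}. 
       of_real ((sinc_coeff r l)\<^sup>2) * ee (of_int l * (x - (of_int p + \<theta> q) / real q))) / of_nat (card (?U q))) / of_nat (card S))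
      \<longlonglongrightarrow> (\<Sum>q\<in>S. (\<Sum>p\<in>?U q. of_real (g (x - (of_int p + \<theta> q) / real q))) / of_nat (card (?U q))) / of_nat (card S)"
      using S card_units_pos by (intro tendsto_divide tendsto_sum g(1) tendsto_const) fastforce+
    also have "(\<Sum>q\<in>S. (\<Sum>p\<in>?U q. of_real (g (x - (of_int p + \<theta> q) / real q))) / of_nat (card (?U q))) / of_nat (card S) = complex_of_real (G x)"
      by (simp add: G_def)
    also have "(\<lambda>j. (\<Sum>q\<in>S. (\<Sum>p\<in>?U q. \<Sum>l\<in>{- int j..int j}. 
       of_real ((sinc_coeff r l)\<^sup>2) * ee (of_int l * (x - (of_int p + \<theta> q) / real q))) / of_nat (card (?U q))) / of_nat (card S))
       = (\<lambda>j. \<Sum>l\<in>{- int j..int j}. block_coeff A B \<theta> S r l * ee (of_int l * x))"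
      unfolding eq by (simp only: sum_divide_distrib sum.swap[of _ _ "{- int _..int _}"])
    finally show "(\<lambda>j. \<Sum>l\<in>{- int j..int j}. block_coeff A B \<theta> S r l * ee (of_int l * x)) \<longlonglongrightarrow> of_real (G x)" .
    show "G x \<ge> 0" unfolding G_def by (intro divide_nonneg_nonneg sum_nonneg g(2)) auto
    assume "G x \<noteq> 0"
    then obtain q where q: "q \<in> S" "(\<Sum>p\<in>?U q. g (x - (of_int p + \<theta> q) / real q)) / real (card (?U q)) \<noteq> 0"
      unfolding G_def using sum.not_neutral_contains_not_neutral by (metis (no_types, lifting) divide_eq_0_iff)
    then obtain p where p: "p \<in> ?U q" "g (x - (of_int p + \<theta> q) / real q) \<noteq> 0"
      using sum.not_neutral_contains_not_neutral by (metis (no_types, lifting) divide_eq_0_iff)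
    then obtain n where n: "\<bar>x - (of_int p + \<theta> q) / real q - of_int n\<bar> \<le> r"
      using g(3)[of "x - (of_int p + \<theta> q) / real q"] by (meson not_le)
    have "x - (of_int p + \<theta> q) / real q - of_int n = x - (of_int (p + int q * n) + \<theta> q) / real q"
      using S0[OF q(1)] by (simp add: field_simps)
    moreover have "gcd (B q * (p + int q * n) + A q) (int q) = 1"
    proof -
      have "B q * (p + int q * n) + A q = (B q * n) * int q + (B q * p + A q)" by (simp add: algebra_simps)
      hence "gcd (int q) (B q * (p + int q * n) + A q) = gcd (int q) (B q * p + A q)"
        by (simp only: gcd_add_mult)
      thus ?thesis using p(1) by (simp add: admissible_residues_def gcd.commute)
    qed
    ultimately show "\<exists>q\<in>S. \<exists>p. gcd (B q * p + A q) (int q) = 1 \<and> \<bar>x - (of_int p + \<theta> q) / real q\<bar> \<le> r"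
      using q(1) n by metis
  qed
qed

lemma block_coeff_0: "block_coeff A B \<theta> S r 0 = 1"
proof -
  have "(\<Sum>q\<in>S. ee (- (of_int 0 * \<theta> q / real q)) * residue_exp_sum (A q) (B q) q 0 / of_nat (card (admissible_residues (A q) (B q) q))) = (\<Sum>q\<in>S. 1)"
    using card_units_pos by (intro sum.cong refl) (simp add: residue_exp_sum_0_card card_gt_0_iff)
  thus ?thesis using S unfolding block_coeff_def by (simp add: sinc_coeff_def)
qed

lemma norm_block_coeff_le:
  assumes "\<And>q. q \<in> S \<Longrightarrow> cmod (residue_exp_sum (A q) (B q) q l) / real (card (admissible_residues (A q) (B q) q)) \<le> f q"
  shows "cmod (block_coeff A B \<theta> S r l) \<le> (sinc_coeff r l)\<^sup>2 * ((\<Sum>q\<in>S. f q) / real (card S))"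
proof -
  have "cmod (\<Sum>q\<in>S. ee (- (of_int l * \<theta> q / real q)) * residue_exp_sum (A q) (B q) q l / of_nat (card (admissible_residues (A q) (B q) q))) \<le> (\<Sum>q\<in>S. f q)"
    using assms by (intro sum_norm_le) (simp add: norm_mult norm_divide)
  hence "((sinc_coeff r l)\<^sup>2 / real (card S)) * cmod (\<Sum>q\<in>S. ee (- (of_int l * \<theta> q / real q)) * residue_exp_sum (A q) (B q) q l / of_nat (card (admissible_residues (A q) (B q) q)))
     \<le> ((sinc_coeff r l)\<^sup>2 / real (card S)) * (\<Sum>q\<in>S. f q)" by (intro mult_left_mono) auto
  thus ?thesis unfolding block_coeff_def norm_mult norm_of_real by simp
qed

lemma norm_block_coeff_le_sinc: "cmod (block_coeff A B \<theta> S r l) \<le> (sinc_coeff r l)\<^sup>2"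
  using norm_block_coeff_le[of l "\<lambda>_. 1"] norm_residue_exp_sum_le_card card_units_pos S
  by (simp add: divide_le_eq_1)

text \<open>A crude bound whose constant explodes as r tends to 0. It only serves to keep each
  product density in the class with decay of rate 2 and to make the Fourier series converge
  absolutely.\<close>

lemma norm_block_coeff_quadratic: 
  "cmod (block_coeff A B \<theta> S r l) \<le> (1 + 4 / r\<^sup>2) * (1 + \<bar>of_int l\<bar>) powr (-2)"
proof (cases "l = 0")
  case True
  thus ?thesis by (simp add: block_coeff_0)
next
  case False
  hence l: "\<bar>of_int l\<bar> \<ge> (1::real)" by (metis Ints_of_int of_int_0_eq_iff Ints_nonzero_abs_ge1)
  have "cmod (block_coeff A B \<theta> S r l) \<le> 1 / (\<bar>of_int l\<bar> * r)\<^sup>2"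
    using norm_block_coeff_le_sinc[of l] sinc_coeff_sq_le(2)[OF r False] by linarith
  also have "\<dots> \<le> 1 / ((1 + \<bar>of_int l\<bar>) / 2 * r)\<^sup>2"
    using l r by (intro divide_left_mono power_mono mult_right_mono mult_pos_pos zero_less_power) auto
  also have "\<dots> = 4 / r\<^sup>2 * (1 + \<bar>of_int l\<bar>) powr (-2)"
    using l by (simp add: powr_minus power_mult_distrib power_divide inverse_eq_divide)
  also have "\<dots> \<le> (1 + 4 / r\<^sup>2) * (1 + \<bar>of_int l\<bar>) powr (-2)"
    by (intro mult_right_mono) auto
  finally show ?thesis .
qed

end

section \<open>Cancellation from averaging over q\<close>

lemma harmonic_le_ln: "M > 0 \<Longrightarrow> (\<Sum>j\<in>{1..M}. 1 / real j) \<le> 1 + ln (real M)"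
proof (induction M)
  case (Suc M)
  show ?case
  proof (cases "M = 0")
    case False
    have "ln (real M / real (Suc M)) \<le> real M / real (Suc M) - 1"
      using False by (intro ln_le_minus_one) auto
    also have "\<dots> = - (1 / real (Suc M))" by (simp add: field_simps)
    finally have "1 / real (Suc M) \<le> ln (real (Suc M)) - ln (real M)"
      using False by (simp add: ln_div)
    thus ?thesis using Suc False by simp
  qed auto
qed auto

text \<open>The counterpart of \<open>sum_gcd_powr_le\<close> with l fixed and q varying: a divisor
  e of l meets only the multiples q = e * j, and e / q = 1 / j leaves a harmonic sum.\<close>

lemma sum_gcd_div_le:
  fixes l M :: nat
  assumes "l > 0" "M > 0"
  shows "(\<Sum>q\<in>{1..M}. (\<Sum>e | e dvd q \<and> e dvd l. real e) / real q) 
    \<le> real (card {d. d dvd l}) * (1 + ln (real M))"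
proof -
  have "(\<Sum>q\<in>{1..M}. (\<Sum>e | e dvd q \<and> e dvd l. real e) / real q) = 
     (\<Sum>q\<in>{1..M}. \<Sum>e | e \<in> {d. d dvd l} \<and> e dvd q. real e / real q)"
    by (simp add: sum_divide_distrib conj_commute)
  also have "\<dots> = (\<Sum>e\<in>{d. d dvd l}. \<Sum>q | q \<in> {1..M} \<and> e dvd q. real e / real q)"
    using assms by (intro sum.swap_restrict) auto
  also have "\<dots> \<le> (\<Sum>e\<in>{d. d dvd l}. 1 + ln (real M))"
  proof (intro sum_mono)
    fix e assume "e \<in> {d. d dvd l}"
    hence e: "e > 0" using assms by (auto intro: dvd_pos_nat)
    have "(\<Sum>q | q \<in> {1..M} \<and> e dvd q. real e / real q) = (\<Sum>j\<in>{1..M div e}. 1 / real j)"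
      unfolding sum_multiples[OF e] using e by (intro sum.cong refl) simp
    also have "\<dots> \<le> (\<Sum>j\<in>{1..M}. 1 / real j)" by (intro sum_mono2) auto
    also have "\<dots> \<le> 1 + ln (real M)" using assms by (intro harmonic_le_ln)
    finally show "(\<Sum>q | q \<in> {1..M} \<and> e dvd q. real e / real q) \<le> 1 + ln (real M)" .
  qed
  finally show ?thesis by simp
qed

text \<open>The losses are M^\<epsilon> from the divisor bound for the number of admissible
  residues, |l|^\<epsilon> from d(l), and M^\<epsilon> from the logarithm. The tent gives the factor
  (|l| r)^(-(\<sigma> + \<epsilon>)), whose additional \<epsilon> cancels |l|^\<epsilon>; the gain
  is the division by card S. K depends on \<epsilon> alone, so it is fixed before the block is
  chosen.\<close>

lemma norm_block_coeff_decay: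
  assumes \<epsilon>: "\<epsilon> > 0" and \<sigma>: "0 \<le> \<sigma>" "\<sigma> + \<epsilon> \<le> 2"
  obtains K where "K > 0" "\<And>A B \<theta> S r M l. finite S \<Longrightarrow> S \<noteq> {} \<Longrightarrow> S \<subseteq> {1..M} \<Longrightarrow> 
    (\<And>q. q \<in> S \<Longrightarrow> gcd (A q) (B q) = 1) \<Longrightarrow> r > 0 \<Longrightarrow> l \<noteq> 0 \<Longrightarrow>
    cmod (block_coeff A B \<theta> S r l) \<le> K * \<bar>of_int l\<bar> powr (- \<sigma>) * (r powr (- (\<sigma> + \<epsilon>)) * real M powr (2 * \<epsilon>) / real (card S))"
proof -
  obtain K where K: "K > 0" "\<And>n. n > 0 \<Longrightarrow> real (card {d. d dvd n}) \<le> K * real n powr \<epsilon>"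
    using divisor_bound[OF \<epsilon>] by blast
  define K2 where "K2 = 1 + 1 / \<epsilon>"
  have K2: "K2 > 0" using \<epsilon> by (simp add: K2_def add_pos_pos)
  show ?thesis
  proof (rule that[of "K * K * K2"])
    show "K * K * K2 > 0" using K K2 by simp
    fix A B :: "nat \<Rightarrow> int" and \<theta> :: "nat \<Rightarrow> real" and S :: "nat set" and r :: real and M :: nat and l :: int
    assume S: "finite S" "S \<noteq> {}" "S \<subseteq> {1..M}" and AB: "\<And>q. q \<in> S \<Longrightarrow> gcd (A q) (B q) = 1" and r: "r > 0" and l: "l \<noteq> 0"
    have M: "M > 0" using S by auto
    define n where "n = nat \<bar>l\<bar>"
    have n: "n > 0" "real n = \<bar>of_int l\<bar>" using l by (auto simp: n_def)
    let ?D = "\<lambda>q. (\<Sum>e | e dvd q \<and> e dvd n. real e) / real q"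
    have "cmod (residue_exp_sum (A q) (B q) q l) / real (card (admissible_residues (A q) (B q) q)) \<le> K * real M powr \<epsilon> * ?D q" if q: "q \<in> S" for q
    proof -
      have q0: "q > 0" "q \<le> M" using q S(3) by auto
      let ?u = "real (card (admissible_residues (A q) (B q) q))"
      have 1: "cmod (residue_exp_sum (A q) (B q) q l) \<le> (\<Sum>e | e dvd q \<and> e dvd n. real e)"
      proof -
        have "int e dvd l \<longleftrightarrow> e dvd n" for e by (simp add: n_def int_dvd_int_iff[symmetric])
        thus ?thesis using norm_residue_exp_sum_le[OF q0(1) AB[OF q], of l] by simp
      qed
      have 2: "real q \<le> ?u * real (card {d. d dvd q})" by (rule card_admissible_residues_ge[OF q0(1) AB[OF q]])
      also have "\<dots> \<le> ?u * (K * real M powr \<epsilon>)"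
      proof (intro mult_left_mono)
        have "real (card {d. d dvd q}) \<le> K * real q powr \<epsilon>" by (rule K(2)[OF q0(1)])
        also have "\<dots> \<le> K * real M powr \<epsilon>" using K q0 \<epsilon> by (intro mult_left_mono powr_mono2) auto
        finally show "real (card {d. d dvd q}) \<le> K * real M powr \<epsilon>" .
      qed auto
      finally have 3: "real q \<le> ?u * (K * real M powr \<epsilon>)" .
      hence "?u \<noteq> 0" using q0 by (metis mult_zero_left not_le of_nat_0_less_iff)
      moreover have "?u \<ge> 0" by (rule of_nat_0_le_iff)
      ultimately have u: "?u > 0" by linarith
      have "1 / ?u \<le> K * real M powr \<epsilon> / real q" using 3 u q0 by (simp add: field_simps)
      hence "cmod (residue_exp_sum (A q) (B q) q l) * (1 / ?u) \<le> (\<Sum>e | e dvd q \<and> e dvd n. real e) * (K * real M powr \<epsilon> / real q)"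
        using 1 by (intro mult_mono) (auto intro: sum_nonneg)
      thus ?thesis by (simp add: field_simps)
    qed
    hence "cmod (block_coeff A B \<theta> S r l) \<le> (sinc_coeff r l)\<^sup>2 * ((\<Sum>q\<in>S. K * real M powr \<epsilon> * ?D q) / real (card S))"
      using S AB r by (intro norm_block_coeff_le) auto
    also have "\<dots> \<le> (real n * r) powr (- (\<sigma> + \<epsilon>)) * ((K * real M powr \<epsilon> * ((K * real n powr \<epsilon>) * (K2 * real M powr \<epsilon>))) / real (card S))"
    proof (intro mult_mono divide_right_mono)
      \<comment> \<open>The minimum of 1 and y^(-2) lies below y^(-a) for every a between 0 and
        2.\<close>
      show "(sinc_coeff r l)\<^sup>2 \<le> (real n * r) powr (- (\<sigma> + \<epsilon>))"
      proof (cases "real n * r \<le> 1")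
        case True
        have "1 \<le> (real n * r) powr (- (\<sigma> + \<epsilon>))"
          using True n(1) r \<sigma> \<epsilon> powr_mono'[of "- (\<sigma> + \<epsilon>)" 0 "real n * r"] by simp
        thus ?thesis using sinc_coeff_sq_le(1)[OF r l] by linarith
      next
        case False
        have "(sinc_coeff r l)\<^sup>2 \<le> 1 / (real n * r)\<^sup>2" using sinc_coeff_sq_le(2)[OF r l] n by simp
        also have "\<dots> = (real n * r) powr (-2)" using False by (simp add: powr_minus inverse_eq_divide)
        also have "\<dots> \<le> (real n * r) powr (- (\<sigma> + \<epsilon>))" using False \<sigma> by (intro powr_mono) auto
        finally show ?thesis .
      qed
      have "(\<Sum>q\<in>S. K * real M powr \<epsilon> * ?D q) = K * real M powr \<epsilon> * (\<Sum>q\<in>S. ?D q)"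
        by (simp only: sum_distrib_left)
      also have "(\<Sum>q\<in>S. ?D q) \<le> (\<Sum>q\<in>{1..M}. ?D q)"
        using S by (intro sum_mono2) (auto intro!: divide_nonneg_nonneg sum_nonneg)
      also have "\<dots> \<le> real (card {d. d dvd n}) * (1 + ln (real M))"
        by (rule sum_gcd_div_le[OF n(1) M])
      also have "\<dots> \<le> (K * real n powr \<epsilon>) * (K2 * real M powr \<epsilon>)"
      proof (intro mult_mono K(2) n(1))
        have "1 \<le> real M powr \<epsilon>" using M \<epsilon> by (simp add: ge_one_powr_ge_zero)
        moreover have "ln (real M) \<le> real M powr \<epsilon> / \<epsilon>" using M \<epsilon> by (intro ln_powr_bound) auto
        ultimately show "1 + ln (real M) \<le> K2 * real M powr \<epsilon>" by (simp add: K2_def ring_distribs)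
      qed (use K M in auto)
      finally show "(\<Sum>q\<in>S. K * real M powr \<epsilon> * ?D q) \<le> K * real M powr \<epsilon> * ((K * real n powr \<epsilon>) * (K2 * real M powr \<epsilon>))"
        using K by (simp add: mult_left_mono)
    qed (use K in \<open>auto intro!: divide_nonneg_nonneg sum_nonneg mult_nonneg_nonneg\<close>)
    also have "\<dots> = K * K * K2 * (real n powr (- (\<sigma> + \<epsilon>)) * real n powr \<epsilon>) * (r powr (- (\<sigma> + \<epsilon>)) * (real M powr \<epsilon> * real M powr \<epsilon>) / real (card S))"
      using n r by (simp add: powr_mult mult_ac)
    also have "real n powr (- (\<sigma> + \<epsilon>)) * real n powr \<epsilon> = \<bar>of_int l\<bar> powr (- \<sigma>)"
      unfolding n(2)[symmetric] by (simp flip: powr_add)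
    also have "real M powr \<epsilon> * real M powr \<epsilon> = real M powr (2 * \<epsilon>)" by (simp flip: powr_add)
    finally show "cmod (block_coeff A B \<theta> S r l) \<le> K * K * K2 * \<bar>of_int l\<bar> powr (- \<sigma>) * (r powr (- (\<sigma> + \<epsilon>)) * real M powr (2 * \<epsilon>) / real (card S))" .
  qed
qed

section \<open>Dyadic blocks and the exponent of convergence\<close>

definition dyadic_block :: "nat set \<Rightarrow> (nat \<Rightarrow> real) \<Rightarrow> nat \<Rightarrow> nat set" where
  "dyadic_block Q \<psi> m = {q \<in> Q. (1 / 2) ^ Suc m < \<psi> q / real q \<and> \<psi> q / real q \<le> (1 / 2) ^ m}"

text \<open>Since \<psi> q < 1/2, the lower bound on \<psi> q / q forces q < 2^m. This makes blocks
  finite and lets 2^m play the role of M.\<close>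

lemma dyadic_block_subset:
  assumes "\<And>q. q \<in> Q \<Longrightarrow> q > 0" "\<And>q. q \<in> Q \<Longrightarrow> \<psi> q \<in> {0..<1/2}"
  shows "dyadic_block Q \<psi> m \<subseteq> {1..2 ^ m}"
proof
  fix q assume "q \<in> dyadic_block Q \<psi> m"
  hence q: "q \<in> Q" "(1 / 2) ^ Suc m < \<psi> q / real q" by (auto simp: dyadic_block_def)
  note q0 = assms(1)[OF q(1)]
  have "(1 / 2) ^ Suc m * real q < \<psi> q" using q(2) q0 by (simp add: field_simps)
  also have "\<dots> < 1 / 2" using assms(2)[OF q(1)] by simp
  finally have "real q < 2 ^ m" by (simp add: power_divide field_simps)
  hence "real q < real (2 ^ m)" by simp
  hence "q < 2 ^ m" by (simp only: of_nat_less_iff)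
  thus "q \<in> {1..2 ^ m}" using q0 by auto
qed

lemma dyadic_block_exists:
  assumes "0 < x" "x \<le> (1::real)"
  shows "\<exists>m. (1 / 2) ^ Suc m < x \<and> x \<le> (1 / 2) ^ m"
proof -
  have "\<exists>m. (1 / 2) ^ Suc m < x"
  proof -
    obtain n where "(1 / 2) ^ n < x" using real_arch_pow_inv[of x "1/2"] assms by auto
    moreover have "(1 / 2) ^ Suc n \<le> (1 / 2 :: real) ^ n" by simp
    ultimately show ?thesis by (intro exI[of _ n]) linarith
  qed
  define m where "m = (LEAST m. (1 / 2) ^ Suc m < x)"
  have 1: "(1 / 2) ^ Suc m < x" unfolding m_def by (rule LeastI_ex) fact
  have "x \<le> (1 / 2) ^ m"
  proof (cases m)
    case (Suc k)
    hence "\<not> (1 / 2) ^ Suc k < x" using not_less_Least[of k "\<lambda>m. (1 / 2) ^ Suc m < x"] by (simp add: m_def)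
    thus ?thesis by (simp add: Suc)
  qed (use assms in auto)
  thus ?thesis using 1 by blast
qed

text \<open>If all blocks from m0 on were smaller, then for \<rho> between \<tau> and the exponent
  of convergence the series of (\<psi> q / q)^\<rho>, grouped by blocks, would be dominated by the
  sum of card * 2^(-\<rho> m), eventually geometric. This contradicts the infimum. As m0 is
  arbitrary, large blocks occur at arbitrarily small scales.\<close>

lemma large_dyadic_block:
  assumes Q0: "\<And>q. q \<in> Q \<Longrightarrow> q > 0" and \<psi>: "\<And>q. q \<in> Q \<Longrightarrow> \<psi> q \<in> {0..<1/2}"
    and \<tau>: "0 \<le> \<tau>" "\<tau> < conv_exponent Q \<psi>"
  shows "\<exists>m\<ge>m0. real (card (dyadic_block Q \<psi> m)) \<ge> 2 powr (\<tau> * real m)"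
proof (rule ccontr)
  assume "\<not> ?thesis"
  hence small: "real (card (dyadic_block Q \<psi> m)) < 2 powr (\<tau> * real m)" if "m \<ge> m0" for m using that not_le by blast
  define \<rho> where "\<rho> = (\<tau> + conv_exponent Q \<psi>) / 2"
  have \<rho>: "\<tau> < \<rho>" "\<rho> < conv_exponent Q \<psi>" using \<tau> by (auto simp: \<rho>_def)
  define h where "h m = real (card (dyadic_block Q \<psi> m)) * 2 powr (- \<rho> * real m)" for m
  have h: "summable h"
  proof (rule summable_comparison_test)
    have "2 powr (\<tau> - \<rho>) < (1::real)" using \<rho> powr_less_mono[of "\<tau> - \<rho>" 0 "2::real"] by simp
    thus "summable (\<lambda>m. (2 powr (\<tau> - \<rho>)) ^ m :: real)" by (intro summable_geometric) auto
    show "\<exists>N. \<forall>n\<ge>N. norm (h n) \<le> (2 powr (\<tau> - \<rho>)) ^ n"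
    proof (intro exI allI impI)
      fix n assume n: "n \<ge> m0"
      have "h n \<le> 2 powr (\<tau> * real n) * 2 powr (- \<rho> * real n)"
        unfolding h_def using small[OF n] by (intro mult_right_mono) auto
      also have "\<dots> = (2 powr (\<tau> - \<rho>)) ^ n"
        by (simp add: powr_power flip: powr_add) (simp add: algebra_simps)
      finally show "norm (h n) \<le> (2 powr (\<tau> - \<rho>)) ^ n" by (simp add: h_def)
    qed
  qed
  have h0: "h m \<ge> 0" for m by (simp add: h_def)
  have fin: "finite (dyadic_block Q \<psi> m)" for m
    using finite_subset[OF dyadic_block_subset[of Q \<psi>, OF Q0 \<psi>]] by simp
  have r01: "0 \<le> \<psi> q / real q" "\<psi> q / real q \<le> 1" if "q \<in> Q" for q
    using \<psi>[OF that] Q0[OF that] by (auto simp: divide_le_eq)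
  have "\<forall>q. \<exists>m. q \<in> Q \<and> \<psi> q / real q > 0 \<longrightarrow> q \<in> dyadic_block Q \<psi> m"
    using dyadic_block_exists r01 unfolding dyadic_block_def by blast
  then obtain idx where idx: "\<And>q. q \<in> Q \<Longrightarrow> \<psi> q / real q > 0 \<Longrightarrow> q \<in> dyadic_block Q \<psi> (idx q)" by metis
  have "(\<lambda>q. (\<psi> q / real q) powr \<rho>) summable_on Q"
  proof (rule nonneg_bdd_above_summable_on)
    show "bdd_above (sum (\<lambda>q. (\<psi> q / real q) powr \<rho>) ` {F. F \<subseteq> Q \<and> finite F})"
    proof (rule bdd_aboveI2)
      fix F assume "F \<in> {F. F \<subseteq> Q \<and> finite F}"
      hence F: "F \<subseteq> Q" "finite F" by auto
      \<comment> \<open>An index with \<psi> q = 0 lies in no block; it contributes nothing because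
        0 powr \<rho> = 0.\<close>
      define F' where "F' = {q \<in> F. \<psi> q / real q > 0}"
      have F': "F' \<subseteq> Q" "finite F'" "\<And>q. q \<in> F' \<Longrightarrow> \<psi> q / real q > 0" using F by (auto simp: F'_def)
      have "(\<Sum>q\<in>F. (\<psi> q / real q) powr \<rho>) = (\<Sum>q\<in>F'. (\<psi> q / real q) powr \<rho>)"
      proof (rule sum.mono_neutral_right)
        show "\<forall>q\<in>F - F'. (\<psi> q / real q) powr \<rho> = 0"
        proof
          fix q assume q: "q \<in> F - F'"
          hence "\<psi> q / real q = 0" using r01(1)[of q] F by (auto simp: F'_def)
          thus "(\<psi> q / real q) powr \<rho> = 0" by (simp only: powr_0)
        qed
      qed (use F in \<open>auto simp: F'_def\<close>)
      also have "\<dots> = (\<Sum>m\<in>idx ` F'. \<Sum>q\<in>{q \<in> F'. idx q = m}. (\<psi> q / real q) powr \<rho>)"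
        by (rule sum.group[symmetric]) (use F' in auto)
      also have "\<dots> \<le> (\<Sum>m\<in>idx ` F'. h m)"
      proof (intro sum_mono)
        fix m
        have "(\<Sum>q\<in>{q \<in> F'. idx q = m}. (\<psi> q / real q) powr \<rho>) \<le> (\<Sum>q\<in>{q \<in> F'. idx q = m}. 2 powr (- \<rho> * real m))"
        proof (intro sum_mono)
          fix q assume "q \<in> {q \<in> F'. idx q = m}"
          hence "q \<in> dyadic_block Q \<psi> m" "\<psi> q / real q > 0" using idx F' by auto
          hence "(\<psi> q / real q) powr \<rho> \<le> ((1 / 2) ^ m) powr \<rho>"
            using \<rho> \<tau> by (intro powr_mono2) (auto simp: dyadic_block_def)
          also have "\<dots> = 2 powr (- \<rho> * real m)"
          proof -
            have "(1 / 2 :: real) ^ m = 2 powr (- real m)" by (simp add: powr_minus powr_realpow power_divide inverse_eq_divide)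
            thus ?thesis by (simp add: powr_powr mult.commute)
          qed
          finally show "(\<psi> q / real q) powr \<rho> \<le> 2 powr (- \<rho> * real m)" .
        qed
        also have "\<dots> = real (card {q \<in> F'. idx q = m}) * 2 powr (- \<rho> * real m)" by simp
        also have "\<dots> \<le> h m" unfolding h_def
        proof (intro mult_right_mono)
          have "{q \<in> F'. idx q = m} \<subseteq> dyadic_block Q \<psi> m" using idx F' by auto
          thus "real (card {q \<in> F'. idx q = m}) \<le> real (card (dyadic_block Q \<psi> m))"
            using card_mono[OF fin] by simp
        qed auto
        finally show "(\<Sum>q\<in>{q \<in> F'. idx q = m}. (\<psi> q / real q) powr \<rho>) \<le> h m" .
      qed
      also have "\<dots> \<le> suminf h" using F' h0 by (intro sum_le_suminf h) auto
      finally show "(\<Sum>q\<in>F. (\<psi> q / real q) powr \<rho>) \<le> suminf h" .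
    qed
  qed auto
  hence "conv_exponent Q \<psi> \<le> \<rho>"
    unfolding conv_exponent_def using \<rho> \<tau> by (intro cInf_lower bdd_belowI[of _ 0]) auto
  thus False using \<rho> by simp
qed

lemma block_function_exists:
  fixes Q :: "nat set" and A B :: "nat \<Rightarrow> int" and \<psi> \<theta> :: "nat \<Rightarrow> real"
  assumes Q0: "\<And>q. q \<in> Q \<Longrightarrow> q > 0"
    and AB: "\<And>q. q \<in> Q \<Longrightarrow> gcd (A q) (B q) = 1"
    and \<psi>: "\<And>q. q \<in> Q \<Longrightarrow> \<psi> q \<in> {0..<1/2}"
    and \<sigma>: "0 \<le> \<sigma>" "\<sigma> \<le> 1" "\<sigma> < conv_exponent Q \<psi>" and \<delta>: "\<delta> > 0" and \<eta>: "\<eta> > 0"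
  obtains G :: "real \<Rightarrow> real" and c :: "int \<Rightarrow> complex" and K :: real and S r where
    "\<And>x. (\<lambda>j. \<Sum>l\<in>{- int j..int j}. c l * ee (of_int l * x)) \<longlonglongrightarrow> of_real (G x)"
    "\<And>x. G x \<ge> 0" "c 0 = 1" "\<And>l. cmod (c l) \<le> K * (1 + \<bar>of_int l\<bar>) powr (-2)"
    "\<And>l. l \<noteq> 0 \<Longrightarrow> cmod (c l) \<le> \<delta> * (1 + \<bar>of_int l\<bar>) powr (- \<sigma>)"
    "finite S" "S \<subseteq> Q" "\<And>q. q \<in> S \<Longrightarrow> r < \<psi> q / real q \<and> \<psi> q / real q < \<eta>"
    "\<And>x. G x \<noteq> 0 \<Longrightarrow> \<exists>q\<in>S. \<exists>p. gcd (B q * p + A q) (int q) = 1 \<and> \<bar>x - (of_int p + \<theta> q) / real q\<bar> \<le> r"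
proof -
  \<comment> \<open>With r about 2^(-m) and M = 2^m, the coefficient bound costs m (\<sigma> +
    \<epsilon>) + 2 \<epsilon> m in the exponent of 2, and a block of 2^((\<sigma> + 4 \<epsilon>)
    m) elements leaves a saving 2^(-\<epsilon> m). The divisor 5 makes \<sigma> + 4 \<epsilon>
    strictly smaller than the exponent of convergence; the cap at 1 ensures \<sigma> + \<epsilon> <=
    2.\<close>
  define \<epsilon> where "\<epsilon> = min 1 ((conv_exponent Q \<psi> - \<sigma>) / 5)"
  have \<epsilon>: "\<epsilon> > 0" "\<epsilon> \<le> 1" "\<sigma> + 4 * \<epsilon> < conv_exponent Q \<psi>" 
  proof -
    have "\<epsilon> \<le> (conv_exponent Q \<psi> - \<sigma>) / 5" unfolding \<epsilon>_def by (rule min.cobounded2)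
    thus "\<sigma> + 4 * \<epsilon> < conv_exponent Q \<psi>" using \<sigma> by (simp add: field_simps)
  qed (use \<sigma> in \<open>auto simp: \<epsilon>_def\<close>)
  obtain K where K: "K > 0" "\<And>A B \<theta> S r M l. finite S \<Longrightarrow> S \<noteq> {} \<Longrightarrow> S \<subseteq> {1..M} \<Longrightarrow> 
    (\<And>q. q \<in> S \<Longrightarrow> gcd (A q) (B q) = 1) \<Longrightarrow> r > 0 \<Longrightarrow> l \<noteq> 0 \<Longrightarrow>
    cmod (block_coeff A B \<theta> S r l) \<le> K * \<bar>of_int l\<bar> powr (- \<sigma>) * (r powr (- (\<sigma> + \<epsilon>)) * real M powr (2 * \<epsilon>) / real (card S))"
    using norm_block_coeff_decay[of \<epsilon> \<sigma>] \<epsilon> \<sigma> by (metis add_mono one_add_one)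
  \<comment> \<open>The 8 is 2 * 4: a factor 2 for replacing |l| by 1 + |l|, and 2^(\<sigma> +
    \<epsilon>) <= 4 for r being half of 2^(-m).\<close>
  have "(\<lambda>m. 8 * K * (2 powr (- \<epsilon>)) ^ m) \<longlonglongrightarrow> 8 * K * 0"
    using \<epsilon> powr_less_mono[of "- \<epsilon>" 0 "2::real"] by (intro tendsto_mult tendsto_const LIMSEQ_power_zero) auto
  hence "eventually (\<lambda>m. 8 * K * (2 powr (- \<epsilon>)) ^ m < \<delta>) sequentially"
    using \<delta> by (intro order_tendstoD(2)[of _ "8 * K * 0"]) auto
  moreover have "(\<lambda>m. (1 / 2 :: real) ^ m) \<longlonglongrightarrow> 0" by (intro LIMSEQ_power_zero) auto
  hence "eventually (\<lambda>m. (1 / 2 :: real) ^ m < \<eta>) sequentially" using \<eta> by (rule order_tendstoD(2))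
  ultimately have "eventually (\<lambda>m. 8 * K * (2 powr (- \<epsilon>)) ^ m < \<delta> \<and> (1 / 2 :: real) ^ m < \<eta>) sequentially"
    by (rule eventually_conj)
  then obtain m0 where m0: "\<And>m. m \<ge> m0 \<Longrightarrow> 8 * K * (2 powr (- \<epsilon>)) ^ m < \<delta> \<and> (1 / 2 :: real) ^ m < \<eta>"
    by (auto simp: eventually_sequentially)
  obtain m where m: "m \<ge> m0" "real (card (dyadic_block Q \<psi> m)) \<ge> 2 powr ((\<sigma> + 4 * \<epsilon>) * real m)"
    using large_dyadic_block[of Q \<psi> "\<sigma> + 4 * \<epsilon>" m0, OF Q0 \<psi>] \<sigma> \<epsilon> by auto
  define S where "S = dyadic_block Q \<psi> m"
  \<comment> \<open>This lies strictly below every \<psi> q / q of the block, so the closed support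
    of a tent satisfies the strict approximation inequality.\<close>
  define r :: real where "r = (1 / 2) ^ Suc m"
  have S: "finite S" "S \<subseteq> {1..2 ^ m}" "S \<subseteq> Q" 
    using dyadic_block_subset[of Q \<psi> m, OF Q0 \<psi>] by (auto simp: S_def dyadic_block_def intro: finite_subset)
  have cS: "real (card S) \<ge> 2 powr ((\<sigma> + 4 * \<epsilon>) * real m)" using m by (simp add: S_def)
  hence cS0: "real (card S) > 0" by (rule less_le_trans[rotated]) simp
  hence Sne: "S \<noteq> {}" by auto
  have r: "r > 0" by (simp add: r_def)
  have S0: "\<And>q. q \<in> S \<Longrightarrow> q > 0" "\<And>q. q \<in> S \<Longrightarrow> gcd (A q) (B q) = 1" using S Q0 AB by auto
  obtain G where G: "\<And>x. (\<lambda>j. \<Sum>l\<in>{- int j..int j}. block_coeff A B \<theta> S r l * ee (of_int l * x)) \<longlonglongrightarrow> of_real (G x)"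
    "\<And>x. G x \<ge> 0" 
    "\<And>x. G x \<noteq> 0 \<Longrightarrow> \<exists>q\<in>S. \<exists>p. gcd (B q * p + A q) (int q) = 1 \<and> \<bar>x - (of_int p + \<theta> q) / real q\<bar> \<le> r"
    using block_function[where S = S and A = A and B = B and \<theta> = \<theta> and r = r, OF S(1) Sne S0(1) S0(2) r] by blast
  show ?thesis
  proof (rule that[of "block_coeff A B \<theta> S r" G "1 + 4 / r\<^sup>2" S r])
    show "block_coeff A B \<theta> S r 0 = 1" by (intro block_coeff_0 S(1) Sne S0 r)
    show "cmod (block_coeff A B \<theta> S r l) \<le> (1 + 4 / r\<^sup>2) * (1 + \<bar>of_int l\<bar>) powr (-2)" for l
      by (intro norm_block_coeff_quadratic S(1) Sne S0 r)
    show "r < \<psi> q / real q \<and> \<psi> q / real q < \<eta>" if "q \<in> S" for q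
    proof -
      have "(1 / 2) ^ Suc m < \<psi> q / real q" "\<psi> q / real q \<le> (1 / 2) ^ m" using that by (auto simp: S_def dyadic_block_def)
      thus ?thesis using m0[OF m(1)] unfolding r_def by linarith
    qed
    fix l :: int assume l: "l \<noteq> 0"
    have l1: "\<bar>of_int l\<bar> \<ge> (1::real)" using l by (metis Ints_of_int of_int_0_eq_iff Ints_nonzero_abs_ge1)
    have "cmod (block_coeff A B \<theta> S r l) \<le> K * \<bar>of_int l\<bar> powr (- \<sigma>) * (r powr (- (\<sigma> + \<epsilon>)) * real (2 ^ m) powr (2 * \<epsilon>) / real (card S))"
      by (rule K(2)[OF S(1) Sne S(2) S0(2) r l])
    also have "\<dots> \<le> K * (2 * (1 + \<bar>of_int l\<bar>) powr (- \<sigma>)) * (4 * (2 powr (- \<epsilon>)) ^ m)"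
    proof (intro mult_mono mult_left_mono)
      have "\<bar>of_int l\<bar> powr (- \<sigma>) \<le> ((1 + \<bar>of_int l\<bar>) / 2) powr (- \<sigma>)"
        using l1 \<sigma> by (intro powr_mono2') auto
      also have "\<dots> = 2 powr \<sigma> * (1 + \<bar>of_int l\<bar>) powr (- \<sigma>)"
        by (simp add: powr_divide powr_minus field_simps)
      also have "\<dots> \<le> 2 powr 1 * (1 + \<bar>of_int l\<bar>) powr (- \<sigma>)"
        using \<sigma> by (intro mult_right_mono powr_mono) auto
      finally show "\<bar>of_int l\<bar> powr (- \<sigma>) \<le> 2 * (1 + \<bar>of_int l\<bar>) powr (- \<sigma>)" by simp
      have r2: "r = 2 powr (- (real m + 1))"
      proof -
        have "2 powr (- (real m + 1)) = (inverse (2 ^ Suc m) :: real)"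
          using powr_realpow[of "2::real" "Suc m"] by (simp only: powr_minus of_nat_Suc add.commute)
        thus ?thesis by (simp add: r_def power_divide inverse_eq_divide)
      qed
      have m2: "real (2 ^ m) = 2 powr real m" by (simp add: powr_realpow)
      have "r powr (- (\<sigma> + \<epsilon>)) * real (2 ^ m) powr (2 * \<epsilon>) / real (card S) \<le> 
         r powr (- (\<sigma> + \<epsilon>)) * real (2 ^ m) powr (2 * \<epsilon>) / 2 powr ((\<sigma> + 4 * \<epsilon>) * real m)"
        using cS cS0 by (intro divide_left_mono) auto
      also have "\<dots> = 2 powr ((real m + 1) * (\<sigma> + \<epsilon>) + real m * (2 * \<epsilon>) - (\<sigma> + 4 * \<epsilon>) * real m)"
        unfolding r2 m2 by (simp only: powr_powr powr_add[symmetric] powr_diff[symmetric]) (simp add: algebra_simps)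
      also have "(real m + 1) * (\<sigma> + \<epsilon>) + real m * (2 * \<epsilon>) - (\<sigma> + 4 * \<epsilon>) * real m = (\<sigma> + \<epsilon>) + real m * (- \<epsilon>)"
        by (simp add: algebra_simps)
      also have "2 powr \<dots> = 2 powr (\<sigma> + \<epsilon>) * (2 powr (- \<epsilon>)) ^ m"
      proof -
        have "(2 powr (- \<epsilon>)) ^ m = (2::real) powr (real m * (- \<epsilon>))" by (rule powr_power) simp
        thus ?thesis by (simp only: powr_add)
      qed
      also have "\<dots> \<le> 2 powr 2 * (2 powr (- \<epsilon>)) ^ m" using \<sigma> \<epsilon> by (intro mult_right_mono powr_mono) auto
      finally show "r powr (- (\<sigma> + \<epsilon>)) * real (2 ^ m) powr (2 * \<epsilon>) / real (card S) \<le> 4 * (2 powr (- \<epsilon>)) ^ m" by simp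
    qed (use K r in auto)
    also have "\<dots> = 8 * K * (2 powr (- \<epsilon>)) ^ m * (1 + \<bar>of_int l\<bar>) powr (- \<sigma>)" by simp
    also have "\<dots> \<le> \<delta> * (1 + \<bar>of_int l\<bar>) powr (- \<sigma>)" using m0[OF m(1)] by (intro mult_right_mono) auto
    finally show "cmod (block_coeff A B \<theta> S r l) \<le> \<delta> * (1 + \<bar>of_int l\<bar>) powr (- \<sigma>)" .
  qed (use S G in auto)
qed

section \<open>Products of densities and the lower bound\<close>

definition fourier_transform :: "(real \<Rightarrow> real) \<Rightarrow> real \<Rightarrow> complex" where
  "fourier_transform f \<xi> = (\<integral>x. f x *\<^sub>R ee (- \<xi> * x) \<partial>lborel)"

text \<open>The point is uniformity in \<xi>. Measuring l from the floor of \<xi> costs a factor 2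
  in each bracket, hence 2^(3/2), and leaves one fixed convergent series.\<close>

lemma sum_bracket_bounded:
  obtains L :: real where "L > 0" "\<And>(\<xi>::real) F. finite F \<Longrightarrow> (\<Sum>l\<in>F. (1 + \<bar>\<xi> - of_int l\<bar>) powr (- 3 / 2)) \<le> L"
proof -
  define u where "u i = real (Suc i) powr (- 3 / 2)" for i
  have "summable (\<lambda>i. real i powr (- 3 / 2))" by (subst summable_real_powr_iff) simp
  hence u: "summable u" unfolding u_def by (subst summable_Suc_iff)
  have u0: "u i \<ge> 0" for i by (simp add: u_def)
  define L where "L = 2 powr (3 / 2) * (2 * suminf u)"
  have "u 0 \<le> suminf u" using sum_le_suminf[OF u, of "{0}"] u0 by simp
  hence "suminf u \<ge> 1" by (simp add: u_def)
  hence L0: "L > 0" by (simp add: L_def)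
  have "(\<Sum>l\<in>F. (1 + \<bar>\<xi> - of_int l\<bar>) powr (- 3 / 2)) \<le> L" if F: "finite F" for \<xi> :: real and F :: "int set"
  proof -
    define n where "n = \<lfloor>\<xi>\<rfloor>"
    define v where "v k = u (nat \<bar>k\<bar>)" for k :: int
    have "\<forall>l\<in>F. nat \<bar>n - l\<bar> \<le> Max ((\<lambda>l. nat \<bar>n - l\<bar>) ` F)" using F by simp
    then obtain J where J: "\<And>l. l \<in> F \<Longrightarrow> nat \<bar>n - l\<bar> \<le> J" by blast
    have "(\<Sum>l\<in>F. (1 + \<bar>\<xi> - of_int l\<bar>) powr (- 3 / 2)) \<le> (\<Sum>l\<in>F. 2 powr (3 / 2) * v (n - l))"
    proof (intro sum_mono)
      fix l
      have "(1 + real (nat \<bar>n - l\<bar>)) / 2 \<le> 1 + \<bar>\<xi> - of_int l\<bar>"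
      proof (cases "n = l")
        case False
        hence "real_of_int \<bar>n - l\<bar> \<ge> 1" by linarith
        moreover have "real_of_int \<bar>n - l\<bar> \<le> \<bar>\<xi> - of_int l\<bar> + 1" unfolding n_def by linarith
        ultimately show ?thesis by simp
      qed auto
      hence "(1 + \<bar>\<xi> - of_int l\<bar>) powr (- 3 / 2) \<le> ((1 + real (nat \<bar>n - l\<bar>)) / 2) powr (- 3 / 2)"
        by (intro powr_mono2') auto
      also have "\<dots> = 2 powr (3 / 2) * v (n - l)"
        by (simp add: v_def u_def powr_divide powr_minus field_simps)
      finally show "(1 + \<bar>\<xi> - of_int l\<bar>) powr (- 3 / 2) \<le> 2 powr (3 / 2) * v (n - l)" .
    qed
    also have "\<dots> = 2 powr (3 / 2) * (\<Sum>k\<in>(\<lambda>l. n - l) ` F. v k)"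
      by (subst sum.reindex) (auto simp: inj_on_def sum_distrib_left)
    also have "(\<Sum>k\<in>(\<lambda>l. n - l) ` F. v k) \<le> (\<Sum>k\<in>{- int J..int J}. v k)"
    proof (intro sum_mono2)
      show "(\<lambda>l. n - l) ` F \<subseteq> {- int J..int J}"
      proof (rule image_subsetI)
        fix l assume "l \<in> F"
        from J[OF this] show "n - l \<in> {- int J..int J}" by auto
      qed
    qed (auto simp: v_def u0)
    also have "\<dots> = u 0 + (\<Sum>i<J. 2 * u (Suc i))"
      unfolding sum_symmetric_int v_def by (simp add: nat_add_distrib)
    also have "\<dots> \<le> 2 * (\<Sum>i<Suc J. u i)"
      using u0[of 0] by (simp only: sum.lessThan_Suc_shift sum_distrib_left[symmetric]) simp
    also have "(\<Sum>i<Suc J. u i) \<le> suminf u" using u0 by (intro sum_le_suminf u) auto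
    finally show ?thesis by (simp add: L_def)
  qed
  thus ?thesis using that L0 by blast
qed

section \<open>Convolution estimates for the decay weights\<close>

lemma bracket_le_mult: "1 + \<bar>\<xi>\<bar> \<le> (1 + \<bar>y\<bar>) * (1 + \<bar>\<xi> - y\<bar>)" for \<xi> y :: real
proof -
  have "\<bar>\<xi>\<bar> \<le> \<bar>y\<bar> + \<bar>\<xi> - y\<bar>" by linarith
  moreover have "0 \<le> \<bar>y\<bar> * \<bar>\<xi> - y\<bar>" by simp
  moreover have "(1 + \<bar>y\<bar>) * (1 + \<bar>\<xi> - y\<bar>) = 1 + \<bar>y\<bar> + \<bar>\<xi> - y\<bar> + \<bar>y\<bar> * \<bar>\<xi> - y\<bar>"
    by (simp add: algebra_simps)
  ultimately show ?thesis by linarith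
qed

text \<open>By \<open>bracket_le_mult\<close>, moving the weight of exponent \<sigma> from y to
  \<xi> costs (1 + |\<xi> - y|)^\<sigma>. For \<sigma> <= 1/2 the quadratic factor can afford it and
  keeps exponent -3/2, still summable over the integers.\<close>

lemma bracket_convolution_le:
  fixes \<xi> y :: real
  assumes "0 \<le> \<sigma>" "\<sigma> \<le> 1 / 2"
  shows "(1 + \<bar>y\<bar>) powr (- \<sigma>) * (1 + \<bar>\<xi> - y\<bar>) powr (-2) \<le> (1 + \<bar>\<xi>\<bar>) powr (- \<sigma>) * (1 + \<bar>\<xi> - y\<bar>) powr (- 3 / 2)"
proof -
  have "(1 + \<bar>\<xi>\<bar>) powr \<sigma> \<le> ((1 + \<bar>y\<bar>) * (1 + \<bar>\<xi> - y\<bar>)) powr \<sigma>"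
    using assms by (intro powr_mono2 bracket_le_mult) auto
  also have "\<dots> = (1 + \<bar>y\<bar>) powr \<sigma> * (1 + \<bar>\<xi> - y\<bar>) powr \<sigma>" by (rule powr_mult)
  finally have "(1 + \<bar>y\<bar>) powr (- \<sigma>) \<le> (1 + \<bar>\<xi>\<bar>) powr (- \<sigma>) * (1 + \<bar>\<xi> - y\<bar>) powr \<sigma>"
    by (simp add: powr_minus field_simps add_pos_nonneg)
  hence "(1 + \<bar>y\<bar>) powr (- \<sigma>) * (1 + \<bar>\<xi> - y\<bar>) powr (-2) \<le> 
     ((1 + \<bar>\<xi>\<bar>) powr (- \<sigma>) * (1 + \<bar>\<xi> - y\<bar>) powr \<sigma>) * (1 + \<bar>\<xi> - y\<bar>) powr (-2)"
    by (intro mult_right_mono) auto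
  also have "\<dots> = (1 + \<bar>\<xi>\<bar>) powr (- \<sigma>) * (1 + \<bar>\<xi> - y\<bar>) powr (\<sigma> - 2)"
    by (simp add: mult.assoc flip: powr_add)
  also have "\<dots> \<le> (1 + \<bar>\<xi>\<bar>) powr (- \<sigma>) * (1 + \<bar>\<xi> - y\<bar>) powr (- 3 / 2)"
    using assms by (intro mult_left_mono powr_mono) auto
  finally show ?thesis .
qed

text \<open>One of 1 + |y| and 1 + |\<xi> - y| is at least half of 1 + |\<xi>|; this factor supplies
  the decay in \<xi> (hence 4 = 2^2) and the other is left to be summed over y. The form |0 - y|
  matches \<open>sum_bracket_bounded\<close> at \<xi> = 0.\<close>

lemma bracket_convolution_quadratic_le:
  fixes \<xi> y :: real
  shows "(1 + \<bar>y\<bar>) powr (-2) * (1 + \<bar>\<xi> - y\<bar>) powr (-2) \<le> 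
    4 * (1 + \<bar>\<xi>\<bar>) powr (-2) * ((1 + \<bar>0 - y\<bar>) powr (- 3 / 2) + (1 + \<bar>\<xi> - y\<bar>) powr (- 3 / 2))"
proof -
  have *: "(1 + a) powr (-2) * (1 + b) powr (-2) \<le> 4 * (1 + \<bar>\<xi>\<bar>) powr (-2) * (1 + b) powr (- 3 / 2)"
    if "1 + \<bar>\<xi>\<bar> \<le> 2 * (1 + a)" "a \<ge> 0" "b \<ge> 0" for a b :: real
  proof (rule mult_mono)
    have "(2 * (1 + a)) powr (-2) \<le> (1 + \<bar>\<xi>\<bar>) powr (-2)" using that by (intro powr_mono2') auto
    moreover have "(2 * (1 + a)) powr (-2) = 2 powr (-2) * (1 + a) powr (-2)" by (rule powr_mult)
    moreover have "2 powr (-2) = (1 / 4 :: real)" by (simp add: powr_minus)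
    ultimately show "(1 + a) powr (-2) \<le> 4 * (1 + \<bar>\<xi>\<bar>) powr (-2)" by simp
    show "(1 + b) powr (-2) \<le> (1 + b) powr (- 3 / 2)" using that by (intro powr_mono) auto
  qed auto
  have nn: "0 \<le> 4 * (1 + \<bar>\<xi>\<bar>) powr (-2) * (1 + b) powr (- 3 / 2)" for b by simp
  have "\<bar>\<xi>\<bar> \<le> \<bar>y\<bar> + \<bar>\<xi> - y\<bar>" by linarith
  then consider "1 + \<bar>\<xi>\<bar> \<le> 2 * (1 + \<bar>y\<bar>)" | "1 + \<bar>\<xi>\<bar> \<le> 2 * (1 + \<bar>\<xi> - y\<bar>)" by argo
  thus ?thesis
  proof cases
    case 1
    have "(1 + \<bar>y\<bar>) powr (-2) * (1 + \<bar>\<xi> - y\<bar>) powr (-2) \<le> 4 * (1 + \<bar>\<xi>\<bar>) powr (-2) * (1 + \<bar>\<xi> - y\<bar>) powr (- 3 / 2)"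
      by (rule *[OF 1]) auto
    thus ?thesis using nn[of "\<bar>0 - y\<bar>"] unfolding distrib_left by linarith
  next
    case 2
    have "(1 + \<bar>\<xi> - y\<bar>) powr (-2) * (1 + \<bar>0 - y\<bar>) powr (-2) \<le> 4 * (1 + \<bar>\<xi>\<bar>) powr (-2) * (1 + \<bar>0 - y\<bar>) powr (- 3 / 2)"
      by (rule *[OF 2]) auto
    moreover have "(1 + \<bar>\<xi> - y\<bar>) powr (-2) * (1 + \<bar>0 - y\<bar>) powr (-2) = (1 + \<bar>y\<bar>) powr (-2) * (1 + \<bar>\<xi> - y\<bar>) powr (-2)"
      by (simp add: mult.commute)
    ultimately show ?thesis using nn[of "\<bar>\<xi> - y\<bar>"] unfolding distrib_left by linarith
  qed
qed

text \<open>The invariant of the iteration. The constants are existentially quantified because they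
  may grow from one stage to the next. The mass is not normalised: multiplying by a block function
  changes it slightly, and dividing by it is postponed to the end.\<close>

definition decaying_density :: "(real \<Rightarrow> real) \<Rightarrow> bool" where
  "decaying_density f \<longleftrightarrow> f \<in> borel_measurable borel \<and> (\<forall>x. f x \<ge> 0) \<and> (\<forall>x. x \<notin> {0..1} \<longrightarrow> f x = 0) \<and>
     (\<exists>b. \<forall>x. f x \<le> b) \<and> (\<exists>C. \<forall>\<xi>. cmod (fourier_transform f \<xi>) \<le> C * (1 + \<bar>\<xi>\<bar>) powr (-2))"

lemma borel_measurable_ee [measurable]: "f \<in> borel_measurable M \<Longrightarrow> (\<lambda>x. ee (f x)) \<in> borel_measurable M"
  by (rule measurable_compose[OF _ borel_measurable_continuous_onI]) (auto intro: continuous_intros)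

lemma decaying_density_integrable:
  fixes h :: "real \<Rightarrow> complex"
  assumes f: "decaying_density f" and [measurable]: "h \<in> borel_measurable borel" and h: "\<And>x. cmod (h x) \<le> B"
  shows "integrable lborel (\<lambda>x. f x *\<^sub>R h x)"
proof -
  from f have [measurable]: "f \<in> borel_measurable borel" by (simp add: decaying_density_def)
  from f obtain b where b: "\<And>x. f x \<le> b" "\<And>x. f x \<ge> 0" "\<And>x. x \<notin> {0..1} \<Longrightarrow> f x = 0" by (auto simp: decaying_density_def)
  show ?thesis
  proof (rule integrableI_bounded_set[where A = "{0..1}" and B = "b * B"])
    show "AE x in lborel. x \<in> {0..1} \<longrightarrow> norm (f x *\<^sub>R h x) \<le> b * B"
    proof (rule AE_I2, rule impI)
      fix x :: real
      have "norm (f x *\<^sub>R h x) = f x * cmod (h x)" using b by simp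
      also have "\<dots> \<le> b * B" using b h[of x] order_trans[OF b(2) b(1)] by (intro mult_mono) auto
      finally show "norm (f x *\<^sub>R h x) \<le> b * B" .
    qed
  qed (use b in auto)
qed

lemma decaying_density_integrable_ee:
  assumes "decaying_density f"
  shows "integrable lborel (\<lambda>x. f x *\<^sub>R ee (c * x))"
  by (rule decaying_density_integrable[OF assms, of _ 1])
    (auto intro!: borel_measurable_continuous_onI continuous_intros)

text \<open>Multiplication by \<open>ee (l * x)\<close> shifts the transform by l, so multiplying by
  the series turns into a discrete convolution. The bound on c makes the partial sums uniformly
  bounded by K * L, which gives dominated convergence, and the bound on the convolution preserves
  decay of rate 2.\<close>

lemma fourier_transform_mult_series:
  assumes f: "decaying_density f" and lim: "\<And>x. (\<lambda>j. \<Sum>l\<in>{- int j..int j}. c l * ee (of_int l * x)) \<longlonglongrightarrow> of_real (G x)"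
    and G0: "\<And>x. G x \<ge> 0" and K: "\<And>l. cmod (c l) \<le> K * (1 + \<bar>of_int l\<bar>) powr (-2)"
  shows "(\<lambda>j. \<Sum>l\<in>{- int j..int j}. c l * fourier_transform f (\<xi> - of_int l)) \<longlonglongrightarrow> fourier_transform (\<lambda>x. f x * G x) \<xi>"
    and "decaying_density (\<lambda>x. f x * G x)"
proof -
  from f have mf [measurable]: "f \<in> borel_measurable borel" by (simp add: decaying_density_def)
  from f obtain b where b: "\<And>x. f x \<le> b" "\<And>x. f x \<ge> 0" "\<And>x. x \<notin> {0..1} \<Longrightarrow> f x = 0" by (auto simp: decaying_density_def)
  from f obtain C where C: "\<And>\<xi>. cmod (fourier_transform f \<xi>) \<le> C * (1 + \<bar>\<xi>\<bar>) powr (-2)" by (auto simp: decaying_density_def)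
  have b0: "b \<ge> 0" using b(1)[of 0] b(2)[of 0] by linarith
  have C0: "C \<ge> 0" using order_trans[OF norm_ge_zero C[of 0]] by simp
  have K0: "K \<ge> 0" using order_trans[OF norm_ge_zero K[of 0]] by simp
  obtain L where L: "L > 0" "\<And>(\<xi>::real) F. finite F \<Longrightarrow> (\<Sum>l\<in>F. (1 + \<bar>\<xi> - of_int l\<bar>) powr (- 3 / 2)) \<le> L"
    using sum_bracket_bounded by blast
  define s where "s j x = (\<Sum>l\<in>{- int j..int j}. c l * ee (of_int l * x))" for j x
  have ms [measurable]: "s j \<in> borel_measurable borel" for j
    unfolding s_def by (intro borel_measurable_continuous_onI continuous_intros)
  have s_lim: "(\<lambda>j. s j x) \<longlonglongrightarrow> of_real (G x)" for x unfolding s_def by (rule lim)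
  have s_bd: "cmod (s j x) \<le> K * L" for j x
  proof -
    have "cmod (s j x) \<le> (\<Sum>l\<in>{- int j..int j}. K * (1 + \<bar>0 - of_int l\<bar>) powr (- 3 / 2))"
      unfolding s_def
    proof (intro sum_norm_le)
      fix l
      have "cmod (c l * ee (of_int l * x)) \<le> K * (1 + \<bar>of_int l\<bar>) powr (-2)" using K[of l] by (simp add: norm_mult)
      also have "\<dots> \<le> K * (1 + \<bar>0 - of_int l\<bar>) powr (- 3 / 2)" 
        using K0 by (intro mult_left_mono) (auto intro!: powr_mono)
      finally show "cmod (c l * ee (of_int l * x)) \<le> K * (1 + \<bar>0 - of_int l\<bar>) powr (- 3 / 2)" .
    qed
    also have "\<dots> \<le> K * L" unfolding sum_distrib_left[symmetric] by (intro mult_left_mono L K0) simp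
    finally show ?thesis .
  qed
  have cG: "(\<lambda>x. complex_of_real (G x)) \<in> borel_measurable borel"
    by (rule borel_measurable_LIMSEQ_metric[OF ms s_lim])
  have mG [measurable]: "G \<in> borel_measurable borel"
    using measurable_compose[OF cG borel_measurable_Re] by simp
  have G_bd: "G x \<le> K * L" for x
  proof -
    have "cmod (of_real (G x)) \<le> K * L"
      by (rule LIMSEQ_le_const2[OF tendsto_norm[OF s_lim]]) (intro exI allI impI s_bd)
    thus ?thesis by simp
  qed
  show lim': "(\<lambda>j. \<Sum>l\<in>{- int j..int j}. c l * fourier_transform f (\<xi> - of_int l)) \<longlonglongrightarrow> fourier_transform (\<lambda>x. f x * G x) \<xi>" for \<xi>
  proof -
    have "(\<lambda>j. \<integral>x. f x *\<^sub>R (s j x * ee (- \<xi> * x)) \<partial>lborel) \<longlonglongrightarrow> (\<integral>x. f x *\<^sub>R (of_real (G x) * ee (- \<xi> * x)) \<partial>lborel)"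
    proof (rule integral_dominated_convergence[where w = "\<lambda>x. indicator {0..1} x * (b * (K * L))"])
      show "integrable lborel (\<lambda>x::real. indicator {0..1} x * (b * (K * L)))" by (intro integrable_mult_left integrable_real_indicator) auto
      show "AE x in lborel. (\<lambda>j. f x *\<^sub>R (s j x * ee (- \<xi> * x))) \<longlonglongrightarrow> f x *\<^sub>R (of_real (G x) * ee (- \<xi> * x))"
        unfolding s_def by (intro AE_I2 tendsto_intros lim)
      show "AE x in lborel. norm (f x *\<^sub>R (s j x * ee (- \<xi> * x))) \<le> indicator {0..1} x * (b * (K * L))" for j
      proof (rule AE_I2)
        fix x
        have "norm (f x *\<^sub>R (s j x * ee (- \<xi> * x))) = f x * cmod (s j x)" using b by (simp add: norm_mult)
        also have "\<dots> \<le> indicator {0..1} x * (b * (K * L))"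
          using b b0 s_bd[of j x] by (cases "x \<in> {0..1}") (auto intro!: mult_mono)
        finally show "norm (f x *\<^sub>R (s j x * ee (- \<xi> * x))) \<le> indicator {0..1} x * (b * (K * L))" .
      qed
    qed measurable
    also have "(\<integral>x. f x *\<^sub>R (of_real (G x) * ee (- \<xi> * x)) \<partial>lborel) = fourier_transform (\<lambda>x. f x * G x) \<xi>"
      unfolding fourier_transform_def by (simp add: scaleR_conv_of_real mult.assoc)
    also have "(\<lambda>j. \<integral>x. f x *\<^sub>R (s j x * ee (- \<xi> * x)) \<partial>lborel) = (\<lambda>j. \<Sum>l\<in>{- int j..int j}. c l * fourier_transform f (\<xi> - of_int l))"
    proof
      fix j
      have "f x *\<^sub>R (s j x * ee (- \<xi> * x)) = (\<Sum>l\<in>{- int j..int j}. c l * (f x *\<^sub>R ee (- (\<xi> - of_int l) * x)))" for x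
      proof -
        have "ee (- (\<xi> - of_int l) * x) = ee (of_int l * x) * ee (- \<xi> * x)" for l
          by (simp add: ee_add[symmetric] ring_distribs)
        thus ?thesis by (simp add: s_def sum_distrib_left sum_distrib_right scaleR_conv_of_real mult_ac)
      qed
      hence "(\<integral>x. f x *\<^sub>R (s j x * ee (- \<xi> * x)) \<partial>lborel) = (\<integral>x. (\<Sum>l\<in>{- int j..int j}. c l * (f x *\<^sub>R ee (- (\<xi> - of_int l) * x))) \<partial>lborel)"
        by simp
      also have "\<dots> = (\<Sum>l\<in>{- int j..int j}. \<integral>x. c l * (f x *\<^sub>R ee (- (\<xi> - of_int l) * x)) \<partial>lborel)"
        by (intro Bochner_Integration.integral_sum integrable_mult_right decaying_density_integrable_ee[OF f])
      also have "\<dots> = (\<Sum>l\<in>{- int j..int j}. c l * fourier_transform f (\<xi> - of_int l))"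
        unfolding fourier_transform_def by (simp only: integral_mult_right_zero)
      finally show "(\<integral>x. f x *\<^sub>R (s j x * ee (- \<xi> * x)) \<partial>lborel) = (\<Sum>l\<in>{- int j..int j}. c l * fourier_transform f (\<xi> - of_int l))" .
    qed
    finally show ?thesis .
  qed
  show "decaying_density (\<lambda>x. f x * G x)"
    unfolding decaying_density_def
  proof (intro conjI allI impI exI)
    show "f x * G x \<le> b * (K * L)" for x using b b0 G0 G_bd by (intro mult_mono) auto
    show "cmod (fourier_transform (\<lambda>x. f x * G x) \<xi>) \<le> (8 * K * C * L) * (1 + \<bar>\<xi>\<bar>) powr (-2)" for \<xi>
    proof (rule LIMSEQ_le_const2[OF tendsto_norm[OF lim']], intro exI allI impI)
      fix j :: nat
      let ?J = "{- int j..int j}"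
      have "cmod (\<Sum>l\<in>?J. c l * fourier_transform f (\<xi> - of_int l)) \<le> (\<Sum>l\<in>?J. K * C * (4 * (1 + \<bar>\<xi>\<bar>) powr (-2)) * 
          ((1 + \<bar>0 - of_int l\<bar>) powr (- 3 / 2) + (1 + \<bar>\<xi> - of_int l\<bar>) powr (- 3 / 2)))"
      proof (intro sum_norm_le)
        fix l
        have "cmod (c l * fourier_transform f (\<xi> - of_int l)) \<le> (K * (1 + \<bar>of_int l\<bar>) powr (-2)) * (C * (1 + \<bar>\<xi> - of_int l\<bar>) powr (-2))"
          unfolding norm_mult using K K0 by (intro mult_mono C K) auto
        also have "\<dots> = K * C * ((1 + \<bar>of_int l\<bar>) powr (-2) * (1 + \<bar>\<xi> - of_int l\<bar>) powr (-2))" by (simp add: mult_ac)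
        also have "\<dots> \<le> K * C * (4 * (1 + \<bar>\<xi>\<bar>) powr (-2) * 
          ((1 + \<bar>0 - of_int l\<bar>) powr (- 3 / 2) + (1 + \<bar>\<xi> - of_int l\<bar>) powr (- 3 / 2)))"
          using K0 C0 by (intro mult_left_mono bracket_convolution_quadratic_le) auto
        finally show "cmod (c l * fourier_transform f (\<xi> - of_int l)) \<le> K * C * (4 * (1 + \<bar>\<xi>\<bar>) powr (-2)) * 
          ((1 + \<bar>0 - of_int l\<bar>) powr (- 3 / 2) + (1 + \<bar>\<xi> - of_int l\<bar>) powr (- 3 / 2))" by (simp only: mult.assoc)
      qed
      also have "\<dots> = K * C * (4 * (1 + \<bar>\<xi>\<bar>) powr (-2)) * 
          ((\<Sum>l\<in>?J. (1 + \<bar>0 - of_int l\<bar>) powr (- 3 / 2)) + (\<Sum>l\<in>?J. (1 + \<bar>\<xi> - of_int l\<bar>) powr (- 3 / 2)))"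
        by (subst sum_distrib_left[symmetric]) (subst sum.distrib, rule refl)
      also have "\<dots> \<le> K * C * (4 * (1 + \<bar>\<xi>\<bar>) powr (-2)) * (L + L)"
        using K0 C0 by (intro mult_left_mono add_mono L) auto
      finally show "cmod (\<Sum>l\<in>?J. c l * fourier_transform f (\<xi> - of_int l)) \<le> (8 * K * C * L) * (1 + \<bar>\<xi>\<bar>) powr (-2)" by (simp add: mult_ac)
    qed
  qed (use b G0 in auto)
qed

text \<open>Because c 0 = 1, the term l = 0 is the old transform itself. All other terms carry the
  factor \<delta>, and the quadratic decay of the old transform sums them.\<close>

lemma fourier_transform_mult_series_close:
  fixes \<sigma> :: real
  assumes \<sigma>: "0 \<le> \<sigma>" "\<sigma> \<le> 1 / 2"
    and L: "\<And>(\<xi>::real) F. finite F \<Longrightarrow> (\<Sum>l\<in>F. (1 + \<bar>\<xi> - of_int l\<bar>) powr (- 3 / 2)) \<le> L"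
    and f: "decaying_density f" and C: "\<And>\<xi>. cmod (fourier_transform f \<xi>) \<le> C * (1 + \<bar>\<xi>\<bar>) powr (-2)"
    and lim: "\<And>x. (\<lambda>j. \<Sum>l\<in>{- int j..int j}. c l * ee (of_int l * x)) \<longlonglongrightarrow> of_real (G x)"
    and G: "\<And>x. G x \<ge> 0" and K: "\<And>l. cmod (c l) \<le> K * (1 + \<bar>of_int l\<bar>) powr (-2)" and c0: "c 0 = 1" and \<delta>: "\<delta> > 0"
    and c: "\<And>l. l \<noteq> 0 \<Longrightarrow> cmod (c l) \<le> \<delta> * (1 + \<bar>of_int l\<bar>) powr (- \<sigma>)"
  shows "cmod (fourier_transform (\<lambda>x. f x * G x) \<xi> - fourier_transform f \<xi>) \<le> \<delta> * C * L * (1 + \<bar>\<xi>\<bar>) powr (- \<sigma>)"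
proof -
  have C0: "C \<ge> 0" using order_trans[OF norm_ge_zero C[of 0]] by simp
  have "(\<lambda>j. (\<Sum>l\<in>{- int j..int j}. c l * fourier_transform f (\<xi> - of_int l)) - fourier_transform f \<xi>) \<longlonglongrightarrow> fourier_transform (\<lambda>x. f x * G x) \<xi> - fourier_transform f \<xi>"
    by (intro tendsto_diff tendsto_const fourier_transform_mult_series(1)[OF f lim G K])
  thus "cmod (fourier_transform (\<lambda>x. f x * G x) \<xi> - fourier_transform f \<xi>) \<le> \<delta> * C * L * (1 + \<bar>\<xi>\<bar>) powr (- \<sigma>)"
  proof (intro LIMSEQ_le_const2[OF tendsto_norm], assumption, intro exI allI impI)
    fix j :: nat
    let ?J = "{- int j..int j} - {0}"
    have "(\<Sum>l\<in>{- int j..int j}. c l * fourier_transform f (\<xi> - of_int l)) - fourier_transform f \<xi> = (\<Sum>l\<in>?J. c l * fourier_transform f (\<xi> - of_int l))"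
      by (subst sum.remove[of _ 0]) (auto simp: c0)
    also have "cmod \<dots> \<le> (\<Sum>l\<in>?J. \<delta> * C * ((1 + \<bar>\<xi>\<bar>) powr (- \<sigma>) * (1 + \<bar>\<xi> - of_int l\<bar>) powr (- 3 / 2)))"
    proof (intro sum_norm_le)
      fix l assume l: "l \<in> ?J"
      have "cmod (c l * fourier_transform f (\<xi> - of_int l)) \<le> (\<delta> * (1 + \<bar>of_int l\<bar>) powr (- \<sigma>)) * (C * (1 + \<bar>\<xi> - of_int l\<bar>) powr (-2))"
        unfolding norm_mult using \<delta> l by (intro mult_mono C c) auto
      also have "\<dots> = \<delta> * C * ((1 + \<bar>of_int l\<bar>) powr (- \<sigma>) * (1 + \<bar>\<xi> - of_int l\<bar>) powr (-2))" by (simp add: mult_ac)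
      also have "\<dots> \<le> \<delta> * C * ((1 + \<bar>\<xi>\<bar>) powr (- \<sigma>) * (1 + \<bar>\<xi> - of_int l\<bar>) powr (- 3 / 2))"
        using \<delta> C0 \<sigma> by (intro mult_left_mono bracket_convolution_le) auto
      finally show "cmod (c l * fourier_transform f (\<xi> - of_int l)) \<le> \<delta> * C * ((1 + \<bar>\<xi>\<bar>) powr (- \<sigma>) * (1 + \<bar>\<xi> - of_int l\<bar>) powr (- 3 / 2))" .
    qed
    also have "\<dots> = \<delta> * C * ((1 + \<bar>\<xi>\<bar>) powr (- \<sigma>) * (\<Sum>l\<in>?J. (1 + \<bar>\<xi> - of_int l\<bar>) powr (- 3 / 2)))"
      by (simp only: sum_distrib_left)
    also have "\<dots> \<le> \<delta> * C * ((1 + \<bar>\<xi>\<bar>) powr (- \<sigma>) * L)"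
      using \<delta> C0 by (intro mult_left_mono L) auto
    finally show "cmod ((\<Sum>l\<in>{- int j..int j}. c l * fourier_transform f (\<xi> - of_int l)) - fourier_transform f \<xi>) \<le> \<delta> * C * L * (1 + \<bar>\<xi>\<bar>) powr (- \<sigma>)"
      by (simp add: mult_ac)
  qed
qed

text \<open>A density of mass 1 that vanishes continuously at both ends of [0,1]; this is what gives
  its transform decay of rate 2, where the indicator of [0,1] would give only rate 1.\<close>

definition parabola :: "real \<Rightarrow> real" where
  "parabola x = indicator {0..1} x * (6 * x * (1 - x))"

lemma parabola_integral: "has_bochner_integral lborel parabola 1"
proof -
  have "has_bochner_integral lborel (\<lambda>x. indicator {0..1} x *\<^sub>R (6 * x * (1 - x) :: real)) ((3 * 1^2 - 2 * 1^3) - (3 * 0^2 - 2 * 0^3))"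
    by (rule has_bochner_integral_FTC_Icc[where F = "\<lambda>x. 3 * x^2 - 2 * x^3"])
      (auto intro!: continuous_intros derivative_eq_intros simp: has_real_derivative_iff_has_vector_derivative[symmetric] power2_eq_square algebra_simps)
  thus ?thesis by (simp add: parabola_def[abs_def])
qed

lemma fourier_transform_parabola_0: "fourier_transform parabola 0 = 1"
proof -
  have "fourier_transform parabola 0 = (\<integral>x. complex_of_real (parabola x) \<partial>lborel)"
    by (simp add: fourier_transform_def scaleR_conv_of_real)
  also have "\<dots> = of_real (\<integral>x. parabola x \<partial>lborel)" by (rule integral_complex_of_real)
  finally show ?thesis using parabola_integral by (simp add: has_bochner_integral_iff)
qed

lemma fourier_transform_parabola_le_1: "cmod (fourier_transform parabola \<xi>) \<le> 1"
proof -
  have "cmod (fourier_transform parabola \<xi>) \<le> (\<integral>x. norm (parabola x *\<^sub>R ee (- \<xi> * x)) \<partial>lborel)"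
    unfolding fourier_transform_def by (rule integral_norm_bound)
  also have "\<dots> = (\<integral>x. parabola x \<partial>lborel)"
    by (intro Bochner_Integration.integral_cong refl) (auto simp: parabola_def indicator_def)
  finally show ?thesis using parabola_integral by (simp add: has_bochner_integral_iff)
qed

lemma fourier_transform_parabola_eq:
  assumes "\<xi> \<noteq> 0"
  defines "\<alpha> \<equiv> - 2 * pi * \<i> * \<xi>"
  shows "fourier_transform parabola \<xi> = exp \<alpha> * (6 / \<alpha>^2 - 12 / \<alpha>^3) + (6 / \<alpha>^2 + 12 / \<alpha>^3)"
proof -
  have \<alpha>: "\<alpha> \<noteq> 0" using assms by simp
  \<comment> \<open>Repeated integration by parts: for P = 6 z - 6 z^2 the antiderivative is
    exp(\<alpha> z) (P / \<alpha> - P' / \<alpha>^2 + P'' / \<alpha>^3). The term P / \<alpha>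
    vanishes at both ends.\<close>
  define F where "F z = exp (\<alpha> * z) * ((6 * z - 6 * z^2) / \<alpha> - (6 - 12 * z) / \<alpha>^2 - 12 / \<alpha>^3)" for z
  have F: "(F has_field_derivative exp (\<alpha> * z) * (6 * z - 6 * z^2)) (at z)" for z
    unfolding F_def using \<alpha>
    by (auto intro!: derivative_eq_intros simp: field_simps power2_eq_square power3_eq_cube)
  have "has_bochner_integral lborel (\<lambda>x. indicator {0..1} x *\<^sub>R (exp (\<alpha> * of_real x) * (6 * of_real x - 6 * (of_real x)^2))) (F (of_real 1) - F (of_real 0))"
  proof (rule has_bochner_integral_FTC_Icc[where F = "\<lambda>x. F (of_real x)"])
    fix x :: real
    show "((\<lambda>x. F (of_real x)) has_vector_derivative exp (\<alpha> * of_real x) * (6 * of_real x - 6 * (of_real x)^2)) (at x within {0..1})"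
      by (rule has_vector_derivative_real_field[OF F])
  qed (auto intro!: continuous_intros)
  moreover have "indicator {0..1} x *\<^sub>R (exp (\<alpha> * of_real x) * (6 * of_real x - 6 * (of_real x)^2)) = parabola x *\<^sub>R ee (- \<xi> * x)" for x
    by (simp add: parabola_def ee_def cis_conv_exp \<alpha>_def scaleR_conv_of_real indicator_def power2_eq_square algebra_simps)
  ultimately have "has_bochner_integral lborel (\<lambda>x. parabola x *\<^sub>R ee (- \<xi> * x)) (F (of_real 1) - F (of_real 0))" by simp
  hence "fourier_transform parabola \<xi> = F (of_real 1) - F (of_real 0)" unfolding fourier_transform_def by (simp add: has_bochner_integral_iff)
  thus ?thesis by (simp add: F_def algebra_simps)
qed

lemma fourier_transform_parabola_decay: "cmod (fourier_transform parabola \<xi>) \<le> 4 * (1 + \<bar>\<xi>\<bar>) powr (-2)"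
\<comment> \<open>The closed form is of no use near 0. For |\<xi>| <= 1 the weight is at least 1/4,
  so the trivial bound 1 suffices, which accounts for the constant 4.\<close>
proof (cases "\<bar>\<xi>\<bar> \<le> 1")
  case True
  have "2 powr (-2) \<le> (1 + \<bar>\<xi>\<bar>) powr (-2)" using True by (intro powr_mono2') auto
  thus ?thesis using fourier_transform_parabola_le_1[of \<xi>] by (simp add: powr_minus)
next
  case False
  define \<alpha> where "\<alpha> = - 2 * pi * \<i> * \<xi>"
  have a: "cmod \<alpha> = 2 * pi * \<bar>\<xi>\<bar>" by (simp add: \<alpha>_def norm_mult)
  have a6: "cmod \<alpha> \<ge> 6 * \<bar>\<xi>\<bar>" unfolding a using pi_gt3 by (intro mult_right_mono) auto
  hence a6': "cmod \<alpha> \<ge> 6" using False by linarith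
  have "cmod (exp \<alpha>) = 1" by (simp add: \<alpha>_def norm_exp_eq_Re)
  have t: "cmod (6 / \<alpha>^2) = 6 / cmod \<alpha> ^ 2" "cmod (12 / \<alpha>^3) = 12 / cmod \<alpha> ^ 3" by (simp_all add: norm_divide norm_power)
  have "cmod (fourier_transform parabola \<xi>) \<le> cmod (exp \<alpha> * (6 / \<alpha>^2 - 12 / \<alpha>^3)) + cmod (6 / \<alpha>^2 + 12 / \<alpha>^3)"
    using fourier_transform_parabola_eq[of \<xi>] False unfolding \<alpha>_def by (metis norm_triangle_ineq abs_zero zero_le_one)
  also have "\<dots> \<le> (6 / cmod \<alpha> ^ 2 + 12 / cmod \<alpha> ^ 3) + (6 / cmod \<alpha> ^ 2 + 12 / cmod \<alpha> ^ 3)"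
    unfolding norm_mult \<open>cmod (exp \<alpha>) = 1\<close> mult_1 t[symmetric] by (intro add_mono norm_triangle_ineq norm_triangle_ineq4)
  also have "12 / cmod \<alpha> ^ 3 = 12 / cmod \<alpha> / cmod \<alpha> ^ 2" by (simp add: power3_eq_cube power2_eq_square)
  also have "12 / cmod \<alpha> / cmod \<alpha> ^ 2 \<le> 2 / cmod \<alpha> ^ 2"
    using a6' by (intro divide_right_mono) (auto simp: divide_le_eq)
  also have "(6 / cmod \<alpha> ^ 2 + 2 / cmod \<alpha> ^ 2) + (6 / cmod \<alpha> ^ 2 + 2 / cmod \<alpha> ^ 2) = 16 / cmod \<alpha> ^ 2" by (simp add: field_simps)
  also have "\<dots> \<le> 16 / (3 * (1 + \<bar>\<xi>\<bar>)) ^ 2"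
  proof -
    have "3 * (1 + \<bar>\<xi>\<bar>) \<le> cmod \<alpha>" using a6 False by auto
    thus ?thesis by (intro divide_left_mono power_mono mult_pos_pos zero_less_power) auto
  qed
  also have "\<dots> \<le> 4 * (1 + \<bar>\<xi>\<bar>) powr (-2)"
  proof -
    have "16 / (3 * w) ^ 2 \<le> 4 * w powr (-2)" if "w > 0" for w :: real
    proof -
      have "16 / (3 * w) ^ 2 = 16 / 9 * (1 / w ^ 2)" by (simp add: power_mult_distrib)
      also have "\<dots> \<le> 4 * (1 / w ^ 2)" by (intro mult_right_mono) auto
      also have "1 / w ^ 2 = w powr (-2)" using that by (simp add: powr_minus inverse_eq_divide)
      finally show ?thesis .
    qed
    thus ?thesis by (simp only: add_pos_nonneg zero_less_one abs_ge_zero)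
  qed
  finally show ?thesis by simp
qed

lemma decaying_density_parabola: "decaying_density parabola"
  unfolding decaying_density_def
proof (intro conjI allI impI)
  show "parabola \<in> borel_measurable borel" unfolding parabola_def by measurable
  show "\<exists>b. \<forall>x. parabola x \<le> b"
  proof (intro exI allI)
    fix x :: real
    have "6 * x * (1 - x) \<le> 6 * 1 * 1" if "0 \<le> x" "x \<le> 1" using that by (intro mult_mono) auto
    thus "parabola x \<le> 6" by (auto simp: parabola_def indicator_def)
  qed
  show "\<exists>C. \<forall>\<xi>. cmod (fourier_transform parabola \<xi>) \<le> C * (1 + \<bar>\<xi>\<bar>) powr (- 2)" using fourier_transform_parabola_decay by blast
qed (auto simp: parabola_def indicator_def)

section \<open>From densities to probability measures, and the iteration\<close>

lemma fourier_transform_0: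
  assumes "decaying_density f"
  shows "fourier_transform f 0 = of_real (\<integral>x. f x \<partial>lborel)" and "integrable lborel f"
proof -
  show "fourier_transform f 0 = of_real (\<integral>x. f x \<partial>lborel)"
    unfolding fourier_transform_def integral_complex_of_real[symmetric] by (simp add: scaleR_conv_of_real)
  have "integrable lborel (\<lambda>x. f x *\<^sub>R ee (0 * x))" by (rule decaying_density_integrable_ee[OF assms])
  from integrable_Re[OF this] show "integrable lborel f" by simp
qed

definition density_prob :: "(real \<Rightarrow> real) \<Rightarrow> real measure" where
  "density_prob f = density lborel (\<lambda>x. ennreal (f x / (\<integral>x. f x \<partial>lborel)))"

lemma density_prob:
  assumes f: "decaying_density f" and pos: "(\<integral>x. f x \<partial>lborel) > 0"
  shows "real_distribution (density_prob f)" 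
    and "fourier_meas (density_prob f) \<xi> = fourier_transform f \<xi> / of_real (\<integral>x. f x \<partial>lborel)"
    and "AE x in density_prob f. f x \<noteq> 0"
proof -
  let ?I = "\<integral>x. f x \<partial>lborel"
  from f have [measurable]: "f \<in> borel_measurable borel" and f0: "\<And>x. f x \<ge> 0"
    by (auto simp: decaying_density_def)
  have g0: "f x / ?I \<ge> 0" for x using f0 pos by (intro divide_nonneg_pos) auto
  show "real_distribution (density_prob f)"
  proof (intro real_distribution.intro real_distribution_axioms.intro prob_spaceI)
    have "emeasure (density_prob f) (space (density_prob f)) = (\<integral>\<^sup>+x. ennreal (f x / ?I) \<partial>lborel)"
      unfolding density_prob_def by (simp add: emeasure_density)
    also have "\<dots> = ennreal (\<integral>x. f x / ?I \<partial>lborel)"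
      using g0 fourier_transform_0(2)[OF f] by (intro nn_integral_eq_integral) auto
    also have "(\<integral>x. f x / ?I \<partial>lborel) = 1" using pos by simp
    finally show "emeasure (density_prob f) (space (density_prob f)) = 1" by simp
  qed (auto simp: density_prob_def)
  have "fourier_meas (density_prob f) \<xi> = (\<integral>x. (f x / ?I) *\<^sub>R ee (- \<xi> * x) \<partial>lborel)"
    unfolding fourier_meas_ee density_prob_def using g0 by (subst integral_density) auto
  also have "\<dots> = (\<integral>x. (f x *\<^sub>R ee (- \<xi> * x)) / of_real ?I \<partial>lborel)"
    by (simp add: scaleR_conv_of_real)
  also have "\<dots> = fourier_transform f \<xi> / of_real ?I" unfolding fourier_transform_def by simp
  finally show "fourier_meas (density_prob f) \<xi> = fourier_transform f \<xi> / of_real ?I" .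
  show "AE x in density_prob f. f x \<noteq> 0"
    unfolding density_prob_def by (subst AE_density) auto
qed

text \<open>The set T is recorded besides the new density because densities have no pointwise limit
  here: what passes to a weak limit is full measure on a closed set.\<close>

lemma density_step:
  fixes Q :: "nat set" and A B :: "nat \<Rightarrow> int" and \<psi> \<theta> :: "nat \<Rightarrow> real"
  assumes Q0: "\<And>q. q \<in> Q \<Longrightarrow> q > 0"
    and AB: "\<And>q. q \<in> Q \<Longrightarrow> gcd (A q) (B q) = 1"
    and \<psi>: "\<And>q. q \<in> Q \<Longrightarrow> \<psi> q \<in> {0..<1/2}"
    and \<sigma>: "0 \<le> \<sigma>" "\<sigma> \<le> 1 / 2" "\<sigma> < conv_exponent Q \<psi>" 
    and f: "decaying_density f" and \<delta>: "\<delta> > 0" and \<eta>: "\<eta> > 0"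
  obtains f' T where "decaying_density f'" "\<And>\<xi>. cmod (fourier_transform f' \<xi> - fourier_transform f \<xi>) \<le> \<delta> * (1 + \<bar>\<xi>\<bar>) powr (- \<sigma>)"
    "closed T" "\<And>x. f' x \<noteq> 0 \<Longrightarrow> f x \<noteq> 0 \<and> x \<in> T"
    "\<And>x. x \<in> T \<Longrightarrow> x \<in> {0..1} \<and> (\<exists>q\<in>Q. \<exists>p. gcd (B q * p + A q) (int q) = 1 \<and> 
        \<bar>x - (of_int p + \<theta> q) / real q\<bar> < \<psi> q / real q \<and> \<psi> q / real q < \<eta>)"
proof -
  from f obtain C where C: "\<And>\<xi>. cmod (fourier_transform f \<xi>) \<le> C * (1 + \<bar>\<xi>\<bar>) powr (-2)" by (auto simp: decaying_density_def)
  have C0: "C \<ge> 0" using order_trans[OF norm_ge_zero C[of 0]] by simp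
  obtain L where L: "L > 0" "\<And>(\<xi>::real) F. finite F \<Longrightarrow> (\<Sum>l\<in>F. (1 + \<bar>\<xi> - of_int l\<bar>) powr (- 3 / 2)) \<le> L"
    using sum_bracket_bounded by blast
  \<comment> \<open>The density f is already fixed, so its decay constant C may enter the choice; C
    + 1 guards against C = 0.\<close>
  define \<delta>' where "\<delta>' = \<delta> / ((C + 1) * L)"
  have \<delta>': "\<delta>' > 0" using \<delta> C0 L(1) by (simp add: \<delta>'_def)
  have "\<delta>' * C * L \<le> \<delta>' * (C + 1) * L" using \<delta>' L(1) by (intro mult_right_mono mult_left_mono) auto
  also have "\<dots> = \<delta>" using C0 L(1) by (simp add: \<delta>'_def)
  finally have \<delta>L: "\<delta>' * C * L \<le> \<delta>" .
  have \<sigma>1: "\<sigma> \<le> 1" using \<sigma> by simp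
  show ?thesis
  proof (rule block_function_exists[where Q = Q and A = A and B = B and \<psi> = \<psi> and \<theta> = \<theta> and \<sigma> = \<sigma> and \<delta> = \<delta>' and \<eta> = \<eta>, 
      OF Q0 AB \<psi> \<sigma>(1) \<sigma>1 \<sigma>(3) \<delta>' \<eta>])
    fix G :: "real \<Rightarrow> real" and c K S r 
    assume G: "\<And>x. (\<lambda>j. \<Sum>l\<in>{- int j..int j}. c l * ee (of_int l * x)) \<longlonglongrightarrow> of_real (G x)"
      "\<And>x. G x \<ge> 0" "c 0 = 1" "\<And>l. cmod (c l) \<le> K * (1 + \<bar>of_int l\<bar>) powr (-2)"
      "\<And>l. l \<noteq> 0 \<Longrightarrow> cmod (c l) \<le> \<delta>' * (1 + \<bar>of_int l\<bar>) powr (- \<sigma>)"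
      "finite S" "S \<subseteq> Q" "\<And>q. q \<in> S \<Longrightarrow> r < \<psi> q / real q \<and> \<psi> q / real q < \<eta>"
      "\<And>x. G x \<noteq> 0 \<Longrightarrow> \<exists>q\<in>S. \<exists>p. gcd (B q * p + A q) (int q) = 1 \<and> \<bar>x - (of_int p + \<theta> q) / real q\<bar> \<le> r"
    \<comment> \<open>Only finitely many centres lie within r of [0,1], all of modulus at most r +
      1. Restricting to such p makes T a finite union of closed sets, hence closed.\<close>
    define P where "P q = {p::int. gcd (B q * p + A q) (int q) = 1 \<and> \<bar>0 - (of_int p + \<theta> q) / real q\<bar> < r + 2}" for q
    define T where "T = {0..1} \<inter> (\<Union>q\<in>S. \<Union>p\<in>P q. {x. \<bar>x - (of_int p + \<theta> q) / real q\<bar> \<le> r})"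
    show ?thesis
    proof (rule that[of "\<lambda>x. f x * G x" T])
      show "decaying_density (\<lambda>x. f x * G x)" by (rule fourier_transform_mult_series(2)[OF f G(1,2,4)])
      show "cmod (fourier_transform (\<lambda>x. f x * G x) \<xi> - fourier_transform f \<xi>) \<le> \<delta> * (1 + \<bar>\<xi>\<bar>) powr (- \<sigma>)" for \<xi>
      proof -
        have "cmod (fourier_transform (\<lambda>x. f x * G x) \<xi> - fourier_transform f \<xi>) \<le> \<delta>' * C * L * (1 + \<bar>\<xi>\<bar>) powr (- \<sigma>)"
          by (rule fourier_transform_mult_series_close[OF \<sigma>(1,2) L(2) f C G(1,2,4,3) \<delta>' G(5)])
        also have "\<dots> \<le> \<delta> * (1 + \<bar>\<xi>\<bar>) powr (- \<sigma>)" using \<delta>L by (intro mult_right_mono) auto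
        finally show ?thesis .
      qed
      have "finite (P q)" if "q \<in> S" for q
        unfolding P_def using Q0[of q] that G(7) by (intro finite_subset[OF _ finite_near_int[of q 0 "\<theta> q" "r + 2"]]) auto
      thus "closed T" unfolding T_def
        by (intro closed_Int closed_atLeastAtMost closed_UN ballI G(6) closed_Collect_le continuous_intros)
      show "f x \<noteq> 0 \<and> x \<in> T" if "f x * G x \<noteq> 0" for x
      proof -
        have x: "f x \<noteq> 0" "G x \<noteq> 0" using that by auto
        hence x01: "x \<in> {0..1}" using f by (auto simp: decaying_density_def)
        obtain q p where qp: "q \<in> S" "gcd (B q * p + A q) (int q) = 1" "\<bar>x - (of_int p + \<theta> q) / real q\<bar> \<le> r"
          using G(9)[OF x(2)] by (elim bexE exE conjE)
        have "\<bar>0 - (of_int p + \<theta> q) / real q\<bar> < r + 2" using qp(3) x01 unfolding atLeastAtMost_iff by linarith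
        hence "p \<in> P q" using qp(2) unfolding P_def by (intro CollectI conjI)
        thus ?thesis using x x01 qp(1,3) unfolding T_def by blast
      qed
      fix x assume "x \<in> T"
      then obtain q p where qp: "x \<in> {0..1}" "q \<in> S" "p \<in> P q" "\<bar>x - (of_int p + \<theta> q) / real q\<bar> \<le> r"
        unfolding T_def by blast
      have "gcd (B q * p + A q) (int q) = 1" using qp(3) unfolding P_def mem_Collect_eq by (rule conjunct1)
      moreover have "\<bar>x - (of_int p + \<theta> q) / real q\<bar> < \<psi> q / real q \<and> \<psi> q / real q < \<eta>" using G(8)[OF qp(2)] qp(4) by linarith
      ultimately show "x \<in> {0..1} \<and> (\<exists>q\<in>Q. \<exists>p. gcd (B q * p + A q) (int q) = 1 \<and> 
          \<bar>x - (of_int p + \<theta> q) / real q\<bar> < \<psi> q / real q \<and> \<psi> q / real q < \<eta>)"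
        using qp(1,2) G(7) by (intro conjI bexI[of _ q] exI[of _ p]) auto
    qed
  qed
qed

text \<open>The perturbations 2^(-(n+2)) add up to 1/2, so the mass can never fall below 1/2. The
  threshold 2^(-n) on \<psi> q / q forces the approximations of later stages to use ever new
  q.\<close>

lemma density_sequence:
  fixes Q :: "nat set" and A B :: "nat \<Rightarrow> int" and \<psi> \<theta> :: "nat \<Rightarrow> real"
  assumes Q0: "\<And>q. q \<in> Q \<Longrightarrow> q > 0"
    and AB: "\<And>q. q \<in> Q \<Longrightarrow> gcd (A q) (B q) = 1"
    and \<psi>: "\<And>q. q \<in> Q \<Longrightarrow> \<psi> q \<in> {0..<1/2}"
    and \<sigma>: "0 \<le> \<sigma>" "\<sigma> \<le> 1 / 2" "\<sigma> < conv_exponent Q \<psi>" 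
  obtains f T where "\<And>n. decaying_density (f n)" "f 0 = parabola" 
    "\<And>n \<xi>. cmod (fourier_transform (f (Suc n)) \<xi> - fourier_transform (f n) \<xi>) \<le> (1 / 2) ^ (n + 2) * (1 + \<bar>\<xi>\<bar>) powr (- \<sigma>)"
    "\<And>n. closed (T n)" "\<And>n x. f (Suc n) x \<noteq> 0 \<Longrightarrow> f n x \<noteq> 0 \<and> x \<in> T n"
    "\<And>n x. x \<in> T n \<Longrightarrow> x \<in> {0..1} \<and> (\<exists>q\<in>Q. \<exists>p. gcd (B q * p + A q) (int q) = 1 \<and> 
        \<bar>x - (of_int p + \<theta> q) / real q\<bar> < \<psi> q / real q \<and> \<psi> q / real q < (1 / 2) ^ n)"
proof -
  define R where "R n f f' T \<longleftrightarrow> (\<forall>\<xi>. cmod (fourier_transform f' \<xi> - fourier_transform f \<xi>) \<le> (1 / 2) ^ (n + 2) * (1 + \<bar>\<xi>\<bar>) powr (- \<sigma>)) \<and>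
    closed T \<and> (\<forall>x. f' x \<noteq> 0 \<longrightarrow> f x \<noteq> 0 \<and> x \<in> T) \<and> 
    (\<forall>x\<in>T. x \<in> {0..1} \<and> (\<exists>q\<in>Q. \<exists>p. gcd (B q * p + A q) (int q) = 1 \<and> 
        \<bar>x - (of_int p + \<theta> q) / real q\<bar> < \<psi> q / real q \<and> \<psi> q / real q < (1 / 2) ^ n))" 
    for n :: nat and f f' :: "real \<Rightarrow> real" and T
  \<comment> \<open>The clause for n = 0 builds the starting density into the invariant, since
    dependent choice by itself would start anywhere. The sets T depend on two consecutive densities
    and are selected afterwards.\<close>
  have "\<exists>f. \<forall>n. (decaying_density (f n) \<and> (n = 0 \<longrightarrow> f n = parabola)) \<and> (\<exists>T. R n (f n) (f (Suc n)) T)"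
  proof (rule dependent_nat_choice)
    show "\<exists>f. decaying_density f \<and> (0 = 0 \<longrightarrow> f = parabola)" using decaying_density_parabola by blast
    fix f and n :: nat assume "decaying_density f \<and> (n = 0 \<longrightarrow> f = parabola)"
    hence f: "decaying_density f" by simp
    obtain f' T where "decaying_density f'" "\<And>\<xi>. cmod (fourier_transform f' \<xi> - fourier_transform f \<xi>) \<le> (1 / 2) ^ (n + 2) * (1 + \<bar>\<xi>\<bar>) powr (- \<sigma>)"
      "closed T" "\<And>x. f' x \<noteq> 0 \<Longrightarrow> f x \<noteq> 0 \<and> x \<in> T"
      "\<And>x. x \<in> T \<Longrightarrow> x \<in> {0..1} \<and> (\<exists>q\<in>Q. \<exists>p. gcd (B q * p + A q) (int q) = 1 \<and> 
          \<bar>x - (of_int p + \<theta> q) / real q\<bar> < \<psi> q / real q \<and> \<psi> q / real q < (1 / 2) ^ n)"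
      by (rule density_step[where Q = Q and A = A and B = B and \<psi> = \<psi> and \<theta> = \<theta> and \<sigma> = \<sigma> and f = f 
            and \<delta> = "(1 / 2) ^ (n + 2)" and \<eta> = "(1 / 2) ^ n", OF Q0 AB \<psi> \<sigma> f]) auto
    thus "\<exists>f'. (decaying_density f' \<and> (Suc n = 0 \<longrightarrow> f' = parabola)) \<and> (\<exists>T. R n f f' T)"
      unfolding R_def by (intro exI[of _ f'] exI[of _ T] conjI allI ballI impI) (auto simp del: power_Suc)
  qed
  then obtain f where f: "\<And>n. decaying_density (f n)" "f 0 = parabola" "\<And>n. \<exists>T. R n (f n) (f (Suc n)) T" by blast
  then obtain T where T: "\<And>n. R n (f n) (f (Suc n)) (T n)" by metis
  show ?thesis
    by (rule that[of f T]) (use f(1,2) T in \<open>unfold R_def, blast+\<close>)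
qed

section \<open>The weak limit and its support\<close>

lemma fourier_meas_char: "fourier_meas \<nu> \<xi> = char \<nu> (- 2 * pi * \<xi>)"
  unfolding fourier_meas_def char_def by (simp add: mult_ac)

text \<open>Different stages might yield the same pair (p, q). Infinitely many pairs are obtained
  from the positive values \<psi> q / q becoming arbitrarily small along the stages.\<close>

lemma infinite_if_arbitrarily_small:
  fixes v :: "'a \<Rightarrow> real"
  assumes ex: "\<And>n. \<exists>z\<in>S. v z < (1 / 2) ^ n" and pos: "\<And>z. z \<in> S \<Longrightarrow> v z > 0"
  shows "infinite S"
proof
  assume fin: "finite S"
  have ne: "S \<noteq> {}" using ex[of 0] by blast
  have "Min (v ` S) > 0" using fin ne pos by simp
  then obtain n where n: "(1 / 2) ^ n < Min (v ` S)" using real_arch_pow_inv[of "Min (v ` S)" "1/2"] by auto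
  obtain z where z: "z \<in> S" "v z < (1 / 2) ^ n" using ex[of n] by blast
  have "Min (v ` S) \<le> v z" using fin z(1) by simp
  thus False using n z(2) by linarith
qed

lemma fourier_decay_attained:
  fixes Q :: "nat set" and A B :: "nat \<Rightarrow> int" and \<psi> \<theta> :: "nat \<Rightarrow> real"
  assumes Q0: "\<And>q. q \<in> Q \<Longrightarrow> q > 0"
    and AB: "\<And>q. q \<in> Q \<Longrightarrow> gcd (A q) (B q) = 1"
    and \<psi>: "\<And>q. q \<in> Q \<Longrightarrow> \<psi> q \<in> {0..<1/2}"
    and \<sigma>: "0 \<le> \<sigma>" "\<sigma> \<le> 1 / 2" "\<sigma> < conv_exponent Q \<psi>" 
  shows "\<exists>\<nu>\<in>prob_measures_on (W_star A B Q \<psi> \<theta>). \<exists>C. \<forall>\<xi>. cmod (fourier_meas \<nu> \<xi>) \<le> C * (1 + \<bar>\<xi>\<bar>) powr (- \<sigma>)"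
proof -
  obtain f T where f: "\<And>n. decaying_density (f n)" "f 0 = parabola" 
    "\<And>n \<xi>. cmod (fourier_transform (f (Suc n)) \<xi> - fourier_transform (f n) \<xi>) \<le> (1 / 2) ^ (n + 2) * (1 + \<bar>\<xi>\<bar>) powr (- \<sigma>)"
    "\<And>n. closed (T n)" "\<And>n x. f (Suc n) x \<noteq> 0 \<Longrightarrow> f n x \<noteq> 0 \<and> x \<in> T n"
    "\<And>n x. x \<in> T n \<Longrightarrow> x \<in> {0..1} \<and> (\<exists>q\<in>Q. \<exists>p. gcd (B q * p + A q) (int q) = 1 \<and> 
        \<bar>x - (of_int p + \<theta> q) / real q\<bar> < \<psi> q / real q \<and> \<psi> q / real q < (1 / 2) ^ n)"
    using density_sequence[where Q = Q and A = A and B = B and \<psi> = \<psi> and \<theta> = \<theta> and \<sigma> = \<sigma>, OF Q0 AB \<psi> \<sigma>] by blast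
  \<comment> \<open>The partial sums of the geometric series of 2^(-(k+2)), kept exact so that the
    induction closes.\<close>
  have close: "cmod (fourier_transform (f n) \<xi> - fourier_transform parabola \<xi>) \<le> (1 / 2 - (1 / 2) ^ (n + 1)) * (1 + \<bar>\<xi>\<bar>) powr (- \<sigma>)" for n \<xi>
  proof (induction n)
    case (Suc n)
    have "cmod (fourier_transform (f (Suc n)) \<xi> - fourier_transform parabola \<xi>) \<le> cmod (fourier_transform (f (Suc n)) \<xi> - fourier_transform (f n) \<xi>) + cmod (fourier_transform (f n) \<xi> - fourier_transform parabola \<xi>)"
      using norm_triangle_ineq[of "fourier_transform (f (Suc n)) \<xi> - fourier_transform (f n) \<xi>" "fourier_transform (f n) \<xi> - fourier_transform parabola \<xi>"] by simp
    also have "\<dots> \<le> (1 / 2) ^ (n + 2) * (1 + \<bar>\<xi>\<bar>) powr (- \<sigma>) + (1 / 2 - (1 / 2) ^ (n + 1)) * (1 + \<bar>\<xi>\<bar>) powr (- \<sigma>)"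
      by (intro add_mono f(3) Suc)
    also have "\<dots> = (1 / 2 - (1 / 2) ^ (Suc n + 1)) * (1 + \<bar>\<xi>\<bar>) powr (- \<sigma>)"
      by (simp only: distrib_right[symmetric]) simp
    finally show ?case .
  qed (simp add: f(2))
  have close': "cmod (fourier_transform (f n) \<xi> - fourier_transform parabola \<xi>) \<le> 1 / 2 * (1 + \<bar>\<xi>\<bar>) powr (- \<sigma>)" for n \<xi>
    using close[of n \<xi>] by (rule order_trans) (intro mult_right_mono, auto)
  \<comment> \<open>At frequency 0 the estimate compares masses. Every f n has mass at least 1/2, so
    normalising costs at most a factor 2 in the decay: hence 5 becomes 10.\<close>
  have mass: "(\<integral>x. f n x \<partial>lborel) \<ge> 1 / 2" for n
  proof -
    have "cmod (of_real ((\<integral>x. f n x \<partial>lborel) - 1)) \<le> 1 / 2"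
      using close'[of n 0] by (simp add: fourier_transform_parabola_0 fourier_transform_0(1)[OF f(1)])
    thus ?thesis unfolding norm_of_real by linarith
  qed
  have mass0: "(\<integral>x. f n x \<partial>lborel) > 0" for n using mass[of n] by linarith
  have decay: "cmod (fourier_transform (f n) \<xi>) \<le> 5 * (1 + \<bar>\<xi>\<bar>) powr (- \<sigma>)" for n \<xi>
  proof -
    have "cmod (fourier_transform (f n) \<xi>) \<le> cmod (fourier_transform (f n) \<xi> - fourier_transform parabola \<xi>) + cmod (fourier_transform parabola \<xi>)"
      using norm_triangle_ineq[of "fourier_transform (f n) \<xi> - fourier_transform parabola \<xi>" "fourier_transform parabola \<xi>"] by simp
    also have "\<dots> \<le> 1 / 2 * (1 + \<bar>\<xi>\<bar>) powr (- \<sigma>) + 4 * (1 + \<bar>\<xi>\<bar>) powr (- \<sigma>)"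
    proof (intro add_mono close')
      show "cmod (fourier_transform parabola \<xi>) \<le> 4 * (1 + \<bar>\<xi>\<bar>) powr (- \<sigma>)"
        using fourier_transform_parabola_decay[of \<xi>] by (rule order_trans) (use \<sigma> in \<open>auto intro!: powr_mono\<close>)
    qed
    also have "\<dots> \<le> 5 * (1 + \<bar>\<xi>\<bar>) powr (- \<sigma>)" by simp
    finally show ?thesis .
  qed
  define \<mu> where "\<mu> n = density_prob (f n)" for n
  have \<mu>: "real_distribution (\<mu> n)" for n unfolding \<mu>_def by (rule density_prob(1)[OF f(1) mass0])
  have \<mu>_decay: "cmod (fourier_meas (\<mu> n) \<xi>) \<le> 10 * (1 + \<bar>\<xi>\<bar>) powr (- \<sigma>)" for n \<xi>
  proof -
    have "cmod (fourier_meas (\<mu> n) \<xi>) = cmod (fourier_transform (f n) \<xi>) / (\<integral>x. f n x \<partial>lborel)"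
      unfolding \<mu>_def density_prob(2)[OF f(1) mass0] norm_divide using mass0[of n] by simp
    also have "\<dots> \<le> (5 * (1 + \<bar>\<xi>\<bar>) powr (- \<sigma>)) / (1 / 2)"
      using decay mass by (intro frac_le) auto
    finally show ?thesis by simp
  qed
  have supp: "f m x \<noteq> 0 \<Longrightarrow> x \<in> T n" if "n < m" for m n x
    using that
  proof (induction m)
    case (Suc m)
    thus ?case using f(5)[of m x] by (cases "n = m") auto
  qed simp
  have \<mu>_T: "AE x in \<mu> m. x \<in> T n" if "n < m" for m n
    using density_prob(3)[OF f(1) mass0, of m] unfolding \<mu>_def by eventually_elim (rule supp[OF that])
  have \<mu>_01: "AE x in \<mu> m. x \<in> {0..1}" for m
    using density_prob(3)[OF f(1) mass0, of m] unfolding \<mu>_def 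
  proof eventually_elim
    case (elim x)
    thus ?case using f(1)[of m] by (auto simp: decaying_density_def)
  qed
  \<comment> \<open>Tightness is stated with half-open intervals, so one is taken that contains
    [0,1] with a margin.\<close>
  have "tight \<mu>"
    unfolding tight_def
  proof (intro conjI allI impI \<mu>)
    fix \<epsilon> :: real assume \<epsilon>: "\<epsilon> > 0"
    have "measure (\<mu> n) {-1<..2} = 1" for n
    proof -
      interpret real_distribution "\<mu> n" by (rule \<mu>)
      have "AE x in \<mu> n. x \<in> {-1<..2}" using \<mu>_01[of n] by eventually_elim auto
      thus ?thesis by (subst prob_eq_1) auto
    qed
    thus "\<exists>a b::real. a < b \<and> (\<forall>n. measure (\<mu> n) {a<..b} > 1 - \<epsilon>)"
      using \<epsilon> by (intro exI[of _ "-1"] exI[of _ 2]) auto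
  qed
  then obtain s M where s: "strict_mono (s :: nat \<Rightarrow> nat)" and M: "real_distribution M" and "weak_conv_m (\<mu> \<circ> id \<circ> s) M"
    using tight_imp_convergent_subsubsequence[of \<mu> id] strict_mono_id by blast
  hence conv: "weak_conv_m (\<lambda>n. \<mu> (s n)) M" by (simp add: o_def)
  interpret M: real_distribution M by (rule M)
  \<comment> \<open>Weak convergence gives pointwise convergence of characteristic functions, so a
    bound uniform in n passes to the limit.\<close>
  have M_decay: "cmod (fourier_meas M \<xi>) \<le> 10 * (1 + \<bar>\<xi>\<bar>) powr (- \<sigma>)" for \<xi>
  proof (rule LIMSEQ_le_const2[OF tendsto_norm])
    show "(\<lambda>n. fourier_meas (\<mu> (s n)) \<xi>) \<longlonglongrightarrow> fourier_meas M \<xi>"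
      unfolding fourier_meas_char by (intro levy_continuity1 \<mu> M conv)
  qed (use \<mu>_decay in blast)
  have M_T: "AE x in M. x \<in> T n" for n
  proof -
    \<comment> \<open>\<open>infdist\<close> to the empty set is 0 by convention, so without this a
      vanishing distance would not mean membership.\<close>
    have ne: "T n \<noteq> {}"
    proof
      assume "T n = {}"
      interpret real_distribution "\<mu> (Suc n)" by (rule \<mu>)
      have "AE x in \<mu> (Suc n). False" using \<mu>_T[of n "Suc n"] \<open>T n = {}\<close> by simp
      thus False using ae_filter_bot by (simp only: eventually_False)
    qed
    \<comment> \<open>The truncated distance to T n is continuous and bounded, so its integrals
      converge along the subsequence. They vanish from k > n on, because s k >= k, and a nonnegative
      function with integral 0 vanishes almost everywhere.\<close>
    define h where "h x = min 1 (infdist x (T n))" for x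
    have h: "isCont h x" "norm (h x) \<le> 1" "h x \<ge> 0" for x
      unfolding h_def by (auto intro!: continuous_intros simp: infdist_nonneg)
    have "(\<lambda>k. \<integral>x. h x \<partial>\<mu> (s k)) \<longlonglongrightarrow> (\<integral>x. h x \<partial>M)"
      by (rule weak_conv_imp_integral_bdd_continuous_conv[OF \<mu> M conv]) (rule h)+
    moreover have "eventually (\<lambda>k. (\<integral>x. h x \<partial>\<mu> (s k)) = 0) sequentially"
      using eventually_gt_at_top[of n]
    proof eventually_elim
      case (elim k)
      have "n < s k" using elim seq_suble[OF s, of k] by linarith
      have "AE x in \<mu> (s k). h x = 0" using \<mu>_T[OF \<open>n < s k\<close>]
        by eventually_elim (simp add: h_def infdist_zero)
      thus ?case by (rule integral_eq_zero_AE)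
    qed
    hence "(\<lambda>k. \<integral>x. h x \<partial>\<mu> (s k)) \<longlonglongrightarrow> 0" by (rule tendsto_eventually)
    ultimately have "(\<integral>x. h x \<partial>M) = 0" by (rule LIMSEQ_unique)
    moreover have mh: "h \<in> borel_measurable M"
    proof -
      have "continuous_on UNIV h" using h(1) by (simp add: continuous_at_imp_continuous_on)
      from borel_measurable_continuous_onI[OF this] show ?thesis by simp
    qed
    moreover have "integrable M h" using h mh by (intro M.integrable_const_bound[of _ 1]) auto
    ultimately have "AE x in M. h x = 0" using h(3) by (subst (asm) integral_nonneg_eq_0_iff_AE) auto
    thus ?thesis
    proof eventually_elim
      case (elim x)
      hence "infdist x (T n) = 0" by (auto simp: h_def min_def split: if_splits)
      thus ?case using in_closed_iff_infdist_zero[OF f(4) ne] by blast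
    qed
  qed
  have "AE x in M. \<forall>n. x \<in> T n" using M_T by (simp add: AE_all_countable)
  hence "AE x in M. x \<in> W_star A B Q \<psi> \<theta>"
  proof eventually_elim
    case (elim x)
    let ?S = "{(p :: int, q :: nat). q \<in> Q \<and> gcd (B q * p + A q) (int q) = 1 \<and>
         \<bar>x - (of_int p + \<theta> q) / real q\<bar> < \<psi> q / real q}"
    let ?v = "\<lambda>z :: int \<times> nat. \<psi> (snd z) / real (snd z)"
    have ex: "\<exists>z\<in>?S. ?v z < (1 / 2) ^ n" for n
    proof -
      have "x \<in> T n" using elim by blast
      from conjunct2[OF f(6)[OF this]] obtain q p where qp: "q \<in> Q" "gcd (B q * p + A q) (int q) = 1" 
        "\<bar>x - (of_int p + \<theta> q) / real q\<bar> < \<psi> q / real q" "\<psi> q / real q < (1 / 2) ^ n"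
        by (elim bexE exE conjE)
      have "(p, q) \<in> ?S" using qp by (simp only: mem_Collect_eq case_prod_conv)
      thus ?thesis using qp(4) by (intro bexI[of _ "(p, q)"]) auto
    qed
    have pos: "?v z > 0" if "z \<in> ?S" for z
    proof -
      have "\<bar>x - (of_int (fst z) + \<theta> (snd z)) / real (snd z)\<bar> < ?v z"
        using that by (simp only: mem_Collect_eq case_prod_unfold)
      thus ?thesis by linarith
    qed
    have "infinite ?S" by (rule infinite_if_arbitrarily_small[OF ex pos])
    moreover have "x \<in> {0..1}" using conjunct1[OF f(6)[of x 0]] elim by simp
    ultimately show ?case unfolding W_star_def mem_Collect_eq by (intro conjI)
  qed
  hence "M \<in> prob_measures_on (W_star A B Q \<psi> \<theta>)" using M by (simp add: prob_measures_on_def)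
  thus ?thesis using M_decay by blast
qed

theorem theorem1:
  fixes Q :: "nat set" and A B :: "nat \<Rightarrow> int" and \<psi> \<theta> :: "nat \<Rightarrow> real"
  assumes "\<And>q. q \<in> Q \<Longrightarrow> q > 0"
    and "\<And>q. q \<in> Q \<Longrightarrow> gcd (A q) (B q) = 1"
    and "\<And>q. q \<in> Q \<Longrightarrow> B q > 0"
    and "\<And>q. q \<in> Q \<Longrightarrow> \<psi> q \<in> {0..<1/2}"
    and "(\<lambda>q. \<psi> q * (\<Prod>l | prime l \<and> l dvd q \<and> \<not> int l dvd B q. 1 - 1 / real l)) summable_on Q"
  shows "fourier_dim (W_star A B Q \<psi> \<theta>) = min (2 * conv_exponent Q \<psi>) 1"
proof -
  let ?W = "W_star A B Q \<psi> \<theta>"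
  define D where "D = {s \<in> {0..1}. \<exists>\<nu> \<in> prob_measures_on ?W. \<exists>C. \<forall>\<xi>.
     cmod (fourier_meas \<nu> \<xi>) \<le> C * (1 + \<bar>\<xi>\<bar>) powr (- s / 2)}"
  have dim: "fourier_dim ?W = Sup (insert 0 D)" by (simp only: fourier_dim_def D_def)
  have bdd: "bdd_above (insert 0 D)" by (rule bdd_aboveI[of _ 1]) (auto simp: D_def)
  have s0: "conv_exponent Q \<psi> \<ge> 0"
    unfolding conv_exponent_def
  proof (rule cInf_greatest)
    show "{s. s \<ge> 0 \<and> (\<lambda>q. (\<psi> q / real q) powr s) summable_on Q} \<noteq> {}"
      using summable_on_powr_2[of Q \<psi>, OF assms(1,4)] by (auto intro!: exI[of _ 2])
  qed auto
  show ?thesis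
  proof (rule antisym)
    show "fourier_dim ?W \<le> min (2 * conv_exponent Q \<psi>) 1"
      unfolding dim
    proof (rule cSup_least)
      fix t assume "t \<in> insert 0 D"
      then consider "t = 0" | "t \<in> D" by blast
      thus "t \<le> min (2 * conv_exponent Q \<psi>) 1"
      proof cases
        case 2
        then obtain \<nu> C where "0 \<le> t" "t \<le> 1" "\<nu> \<in> prob_measures_on ?W" 
          "\<And>\<xi>. cmod (fourier_meas \<nu> \<xi>) \<le> C * (1 + \<bar>\<xi>\<bar>) powr (- t / 2)" unfolding D_def by auto
        thus ?thesis using fourier_decay_exponent_le[of Q A B \<psi> t \<nu> \<theta> C, OF assms(1,2,4,5)] by simp
      qed (use s0 in auto)
    qed simp
    \<comment> \<open>The construction realises only exponents strictly below the minimum, so the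
      supremum is approached from below; exponents t <= 0 are covered by the inserted 0.\<close>
    show "min (2 * conv_exponent Q \<psi>) 1 \<le> fourier_dim ?W"
    proof (rule dense_le)
      fix t assume t: "t < min (2 * conv_exponent Q \<psi>) 1"
      show "t \<le> fourier_dim ?W"
      proof (cases "t \<le> 0")
        case True
        thus ?thesis unfolding dim using cSup_upper[OF _ bdd, of 0] by simp
      next
        case False
        have "\<exists>\<nu>\<in>prob_measures_on ?W. \<exists>C. \<forall>\<xi>. cmod (fourier_meas \<nu> \<xi>) \<le> C * (1 + \<bar>\<xi>\<bar>) powr (- (t / 2))"
          using False t by (intro fourier_decay_attained assms(1,2,4)) auto
        hence "t \<in> D" using False t unfolding D_def by simp
        thus ?thesis unfolding dim by (intro cSup_upper bdd) simp
      qed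
    qed
  qed
qed

end
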